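(* There exists $n_0$ such that for every integer $n \geq n_0$ and every set $P$ of $n$ points in the unit square $[0,1]^2$, there exist three points of $P$ forming a triangle of area at most $n^{-8/7-1/2000}$. *)

theory Defs
  imports "HOL-Analysis.Analysis"
begin

definition triangle_area :: "real ^ 2 \<Rightarrow> real ^ 2 \<Rightarrow> real ^ 2 \<Rightarrow> real" where
  "triangle_area a b c = measure lebesgue (convex hull {a, b, c})"

definition unit_square :: "(real ^ 2) set" where
  "unit_square = {p. \<forall>i. p $ i \<in> {0..1}}"

end

theory Submission
  imports Defs
begin

text \<open>
  Two points of \<open>P\<close> in the same cell of a grid of mesh about \<open>n powr (- 1/2)\<close> span a line; together with one
  of the points this is a flag \<open>(x, a, b)\<close>, the point \<open>(x, a x + b)\<close> on the line of slope \<open>a\<close> and intercept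
  \<open>b\<close>. The triangle on a point of one such pair and both points of another has area at most about \<open>n powr (- 1/2)\<close> times the
  vertical distance \<open>dev\<close> from the point of the first flag to the line of the second. So it is enough that \<open>n\<close> bounded
  flags cannot have all distances above \<open>\<delta> = C * n powr (- 1/s)\<close>, for some \<open>s\<close> with \<open>1/2 + 1/s > 8/7 + 1/2000\<close>; every
  \<open>s > 3/2\<close> works, and \<open>s = 31/20\<close> is used.

  In a minimal counterexample the rescalings \<open>(x / \<alpha>, a / \<beta>, b / (\<alpha> \<beta>))\<close> show that a cell of width \<open>\<alpha>\<close> and slope
  range \<open>\<beta>\<close> has at most \<open>2 n (\<alpha> \<beta>) powr s\<close> flags. With \<open>\<alpha> = w ^ i\<close>, \<open>\<beta> = w ^ j\<close> for a small \<open>w\<close>, the logarithms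
  \<open>G i j\<close> of the covering numbers by these cells are Lipschitz in \<open>(i, j)\<close> and at least \<open>s (i + j) - 2\<close>. As
  \<open>s > 3/2\<close>, some cell \<open>(i, j)\<close> and some \<open>p\<close> satisfy
  \<open>G (i + t) j + G i (j + t) - 2 G i j \<ge> 3 t + 2 D + E\<^sub>0\<close> for all \<open>t \<ge> 2 p\<close>, with \<open>D\<close> a second difference of \<open>G\<close>
  at scale \<open>p\<close>. Cauchy-Schwarz along chains of cells gives, inside that cell, about \<open>w ^ (2 p + D)\<close> times all pairs
  at distance \<open>w ^ (i + j + 2 p)\<close>, and the inequality for \<open>G\<close> is what makes the error of the high-low
  inequality smaller than the main term, so that the expected proportion of close pairs persists at every smaller scale.
  Below the scale \<open>\<delta>\<close> only the pairs of a flag with itself are left, which are too few.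
\<close>

subsection \<open>Slopes of Lipschitz functions on the lattice\<close>

text \<open>The threshold 3/2 comes from the error in the high-low inequality. In a cell with M
  flags one expects about M^2 \<tau> pairs at relative distance \<tau> = w ^ t, while the error is
  about the square root of M^2 M1 M2 / \<tau>, where M1 and M2 are the sizes of cells thinned by
  \<tau> in abscissa or in slope. The error is the smaller one once (M / M1) (M / M2) exceeds \<tau>
  to the power -3. In logarithms this is \<open>axes G i j t\<close> above 3 t; for a linear G with
  both slopes s it reads 2 s > 3. The obstacle is that G is only bounded below by a linear function,
  and at (0, 0) the chains may yield too few starting pairs, a loss measured by D. Hence the search
  for a base point where both requirements hold. It must stay near (0, 0), with p small against m,
  since moving costs part of the gap between 3/2 and the exponent 1 of the final count. The number m
  of scales depends on s alone, while w is the m-th root of \<delta>. So every constant depending on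
  m is below 1 / w once \<delta> is small, and costs G only an additive constant.\<close>

definition axes :: "(nat \<Rightarrow> nat \<Rightarrow> real) \<Rightarrow> nat \<Rightarrow> nat \<Rightarrow> nat \<Rightarrow> real" where
  "axes G i j t = G (i + t) j + G i (j + t) - 2 * G i j"

text \<open>One index step divides one side of the cells by 1 / w and multiplies covering numbers by
  at most a constant times (1 / w)^2; allowing 3 in place of 2 removes the constant
  (\<open>cov_steps\<close>).\<close>

definition step_lipschitz :: "nat \<Rightarrow> (nat \<Rightarrow> nat \<Rightarrow> real) \<Rightarrow> bool" where
  "step_lipschitz m G \<longleftrightarrow> (\<forall>i j. i + j < m \<longrightarrow>
     \<bar>G (Suc i) j - G i j\<bar> \<le> 3 \<and> \<bar>G i (Suc j) - G i j\<bar> \<le> 3)"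

lemma step_lipschitz_fst:
  assumes "step_lipschitz m G" "i + a + j \<le> m"
  shows "\<bar>G (i + a) j - G i j\<bar> \<le> 3 * real a"
  using assms(2)
proof (induction a)
  case (Suc a)
  then have "\<bar>G (i + a) j - G i j\<bar> \<le> 3 * real a" by simp
  moreover have "\<bar>G (Suc (i + a)) j - G (i + a) j\<bar> \<le> 3"
    using assms(1) Suc.prems unfolding step_lipschitz_def by simp
  ultimately show ?case by simp
qed simp

lemma step_lipschitz_snd:
  assumes "step_lipschitz m G" "i + j + b \<le> m"
  shows "\<bar>G i (j + b) - G i j\<bar> \<le> 3 * real b"
  using assms(2)
proof (induction b)
  case (Suc b)
  then have "\<bar>G i (j + b) - G i j\<bar> \<le> 3 * real b" by simp
  moreover have "\<bar>G i (Suc (j + b)) - G i (j + b)\<bar> \<le> 3"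
    using assms(1) Suc.prems unfolding step_lipschitz_def by simp
  ultimately show ?case by simp
qed simp

lemma step_lipschitz_up:
  assumes "step_lipschitz m G" "i + a + (j + b) \<le> m"
  shows "\<bar>G (i + a) (j + b) - G i j\<bar> \<le> 3 * (real a + real b)"
  using step_lipschitz_fst[OF assms(1), of i a "j + b"] step_lipschitz_snd[OF assms(1), of i j b] assms(2)
  by simp

text \<open>The comparison runs through the coordinatewise minimum of the two points, so that it
  never leaves the region where the index sum is at most m.\<close>

lemma step_lipschitz_dist:
  assumes "step_lipschitz m G" "i + j \<le> m" "i' + j' \<le> m"
  shows "\<bar>G i j - G i' j'\<bar> \<le> 3 * (\<bar>real i - real i'\<bar> + \<bar>real j - real j'\<bar>)"
proof -
  define p where "p = min i i'"
  define q where "q = min j j'"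
  obtain a a' where a: "i = p + a" "i' = p + a'" "a = 0 \<or> a' = 0"
    unfolding p_def by (metis add_0_right le_Suc_ex linorder_le_cases min.absorb1 min.absorb2)
  obtain b b' where b: "j = q + b" "j' = q + b'" "b = 0 \<or> b' = 0"
    unfolding q_def by (metis add_0_right le_Suc_ex linorder_le_cases min.absorb1 min.absorb2)
  have "\<bar>G (p + a) (q + b) - G p q\<bar> \<le> 3 * (real a + real b)"
    using step_lipschitz_up[OF assms(1)] assms(2) a b by simp
  moreover have "\<bar>G (p + a') (q + b') - G p q\<bar> \<le> 3 * (real a' + real b')"
    using step_lipschitz_up[OF assms(1)] assms(3) a b by simp
  ultimately have "\<bar>G i j - G i' j'\<bar> \<le> 3 * (real a + real b) + 3 * (real a' + real b')"
    using a b by simp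
  also have "\<dots> = 3 * (\<bar>real i - real i'\<bar> + \<bar>real j - real j'\<bar>)"
    using a b by auto
  finally show ?thesis .
qed

lemma axes_shift:
  assumes "step_lipschitz m G" "i + a + (j + b) + t \<le> m"
  shows "axes G (i + a) (j + b) t \<ge> axes G i j t - 12 * (real a + real b)"
proof -
  have "\<bar>G (i + t + a) (j + b) - G (i + t) j\<bar> \<le> 3 * (real a + real b)"
    using step_lipschitz_up[OF assms(1), of "i + t" a j b] assms(2) by simp
  moreover have "\<bar>G (i + a) (j + t + b) - G i (j + t)\<bar> \<le> 3 * (real a + real b)"
    using step_lipschitz_up[OF assms(1), of i a "j + t" b] assms(2) by simp
  moreover have "\<bar>G (i + a) (j + b) - G i j\<bar> \<le> 3 * (real a + real b)"
    using step_lipschitz_up[OF assms(1), of i a j b] assms(2) by simp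
  ultimately show ?thesis unfolding axes_def by (simp add: add.commute add.left_commute)
qed

section \<open>Supporting slopes and their tilting\<close>

definition excess :: "(nat \<Rightarrow> nat \<Rightarrow> real) \<Rightarrow> nat \<Rightarrow> nat \<Rightarrow> real \<Rightarrow> real \<Rightarrow> nat \<Rightarrow> nat \<Rightarrow> real" where
  "excess G i j x y a b = G (i + a) (j + b) - G i j - (x * real a + y * real b)"

text \<open>The additive 3 is the 2 of the a priori bound \<open>s * real (i + j) - 2\<close>
  together with the bound 1 on \<open>G 0 0\<close>; no tilt makes it worse.\<close>

definition supported :: "(nat \<Rightarrow> nat \<Rightarrow> real) \<Rightarrow> real \<Rightarrow> nat \<Rightarrow> nat \<Rightarrow> real \<Rightarrow> real \<Rightarrow> nat \<Rightarrow> bool" where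
  "supported G \<theta> i j x y W \<longleftrightarrow> (\<forall>a b. a + b \<le> W \<longrightarrow> - \<theta> * (real a + real b) - 3 \<le> excess G i j x y a b)"

text \<open>Complements \<open>supported\<close>: for steps inside the window the supporting slopes
  control \<open>axes\<close>, and this records the growth for longer steps.\<close>

definition axes_grow :: "(nat \<Rightarrow> nat \<Rightarrow> real) \<Rightarrow> nat \<Rightarrow> nat \<Rightarrow> nat \<Rightarrow> nat \<Rightarrow> real \<Rightarrow> bool" where
  "axes_grow G m i j W \<sigma> \<longleftrightarrow> (\<forall>t. W \<le> t \<and> i + j + t \<le> m \<longrightarrow> \<sigma> * real t \<le> axes G i j t)"

lemma supported_slopes_le:
  assumes lip: "step_lipschitz m G" and "i + j + W \<le> m" "supported G \<theta> i j x y W"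
    and "\<theta> \<le> 1/2" "W \<ge> 6"
  shows "x \<le> 4" "y \<le> 4"
proof -
  have "- \<theta> * real W - 3 \<le> G (i + W) j - G i j - x * real W"
    using assms(3)[unfolded supported_def, rule_format, of W 0] unfolding excess_def by simp
  moreover have "\<bar>G (i + W) j - G i j\<bar> \<le> 3 * real W"
    using step_lipschitz_fst[OF lip] assms(2) by simp
  ultimately have "x * real W \<le> (3 + \<theta>) * real W + 3" by (simp add: algebra_simps)
  also have "\<dots> \<le> 4 * real W"
  proof -
    have "\<theta> * real W \<le> 1/2 * real W" by (rule mult_right_mono[OF assms(4)]) simp
    moreover have "(3 + \<theta>) * real W = 3 * real W + \<theta> * real W" by (simp add: algebra_simps)
    moreover have "6 \<le> real W" using assms(5) by simp
    ultimately show ?thesis by linarith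
  qed
  finally show "x \<le> 4" using assms(5) by simp
  have "- \<theta> * real W - 3 \<le> G i (j + W) - G i j - y * real W"
    using assms(3)[unfolded supported_def, rule_format, of 0 W] unfolding excess_def by simp
  moreover have "\<bar>G i (j + W) - G i j\<bar> \<le> 3 * real W"
    using step_lipschitz_snd[OF lip] assms(2) by simp
  ultimately have "y * real W \<le> (3 + \<theta>) * real W + 3" by (simp add: algebra_simps)
  also have "\<dots> \<le> 4 * real W"
  proof -
    have "\<theta> * real W \<le> 1/2 * real W" by (rule mult_right_mono[OF assms(4)]) simp
    moreover have "(3 + \<theta>) * real W = 3 * real W + \<theta> * real W" by (simp add: algebra_simps)
    moreover have "6 \<le> real W" using assms(5) by simp
    ultimately show ?thesis by linarith
  qed
  finally show "y \<le> 4" using assms(5) by simp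
qed

text \<open>If the excess at the diagonal point \<open>(k, k)\<close> is large, subtract from it a function that is concave across the
  diagonal; its minimum is attained away from distance \<open>2 k\<close> and gives a new base point whose supporting slopes
  have a sum larger by \<open>2 ee\<close>.\<close>

lemma tilt_step:
  fixes i j W k m :: nat and \<eta> ee ec :: real
  assumes lip: "step_lipschitz m G" and dom: "i + j + W \<le> m"
    and sup: "supported G (ee/2) i j x y W"
    and \<eta>: "0 < \<eta>" "\<eta> \<le> ec / 28" "ec \<le> 1" and ee: "0 < ee" "ee \<le> ec / 2"
    and k: "2 * k \<le> W" "6 \<le> ee * (2 * real k)"
    and sl: "x \<le> 4" "y \<le> 4" "3 \<le> x + y"
    and viol: "ec * (2 * real k) < excess G i j x y k k"
  shows "\<exists>a b x' y'. a + b \<le> 2 * k \<and> real (a + b) \<le> (1 - \<eta>) * (2 * real k) \<and>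
     x' + y' = x + y + 2 * ee \<and> excess G i j x y a b \<le> ee * (2 * real k) \<and>
     (\<forall>W'. real W' \<le> \<eta>\<^sup>2 / 4 * (2 * real k) \<longrightarrow> supported G (ee/2) (i + a) (j + b) x' y' W')"
proof -
  define r where "r = 2 * real k"
  \<comment> \<open>The curvature C is large enough to force the minimiser within \<eta> r of the
    diagonal, yet on a window of length \<eta>^2 r / 4 the quadratic term stays below the slope
    error ee / 2.\<close>
  define C where "C = 2 / \<eta>\<^sup>2"
  define \<phi> where "\<phi> = (\<lambda>(a::nat, b::nat). ee * (real a + real b - C * (real a - real b)\<^sup>2 / r))"
  define E where "E = (\<lambda>(a, b). excess G i j x y a b)"
  define S where "S = {(a, b). a + b \<le> 2 * k}"
  have r6: "6 \<le> ee * r" using k r_def by simp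
  have rpos: "r > 0" using r6 ee by (metis less_le_trans zero_less_mult_pos zero_less_numeral)
  have "S \<subseteq> {..2*k} \<times> {..2*k}" unfolding S_def by auto
  then have fin: "finite S" by (rule finite_subset) simp
  have "(0, 0) \<in> S" unfolding S_def by simp
  then obtain p where p: "p \<in> S" "\<And>q. q \<in> S \<Longrightarrow> E p - \<phi> p \<le> E q - \<phi> q"
    using ex_min_if_finite[of "(\<lambda>q. E q - \<phi> q) ` S"] fin
    by (metis (no_types, lifting) empty_iff arg_min_if_finite(1) arg_min_least)
  obtain a b where ab: "p = (a, b)" by (metis surj_pair)
  define d where "d = real a - real b"
  define \<tau> where "\<tau> = real a + real b"
  have abk: "a + b \<le> 2 * k" using p(1) ab S_def by simp
  then have \<tau>r: "\<tau> \<le> r" "0 \<le> \<tau>" unfolding \<tau>_def r_def by linarith+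
  have E0: "E (0, 0) = 0" "\<phi> (0, 0) = 0" unfolding E_def excess_def \<phi>_def by simp_all
  have Ep: "excess G i j x y a b \<le> ee * (\<tau> - C * d\<^sup>2 / r)"
    using p(2)[OF \<open>(0,0) \<in> S\<close>] E0 ab unfolding E_def \<phi>_def \<tau>_def d_def by simp
  have low: "- (ee/2) * \<tau> - 3 \<le> excess G i j x y a b"
    using sup abk k(1) unfolding supported_def \<tau>_def by simp
  have Cpos: "C > 0" unfolding C_def using \<eta> by simp
  \<comment> \<open>The minimum is at most the value 0 at the origin, and \<open>low\<close> keeps
    the excess from being very negative, so the subtracted square cannot be large.\<close>
  have "C * d\<^sup>2 / r \<le> 2 * r"
  proof -
    have "ee * (C * d\<^sup>2 / r) \<le> ee * \<tau> + (ee/2) * \<tau> + 3" using Ep low by (simp add: algebra_simps)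
    also have "\<dots> \<le> ee * r + (ee/2) * r + (ee/2) * r"
    proof -
      have "ee * \<tau> \<le> ee * r" using \<tau>r(1) ee by simp
      then show ?thesis using r6 by linarith
    qed
    finally have "ee * (C * d\<^sup>2 / r) \<le> ee * (2 * r)" by simp
    then show ?thesis using ee mult_le_cancel_left_pos by blast
  qed
  then have "2 * d\<^sup>2 / (\<eta>\<^sup>2 * r) \<le> 2 * r" unfolding C_def by simp
  then have "d\<^sup>2 \<le> (\<eta> * r)\<^sup>2"
    using rpos \<eta> by (simp add: field_simps power2_eq_square)
  then have d: "\<bar>d\<bar> \<le> \<eta> * r" using rpos \<eta> by (simp add: abs_le_square_iff[symmetric])
  have Er: "excess G i j x y a b \<le> ee * r"
  proof -
    have "0 \<le> C * d\<^sup>2 / r" using Cpos rpos by simp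
    then have "\<tau> - C * d\<^sup>2 / r \<le> r" using \<tau>r by linarith
    then show ?thesis using Ep mult_left_mono[of "\<tau> - C * d\<^sup>2 / r" r ee] ee by linarith
  qed
  \<comment> \<open>Otherwise (a, b) is within 2 \<eta> r of (k, k). The excess changes by at most 3
    + 4 = 7 per unit, and 14 \<eta> \<le> ec / 2 then contradicts the large excess at (k, k); this
    fixes the constant 28.\<close>
  have \<tau>small: "\<tau> \<le> (1 - \<eta>) * r"
  proof (rule ccontr)
    assume "\<not> ?thesis"
    then have far: "r - \<tau> \<le> \<eta> * r" by (simp add: algebra_simps)
    define D where "D = \<bar>real a - real k\<bar> + \<bar>real b - real k\<bar>"
    have D: "D \<le> 2 * (\<eta> * r)"
    proof -
      have "D \<le> \<bar>\<tau> - r\<bar> + \<bar>d\<bar>" unfolding D_def \<tau>_def r_def d_def by linarith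
      then show ?thesis using far d \<tau>r by linarith
    qed
    have "\<bar>G (i + a) (j + b) - G (i + k) (j + k)\<bar> \<le> 3 * D"
      using step_lipschitz_dist[OF lip, of "i + a" "j + b" "i + k" "j + k"] abk k(1) dom
      unfolding D_def by simp
    moreover have "\<bar>x * (real a - real k) + y * (real b - real k)\<bar> \<le> 4 * D"
    proof -
      have "\<bar>x * (real a - real k)\<bar> \<le> 4 * \<bar>real a - real k\<bar>" "\<bar>y * (real b - real k)\<bar> \<le> 4 * \<bar>real b - real k\<bar>"
        using sl by (auto simp: abs_mult intro!: mult_right_mono)
      then have "\<bar>x * (real a - real k)\<bar> + \<bar>y * (real b - real k)\<bar> \<le> 4 * D" unfolding D_def by simp
      then show ?thesis using abs_triangle_ineq order_trans by blast
    qed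
    ultimately have "\<bar>excess G i j x y a b - excess G i j x y k k\<bar> \<le> 7 * D"
      unfolding excess_def by (simp add: algebra_simps abs_le_iff)
    moreover have "14 * (\<eta> * r) \<le> ec / 2 * r"
      using mult_right_mono[OF \<eta>(2), of r] rpos by simp
    moreover have "ee * r \<le> ec / 2 * r" using mult_right_mono[OF ee(2), of r] rpos by simp
    ultimately show False using viol D Er unfolding r_def by linarith
  qed
  \<comment> \<open>The new slopes are the old ones plus the gradient of \<phi> at the minimiser;
    the terms in d cancel in the sum.\<close>
  define x' where "x' = x + ee * (1 - 2 * C * d / r)"
  define y' where "y' = y + ee * (1 + 2 * C * d / r)"
  have sup': "supported G (ee/2) (i + a) (j + b) x' y' W'" if W': "real W' \<le> \<eta>\<^sup>2 / 4 * r" for W'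
    unfolding supported_def
  proof (intro allI impI)
    fix a' b' :: nat assume ab': "a' + b' \<le> W'"
    define \<tau>' where "\<tau>' = real a' + real b'"
    define d' where "d' = real a' - real b'"
    have \<tau>': "\<tau>' \<le> real W'" "0 \<le> \<tau>'" using ab' unfolding \<tau>'_def by linarith+
    have "\<eta>\<^sup>2 / 4 \<le> \<eta>" using \<eta> by (simp add: power2_eq_square)
    then have "real W' \<le> \<eta> * r" using W' rpos by (meson mult_right_mono less_eq_real_def order_trans)
    then have "\<tau> + \<tau>' \<le> r" using \<tau>small \<tau>' by (simp add: algebra_simps)
    then have "a + a' + (b + b') \<le> 2 * k" unfolding \<tau>_def \<tau>'_def r_def by linarith
    then have "(a + a', b + b') \<in> S" unfolding S_def by simp
    from p(2)[OF this] have "excess G i j x y a b - ee * (\<tau> - C * d\<^sup>2 / r)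
        \<le> excess G i j x y (a + a') (b + b') - ee * (\<tau> + \<tau>' - C * (d + d')\<^sup>2 / r)"
      unfolding ab E_def \<phi>_def \<tau>_def \<tau>'_def d_def d'_def by (simp add: algebra_simps)
    moreover have "excess G (i + a) (j + b) x' y' a' b' =
        excess G i j x y (a + a') (b + b') - excess G i j x y a b - ee * (\<tau>' - 2 * C * d * d' / r)"
      unfolding excess_def x'_def y'_def \<tau>'_def d'_def by (simp add: algebra_simps diff_divide_distrib add_divide_distrib)
    moreover have "(d + d')\<^sup>2 = d\<^sup>2 + 2 * d * d' + d'\<^sup>2" by (simp add: power2_sum)
    ultimately have "- ee * (C * d'\<^sup>2 / r) \<le> excess G (i + a) (j + b) x' y' a' b'"
      by (simp add: algebra_simps diff_divide_distrib add_divide_distrib)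
    moreover have "ee * (C * d'\<^sup>2 / r) \<le> ee/2 * \<tau>'"
    proof -
      have "\<bar>d'\<bar> \<le> \<tau>'" unfolding d'_def \<tau>'_def by linarith
      then have "d'\<^sup>2 \<le> \<tau>' * \<tau>'" by (metis abs_le_square_iff abs_of_nonneg \<tau>'(2) power2_eq_square)
      also have "\<dots> \<le> \<tau>' * (\<eta>\<^sup>2 / 4 * r)" using \<tau>' W' by (intro mult_left_mono) auto
      finally have "C * d'\<^sup>2 / r \<le> C * (\<tau>' * (\<eta>\<^sup>2 / 4 * r)) / r"
        using Cpos rpos by (intro divide_right_mono mult_left_mono) auto
      also have "\<dots> = \<tau>' / 2" unfolding C_def using \<eta> rpos by (simp add: field_simps)
      finally have "ee * (C * d'\<^sup>2 / r) \<le> ee * (\<tau>' / 2)" using ee by (intro mult_left_mono) auto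
      then show ?thesis by simp
    qed
    ultimately show "- (ee/2) * (real a' + real b') - 3 \<le> excess G (i + a) (j + b) x' y' a' b'"
      unfolding \<tau>'_def by linarith
  qed
  show ?thesis
    using abk \<tau>small Er sup' unfolding r_def \<tau>_def
    by (intro exI[of _ a] exI[of _ b] exI[of _ x'] exI[of _ y'] conjI)
       (auto simp: x'_def y'_def algebra_simps)
qed

text \<open>A tilt shrinks the window, so growth of \<open>axes\<close> has to be shown for shorter
  steps and from the new base. If the step stays in the old window, the old supporting slopes and
  the small excess at the new base give it. Otherwise t is at least W / 2, and moving the base by at
  most 2 k \<le> 2 \<rho> W costs at most 48 \<rho> t.\<close>

lemma tilt_step_grow:
  fixes i j W k m :: nat and \<eta> ee ec \<rho> \<beta> \<sigma> :: real
  assumes lip: "step_lipschitz m G" and dom: "i + j + W \<le> m"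
    and sup: "supported G (ee/2) i j x y W" and grow: "axes_grow G m i j W \<sigma>"
    and \<eta>: "0 < \<eta>" "\<eta> \<le> ec / 28" "ec \<le> 1" and ee: "0 < ee" "ee \<le> ec / 2"
    and \<beta>: "48 * ee \<le> \<beta> * \<eta>\<^sup>2" "0 < \<beta>" "\<beta> \<le> 1" and \<sigma>: "\<sigma> \<le> x + y - \<beta>" "3 \<le> x + y"
    and \<rho>: "0 < \<rho>" "\<rho> \<le> 1/4"
    and k: "real k \<le> \<rho> * real W" "24 \<le> \<beta> * (\<eta>\<^sup>2 / 4 * real k)" "6 \<le> ee * (2 * real k)"
    and viol: "ec * (2 * real k) < excess G i j x y k k"
  shows "\<exists>a b x' y' W'. a + b \<le> 2 * k \<and> x' + y' = x + y + 2 * ee \<and>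
     \<eta>\<^sup>2 / 4 * real k \<le> real W' \<and> 2 * W' \<le> W \<and> i + a + (j + b) + W' \<le> m \<and>
     supported G (ee/2) (i + a) (j + b) x' y' W' \<and>
     axes_grow G m (i + a) (j + b) W' (\<sigma> - 48 * \<rho>)"
proof -
  have \<eta>1: "\<eta> \<le> 1" using \<eta> by linarith
  then have \<eta>2: "\<eta>\<^sup>2 \<le> 1" using \<eta>(1) by (simp add: power_le_one)
  have kW: "4 * real k \<le> real W"
    using k(1) mult_right_mono[OF \<rho>(2), of "real W"] by simp
  have "24 \<le> \<beta> * (\<eta>\<^sup>2 / 4 * real k)" by (rule k(2))
  also have "\<dots> \<le> 1 * (\<eta>\<^sup>2 / 4 * real k)" using \<beta> by (intro mult_right_mono) auto
  finally have q24: "24 \<le> \<eta>\<^sup>2 / 4 * real k" by simp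
  have "\<eta>\<^sup>2 / 4 * real k \<le> 1 / 4 * real k" using \<eta>2 by (intro mult_right_mono) auto
  then have k96: "96 \<le> real k" "\<eta>\<^sup>2 / 4 * real k \<le> real k / 4" using q24 by simp_all
  have W6: "W \<ge> 6" using k96 kW by linarith
  have th: "ee / 2 \<le> 1/2" using ee \<eta>(3) by simp
  note sl = supported_slopes_le[OF lip dom sup th W6]
  have kW': "2 * k \<le> W" using kW by linarith
  obtain a b x' y' where ab: "a + b \<le> 2 * k" "real (a + b) \<le> (1 - \<eta>) * (2 * real k)"
     "x' + y' = x + y + 2 * ee" "excess G i j x y a b \<le> ee * (2 * real k)"
     "\<And>W'. real W' \<le> \<eta>\<^sup>2 / 4 * (2 * real k) \<Longrightarrow> supported G (ee/2) (i + a) (j + b) x' y' W'"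
    using tilt_step[OF lip dom sup \<eta> ee kW' k(3) sl \<sigma>(2) viol] by blast
  define W' where "W' = nat \<lfloor>\<eta>\<^sup>2 / 4 * (2 * real k)\<rfloor>"
  have W'up: "real W' \<le> \<eta>\<^sup>2 / 4 * (2 * real k)" unfolding W'_def using \<eta>(1) by (intro of_nat_floor) simp
  have W'lo: "\<eta>\<^sup>2 / 4 * real k \<le> real W'"
    using q24 unfolding W'_def by linarith
  have W'k: "real W' \<le> real k / 2" using W'up k96(2) by linarith
  define r where "r = 2 * real k"
  have abr: "real a + real b \<le> r" using ab(1) unfolding r_def by linarith
  have grow': "(\<sigma> - 48 * \<rho>) * real t \<le> axes G (i + a) (j + b) t"
    if t: "W' \<le> t" "i + a + (j + b) + t \<le> m" for t
  proof (cases "t + 2 * k \<le> W")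
    case True
    have A: "- (ee/2) * (real a + real t + real b) - 3 \<le> excess G i j x y (a + t) b"
      using sup[unfolded supported_def, rule_format, of "a + t" b] ab(1) True by simp
    have B: "- (ee/2) * (real a + real b + real t) - 3 \<le> excess G i j x y a (b + t)"
      using sup[unfolded supported_def, rule_format, of a "b + t"] ab(1) True by (simp add: add.assoc)
    have eq: "axes G (i + a) (j + b) t = (x + y) * real t + excess G i j x y (a + t) b
        + excess G i j x y a (b + t) - 2 * excess G i j x y a b"
      unfolding axes_def excess_def by (simp add: algebra_simps)
    have ab_ee: "ee * (real a + real b) \<le> ee * r" using abr ee by (intro mult_left_mono) auto
    have "axes G (i + a) (j + b) t \<ge> (x + y) * real t - ee * real t - 3 * (ee * r) - 6"
    proof -
      define u v where "u = ee * (real a + real b)" and "v = ee * real t"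
      have "- u / 2 - v / 2 - 3 \<le> excess G i j x y (a + t) b" "- u / 2 - v / 2 - 3 \<le> excess G i j x y a (b + t)"
        using A B unfolding u_def v_def by (simp_all add: field_simps)
      moreover have "u \<le> ee * r" "excess G i j x y a b \<le> ee * r"
        using ab(4) ab_ee unfolding r_def u_def by simp_all
      ultimately show ?thesis unfolding eq v_def[symmetric] by linarith
    qed
    moreover have "ee * real t + 3 * (ee * r) + 6 \<le> \<beta> * real t"
    proof -
      have t1: "\<eta>\<^sup>2 / 4 * real k \<le> real t" using W'lo t(1) by linarith
      have "48 * ee * real k \<le> \<beta> * \<eta>\<^sup>2 * real k" using \<beta>(1) by (intro mult_right_mono) auto
      then have "12 * (ee * real k) \<le> \<beta> * (\<eta>\<^sup>2 / 4 * real k)" by simp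
      also have "\<dots> \<le> \<beta> * real t" using t1 \<beta> by (intro mult_left_mono) auto
      finally have 1: "6 * (ee * real k) \<le> \<beta> * real t / 2" by simp
      have "24 \<le> \<beta> * real t" using k(2) mult_left_mono[OF t1, of \<beta>] \<beta> by linarith
      moreover have "48 * ee \<le> \<beta>" using \<beta>(1) mult_left_mono[OF \<eta>2, of \<beta>] \<beta>(2) by linarith
      then have "48 * ee * real t \<le> \<beta> * real t" by (intro mult_right_mono) auto
      ultimately show ?thesis using 1 unfolding r_def by simp
    qed
    ultimately have "axes G (i + a) (j + b) t \<ge> (x + y - \<beta>) * real t" by (simp add: algebra_simps)
    moreover have "(\<sigma> - 48 * \<rho>) * real t \<le> (x + y - \<beta>) * real t"
      using \<sigma>(1) \<rho>(1) by (intro mult_right_mono) auto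
    ultimately show ?thesis by linarith
  next
    case False
    have tW: "real W \<le> 2 * real t" using False kW by linarith
    have "\<sigma> * real t \<le> axes G i j t"
    proof (cases "W \<le> t")
      case True
      then show ?thesis using grow t(2) unfolding axes_grow_def by simp
    next
      case False
      have A: "- (ee/2) * real t - 3 \<le> excess G i j x y t 0"
        using sup[unfolded supported_def, rule_format, of t 0] False by simp
      have B: "- (ee/2) * real t - 3 \<le> excess G i j x y 0 t"
        using sup[unfolded supported_def, rule_format, of 0 t] False by simp
      have "axes G i j t = (x + y) * real t + excess G i j x y t 0 + excess G i j x y 0 t"
        unfolding axes_def excess_def by (simp add: algebra_simps)
      then have "(x + y) * real t - ee * real t - 6 \<le> axes G i j t" using A B by simp
      moreover have "ee * real t + 6 \<le> \<beta> * real t"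
      proof -
        have "\<eta>\<^sup>2 / 4 * real k \<le> real t" using k96(2) tW kW by linarith
        then have "24 \<le> \<beta> * real t" using k(2) mult_left_mono[of _ "real t" \<beta>] \<beta> by (meson less_eq_real_def order_trans)
        moreover have "48 * ee \<le> \<beta>" using \<beta>(1) mult_left_mono[OF \<eta>2, of \<beta>] \<beta>(2) by linarith
        then have "48 * ee * real t \<le> \<beta> * real t" by (intro mult_right_mono) auto
        ultimately show ?thesis by simp
      qed
      moreover have "\<sigma> * real t \<le> (x + y - \<beta>) * real t" using \<sigma>(1) by (intro mult_right_mono) auto
      ultimately show ?thesis by (simp add: algebra_simps)
    qed
    moreover have "axes G (i + a) (j + b) t \<ge> axes G i j t - 12 * (real a + real b)"
      by (rule axes_shift[OF lip t(2)])
    moreover have "12 * (real a + real b) \<le> 48 * \<rho> * real t"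
    proof -
      have "12 * (real a + real b) \<le> 24 * (\<rho> * real W)" using abr k(1) unfolding r_def by simp
      also have "\<dots> \<le> 24 * (\<rho> * (2 * real t))" using tW \<rho>(1) by (intro mult_left_mono) auto
      finally show ?thesis by simp
    qed
    ultimately show ?thesis by (simp add: algebra_simps)
  qed
  have "2 * W' \<le> W" using W'k kW by linarith
  moreover have "i + a + (j + b) + W' \<le> m"
  proof -
    have "a + b + W' \<le> W" using ab(1) W'k kW by linarith
    then show ?thesis using dom by linarith
  qed
  ultimately show ?thesis using ab(1,3) W'lo ab(5)[OF W'up] grow' unfolding axes_grow_def by blast
qed

text \<open>Supporting slopes never exceed 4, so only boundedly many tilts are possible before the diagonal excess is small.\<close>

lemma tilt_iterate:
  fixes m :: nat and \<eta> ee ec \<rho> \<beta> \<epsilon> Wmin :: real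
  assumes lip: "step_lipschitz m G"
    and \<eta>: "0 < \<eta>" "\<eta> \<le> ec / 28" "ec \<le> 1" and ee: "0 < ee" "ee \<le> ec / 2"
    and \<beta>: "48 * ee \<le> \<beta> * \<eta>\<^sup>2" "0 < \<beta>" "\<beta> \<le> 1"
    and \<rho>: "0 < \<rho>" "\<rho> \<le> 1/4" and \<epsilon>: "0 < \<epsilon>" "\<epsilon> \<le> 1"
    and big: "24 \<le> \<beta> * (\<eta>\<^sup>2 / 4 * (\<epsilon> * \<rho> * Wmin))" "6 \<le> ee * (2 * (\<epsilon> * \<rho> * Wmin))" "6 \<le> Wmin"
  defines "c \<equiv> \<eta>\<^sup>2 / 4 * (\<epsilon> * \<rho>)"
  shows "\<lbrakk>i + j + W \<le> m; supported G (ee/2) i j x y W; axes_grow G m i j W \<sigma>; \<sigma> \<le> x + y - \<beta>;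
     3 \<le> x + y; 8 < x + y + 2 * ee * real n; Wmin \<le> c ^ n * real W\<rbrakk> \<Longrightarrow>
    \<exists>i' j' x' y' W'. i' + j' + W' \<le> m \<and> supported G (ee/2) i' j' x' y' W' \<and>
      axes_grow G m i' j' W' (\<sigma> - 48 * \<rho> * real n) \<and> x + y \<le> x' + y' \<and> Wmin \<le> real W' \<and> W' \<le> W \<and>
      real (i' + j') \<le> real (i + j) + 4 * \<rho> * real W \<and>
      (\<forall>k. \<epsilon> * \<rho> * real W' \<le> real k \<and> real k \<le> \<rho> * real W' \<longrightarrow>
          excess G i' j' x' y' k k \<le> ec * (2 * real k))"
proof (induction n arbitrary: i j W x y \<sigma>)
  \<comment> \<open>n counts the tilts that can still be afforded. With none left, x + y would
    exceed 8, so this case is vacuous.\<close>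
  case 0
  have W: "Wmin \<le> real W" using 0 by simp
  have "W \<ge> 6" using W big(3) by linarith
  moreover have "ee / 2 \<le> 1/2" using ee \<eta>(3) by simp
  ultimately have "x \<le> 4" "y \<le> 4" using supported_slopes_le[OF lip 0(1,2)] by blast+
  then show ?case using 0 by simp
next
  case (Suc n)
  have "\<eta>\<^sup>2 \<le> 1" using \<eta> by (simp add: power_le_one)
  moreover have "\<epsilon> * \<rho> \<le> 1 * 1" using \<epsilon> \<rho> by (intro mult_mono) auto
  ultimately have "\<eta>\<^sup>2 / 4 * (\<epsilon> * \<rho>) \<le> 1 * 1" using \<epsilon> \<rho> by (intro mult_mono) auto
  then have c: "0 < c" "c \<le> 1" unfolding c_def using \<eta> \<epsilon> \<rho> by auto
  have W: "Wmin \<le> real W"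
    using Suc.prems(7) c mult_right_mono[of "c ^ Suc n" 1 "real W"] by (simp add: power_le_one del: power_Suc)
  show ?case
  proof (cases "\<forall>k. \<epsilon> * \<rho> * real W \<le> real k \<and> real k \<le> \<rho> * real W \<longrightarrow>
          excess G i j x y k k \<le> ec * (2 * real k)")
    case True
    have "axes_grow G m i j W (\<sigma> - 48 * \<rho> * real (Suc n))"
      unfolding axes_grow_def
    proof (intro allI impI)
      fix t assume t: "W \<le> t \<and> i + j + t \<le> m"
      have "(\<sigma> - 48 * \<rho> * real (Suc n)) * real t \<le> \<sigma> * real t"
        using \<rho> by (intro mult_right_mono) auto
      then show "(\<sigma> - 48 * \<rho> * real (Suc n)) * real t \<le> axes G i j t"
        using Suc.prems(3) t unfolding axes_grow_def by fastforce
    qed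
    moreover have "real (i + j) \<le> real (i + j) + 4 * \<rho> * real W" using \<rho> by simp
    ultimately show ?thesis using True Suc.prems(1,2) W by blast
  next
    case False
    then obtain k where k: "\<epsilon> * \<rho> * real W \<le> real k" "real k \<le> \<rho> * real W"
        "ec * (2 * real k) < excess G i j x y k k" by (auto simp: not_le)
    have k': "\<epsilon> * \<rho> * Wmin \<le> real k"
    proof -
      have "\<epsilon> * \<rho> * Wmin \<le> \<epsilon> * \<rho> * real W" using W \<epsilon> \<rho> by (intro mult_left_mono) auto
      then show ?thesis using k(1) by linarith
    qed
    have b1: "24 \<le> \<beta> * (\<eta>\<^sup>2 / 4 * real k)"
    proof -
      have "\<beta> * (\<eta>\<^sup>2 / 4 * (\<epsilon> * \<rho> * Wmin)) \<le> \<beta> * (\<eta>\<^sup>2 / 4 * real k)"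
        using k' \<beta> by (intro mult_left_mono) auto
      then show ?thesis using big(1) by linarith
    qed
    have b2: "6 \<le> ee * (2 * real k)"
    proof -
      have "ee * (2 * (\<epsilon> * \<rho> * Wmin)) \<le> ee * (2 * real k)" using k' ee by (intro mult_left_mono) auto
      then show ?thesis using big(2) by linarith
    qed
    obtain a b x' y' W' where st: "a + b \<le> 2 * k" "x' + y' = x + y + 2 * ee"
       "\<eta>\<^sup>2 / 4 * real k \<le> real W'" "2 * W' \<le> W" "i + a + (j + b) + W' \<le> m"
       "supported G (ee/2) (i + a) (j + b) x' y' W'" "axes_grow G m (i + a) (j + b) W' (\<sigma> - 48 * \<rho>)"
      using tilt_step_grow[OF lip Suc.prems(1,2,3) \<eta> ee \<beta> Suc.prems(4,5) \<rho> k(2) b1 b2 k(3)] by blast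
    have p1: "\<sigma> - 48 * \<rho> \<le> x' + y' - \<beta>" "3 \<le> x' + y'" "8 < x' + y' + 2 * ee * real n"
      using Suc.prems(4-6) st(2) \<rho> ee by (auto simp: algebra_simps)
    have "c * real W \<le> real W'"
      using st(3) mult_left_mono[OF k(1), of "\<eta>\<^sup>2 / 4"] unfolding c_def by (simp add: mult.assoc)
    then have "c ^ n * (c * real W) \<le> c ^ n * real W'" using c by (intro mult_left_mono) auto
    then have p2: "Wmin \<le> c ^ n * real W'" using Suc.prems(7) by (simp add: mult_ac)
    obtain i' j' x'' y'' W'' where fin: "i' + j' + W'' \<le> m" "supported G (ee/2) i' j' x'' y'' W''"
      "axes_grow G m i' j' W'' (\<sigma> - 48 * \<rho> - 48 * \<rho> * real n)" "x' + y' \<le> x'' + y''" "Wmin \<le> real W''" "W'' \<le> W'"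
      "real (i' + j') \<le> real (i + a + (j + b)) + 4 * \<rho> * real W'"
      "\<forall>k. \<epsilon> * \<rho> * real W'' \<le> real k \<and> real k \<le> \<rho> * real W'' \<longrightarrow>
          excess G i' j' x'' y'' k k \<le> ec * (2 * real k)"
      using Suc.IH[OF st(5-7) p1 p2] by blast
    have "real (i' + j') \<le> real (i + j) + 4 * \<rho> * real W"
    proof -
      have "real (a + b) \<le> 2 * (\<rho> * real W)" using st(1) k(2) by linarith
      moreover have "\<rho> * (2 * real W') \<le> \<rho> * real W" using st(4) \<rho> by (intro mult_left_mono) auto
      ultimately show ?thesis using fin(7) by simp
    qed
    moreover have "\<sigma> - 48 * \<rho> - 48 * \<rho> * real n = \<sigma> - 48 * \<rho> * real (Suc n)" by (simp add: algebra_simps)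
    moreover have "x + y \<le> x'' + y''" "W'' \<le> W" using fin(4,6) st(2,4) ee by linarith+
    ultimately show ?thesis using fin(1,2,3,5,8) by metis
  qed
qed

text \<open>The search starts at (0, 0) with both slopes s and the whole triangle as window, where
  support is the a priori bound on G. The number n of tilts depends only on \<beta> and ec, so
  \<rho> can be chosen after it: n losses of 48 \<rho> add up to at most \<beta>, and \<rho> \<le>
  1/320 turns the total drift 4 \<rho> m of the base point into m / 80.\<close>

lemma contact_exists:
  fixes s \<beta> ec \<rho> \<epsilon> :: real and n0 :: nat
  assumes s: "s = 3/2 + 3 * \<beta>" and \<beta>: "0 < \<beta>" "\<beta> \<le> 1" and ec: "0 < ec" "ec \<le> \<beta>" and \<epsilon>: "0 < \<epsilon>" "\<epsilon> \<le> 1"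
  shows "\<exists>\<rho>. 0 < \<rho> \<and> \<rho> \<le> 1/320 \<and> \<rho> \<le> \<beta>/48 \<and> (\<forall>W0. \<exists>m0. \<forall>m\<ge>m0. \<forall>G. step_lipschitz m G \<longrightarrow> G 0 0 \<le> 1 \<longrightarrow>
     (\<forall>i j. i + j \<le> m \<longrightarrow> s * real (i + j) - 2 \<le> G i j) \<longrightarrow>
     (\<exists>i j x y W. i + j + W \<le> m \<and> supported G ec i j x y W \<and> axes_grow G m i j W (3 + 4 * \<beta>) \<and>
        2 * s \<le> x + y \<and> x \<le> 4 \<and> y \<le> 4 \<and> W0 \<le> real W \<and> real (i + j) \<le> real m / 80 \<and>
        (\<forall>k. \<epsilon> * \<rho> * real W \<le> real k \<and> real k \<le> \<rho> * real W \<longrightarrow>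
          excess G i j x y k k \<le> ec * (2 * real k))))"
proof -
  define \<eta> where "\<eta> = ec / 28"
  define ee where "ee = ec * \<beta> * \<eta>\<^sup>2 / 48"
  have ec1: "ec \<le> 1" using ec \<beta> by linarith
  have \<eta>: "0 < \<eta>" "\<eta> \<le> ec / 28" "\<eta> \<le> 1" using ec ec1 unfolding \<eta>_def by auto
  have "\<eta>\<^sup>2 \<le> 1" using \<eta> by (simp add: power_le_one)
  then have "\<beta> * \<eta>\<^sup>2 \<le> 1 * 1" using \<beta> by (intro mult_mono) auto
  then have "ec * (\<beta> * \<eta>\<^sup>2) \<le> ec * 1" using ec by (intro mult_left_mono) auto
  moreover have "ec * (\<beta> * \<eta>\<^sup>2) \<le> 1 * (\<beta> * \<eta>\<^sup>2)" using ec1 \<beta> by (intro mult_right_mono) auto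
  moreover have "0 < ec * (\<beta> * \<eta>\<^sup>2)" using ec \<beta> \<eta> by simp
  ultimately have ee: "0 < ee" "ee \<le> ec / 2" "48 * ee \<le> \<beta> * \<eta>\<^sup>2"
    unfolding ee_def using ec by (simp_all add: mult.assoc)
  \<comment> \<open>The slopes have sum at least 3 and each tilt adds 2 ee; n tilts would bring the
    sum to at least 13, above the cap 8.\<close>
  define n where "n = nat \<lceil>5 / ee\<rceil>"
  have n: "5 \<le> ee * real n"
  proof -
    have "5 / ee \<le> real n" unfolding n_def by linarith
    then show ?thesis using ee by (simp add: field_simps)
  qed
  define \<rho> where "\<rho> = min (1/320) (\<beta> / (48 * (real n + 1)))"
  have \<rho>: "0 < \<rho>" "\<rho> \<le> 1/320"
  proof -
    have "0 < \<beta> / (48 * (real n + 1))" using \<beta> by (intro divide_pos_pos) auto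
    then show "0 < \<rho>" "\<rho> \<le> 1/320" unfolding \<rho>_def by linarith+
  qed
  then have \<rho>4: "\<rho> \<le> 1/4" by simp
  have \<rho>n: "48 * \<rho> * real n \<le> \<beta>" "\<rho> \<le> \<beta> / 48"
  proof -
    have "\<rho> \<le> \<beta> / (48 * (real n + 1))" unfolding \<rho>_def by simp
    then have "\<rho> * (48 * (real n + 1)) \<le> \<beta>" by (simp add: field_simps)
    then show "48 * \<rho> * real n \<le> \<beta>" using \<rho> by (simp add: algebra_simps)
    then have "\<rho> * 48 \<le> \<rho> * (48 * (real n + 1))" using \<rho> by (intro mult_left_mono) auto
    then show "\<rho> \<le> \<beta> / 48" using \<open>\<rho> * (48 * (real n + 1)) \<le> \<beta>\<close> by simp
  qed
  define c where "c = \<eta>\<^sup>2 / 4 * (\<epsilon> * \<rho>)"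
  have c: "0 < c" unfolding c_def using \<eta> \<epsilon> \<rho> by simp
  have ex: "\<exists>m0. \<forall>m\<ge>m0. \<forall>G. step_lipschitz m G \<longrightarrow> G 0 0 \<le> 1 \<longrightarrow>
     (\<forall>i j. i + j \<le> m \<longrightarrow> s * real (i + j) - 2 \<le> G i j) \<longrightarrow>
     (\<exists>i j x y W. i + j + W \<le> m \<and> supported G ec i j x y W \<and> axes_grow G m i j W (3 + 4 * \<beta>) \<and>
        2 * s \<le> x + y \<and> x \<le> 4 \<and> y \<le> 4 \<and> W0 \<le> real W \<and> real (i + j) \<le> real m / 80 \<and>
        (\<forall>k. \<epsilon> * \<rho> * real W \<le> real k \<and> real k \<le> \<rho> * real W \<longrightarrow>
          excess G i j x y k k \<le> ec * (2 * real k)))" for W0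
  proof -
    define Wmin where "Wmin = max W0 (max 6 (max (24 / (\<beta> * (\<eta>\<^sup>2 / 4 * (\<epsilon> * \<rho>)))) (6 / (ee * (2 * (\<epsilon> * \<rho>))))))"
    have "24 / (\<beta> * (\<eta>\<^sup>2 / 4 * (\<epsilon> * \<rho>))) \<le> Wmin" "6 / (ee * (2 * (\<epsilon> * \<rho>))) \<le> Wmin" unfolding Wmin_def by auto
    moreover have "0 < \<beta> * (\<eta>\<^sup>2 / 4 * (\<epsilon> * \<rho>))" "0 < ee * (2 * (\<epsilon> * \<rho>))" using \<beta> \<eta> \<epsilon> \<rho> ee by simp_all
    ultimately have "24 \<le> Wmin * (\<beta> * (\<eta>\<^sup>2 / 4 * (\<epsilon> * \<rho>)))" "6 \<le> Wmin * (ee * (2 * (\<epsilon> * \<rho>)))"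
      by (simp_all only: pos_divide_le_eq)
    moreover have "\<beta> * (\<eta>\<^sup>2 / 4 * (\<epsilon> * \<rho> * Wmin)) = Wmin * (\<beta> * (\<eta>\<^sup>2 / 4 * (\<epsilon> * \<rho>)))"
      "ee * (2 * (\<epsilon> * \<rho> * Wmin)) = Wmin * (ee * (2 * (\<epsilon> * \<rho>)))" by (simp_all only: ac_simps)
    moreover have "6 \<le> Wmin" unfolding Wmin_def by simp
    ultimately have big: "24 \<le> \<beta> * (\<eta>\<^sup>2 / 4 * (\<epsilon> * \<rho> * Wmin))" "6 \<le> ee * (2 * (\<epsilon> * \<rho> * Wmin))" "6 \<le> Wmin"
      by (simp_all only:)
    define m0 where "m0 = nat \<lceil>max (Wmin / c ^ n) (max 1 Wmin)\<rceil>"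
    show ?thesis
    proof (rule exI[of _ m0], intro allI impI)
      fix m G assume m: "m0 \<le> m" and lip: "step_lipschitz m G" and G0: "G 0 0 \<le> 1"
        and low: "\<forall>i j. i + j \<le> m \<longrightarrow> s * real (i + j) - 2 \<le> G i j"
      have mW: "Wmin / c ^ n \<le> real m" "Wmin \<le> real m" using m unfolding m0_def by linarith+
      have 1: "0 + 0 + m \<le> m" by simp
      have 2: "supported G (ee / 2) 0 0 s s m" unfolding supported_def excess_def
      proof (intro allI impI)
        fix a b assume "a + b \<le> m"
        then have "s * real (a + b) - 2 \<le> G a b" using low by blast
        moreover have "0 \<le> ee * (real a + real b)" using ee by simp
        ultimately show "- (ee / 2) * (real a + real b) - 3 \<le> G (0 + a) (0 + b) - G 0 0 - (s * real a + s * real b)"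
          using G0 by (simp add: distrib_left)
      qed
      \<comment> \<open>The window has length m, so only t = m remains; there the additive loss 6 is
        absorbed by \<beta> m.\<close>
      have 3: "axes_grow G m 0 0 m (2 * s - \<beta>)" unfolding axes_grow_def
      proof (intro allI impI)
        fix t assume "m \<le> t \<and> 0 + 0 + t \<le> m"
        then have t: "t = m" by simp
        have "s * real m - 2 \<le> G m 0" "s * real m - 2 \<le> G 0 m" using low by (metis add_0_right add_0_left order_refl)+
        moreover have "6 \<le> \<beta> * real m"
        proof -
          have "24 \<le> \<beta> * (\<eta>\<^sup>2 / 4 * (\<epsilon> * \<rho> * Wmin))" by (rule big)
          also have "\<dots> \<le> \<beta> * (1 * (1 * 1 * real m))"
            using \<beta> \<eta> \<open>\<eta>\<^sup>2 \<le> 1\<close> \<epsilon> \<rho> mW big(3) by (intro mult_left_mono mult_mono) auto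
          finally show ?thesis by simp
        qed
        ultimately show "(2 * s - \<beta>) * real t \<le> axes G 0 0 t" unfolding t axes_def using G0 by (simp add: algebra_simps)
      qed
      have 4: "2 * s - \<beta> \<le> s + s - \<beta>" "3 \<le> s + s" "8 < s + s + 2 * ee * real n" using s \<beta> n by auto
      have 5: "Wmin \<le> c ^ n * real m" using mW(1) c by (simp add: field_simps)
      obtain i' j' x' y' W' where fin: "i' + j' + W' \<le> m" "supported G (ee/2) i' j' x' y' W'"
        "axes_grow G m i' j' W' (2 * s - \<beta> - 48 * \<rho> * real n)" "s + s \<le> x' + y'" "Wmin \<le> real W'" "W' \<le> m"
        "real (i' + j') \<le> real (0 + 0) + 4 * \<rho> * real m"
        "\<forall>k. \<epsilon> * \<rho> * real W' \<le> real k \<and> real k \<le> \<rho> * real W' \<longrightarrow>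
          excess G i' j' x' y' k k \<le> ec * (2 * real k)"
        using tilt_iterate[OF lip \<eta>(1,2) ec1 ee(1,2) ee(3) \<beta> \<rho>(1) \<rho>4 \<epsilon> big 1 2 3 4 5[unfolded c_def]] by blast
      have "supported G ec i' j' x' y' W'" unfolding supported_def
      proof (intro allI impI)
        fix a b assume "a + b \<le> W'"
        then have "- (ee/2) * (real a + real b) - 3 \<le> excess G i' j' x' y' a b" using fin(2) unfolding supported_def by blast
        moreover have "ee/2 * (real a + real b) \<le> ec * (real a + real b)" using ee ec by (intro mult_right_mono) auto
        ultimately show "- ec * (real a + real b) - 3 \<le> excess G i' j' x' y' a b" by simp
      qed
      moreover have "axes_grow G m i' j' W' (3 + 4 * \<beta>)" unfolding axes_grow_def
      proof (intro allI impI)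
        fix t assume t: "W' \<le> t \<and> i' + j' + t \<le> m"
        have "(3 + 4 * \<beta>) * real t \<le> (2 * s - \<beta> - 48 * \<rho> * real n) * real t"
          using s \<rho>n by (intro mult_right_mono) auto
        then show "(3 + 4 * \<beta>) * real t \<le> axes G i' j' t" using fin(3) t unfolding axes_grow_def by fastforce
      qed
      moreover have "W0 \<le> real W'" using fin(5) unfolding Wmin_def by simp
      moreover have "real (i' + j') \<le> real m / 80"
        using fin(7) mult_right_mono[OF \<rho>(2), of "real m"] by simp
      moreover have "W' \<ge> 6" using fin(5) big(3) by linarith
      moreover have "ee / 2 \<le> 1 / 2" using ee ec1 by simp
      ultimately show "\<exists>i j x y W. i + j + W \<le> m \<and> supported G ec i j x y W \<and> axes_grow G m i j W (3 + 4 * \<beta>) \<and>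
        2 * s \<le> x + y \<and> x \<le> 4 \<and> y \<le> 4 \<and> W0 \<le> real W \<and> real (i + j) \<le> real m / 80 \<and>
        (\<forall>k. \<epsilon> * \<rho> * real W \<le> real k \<and> real k \<le> \<rho> * real W \<longrightarrow>
          excess G i j x y k k \<le> ec * (2 * real k))"
        using fin(1,4,8) supported_slopes_le[OF lip fin(1,2)] by (metis mult_2)
    qed
  qed
  show ?thesis
  proof (intro exI[of _ \<rho>] conjI)
  qed (fact \<rho> \<rho>n(2) allI[OF ex])+
qed

section \<open>Halving the scale along the diagonal\<close>

definition defect :: "(nat \<Rightarrow> nat \<Rightarrow> real) \<Rightarrow> nat \<Rightarrow> nat \<Rightarrow> nat \<Rightarrow> real" where
  "defect G i j p = G (i + 2 * p) j + G i (j + 2 * p) + G (i + p) (j + p)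
     - G (i + 2 * p) (j + p) - G (i + p) (j + 2 * p) - G i j"

text \<open>\<open>defect\<close> is the logarithm of \<open>cross_ratio\<close>. In this form, with
  \<open>axes\<close> under control at scale 2 p, a large defect forces \<open>axes\<close> to be
  small at scale p from the base (i + p, j + p), because G grows along the diagonal. This is the
  move of the descent.\<close>

lemma defect_axes:
  "defect G i j p = axes G i j (2 * p) - axes G (i + p) (j + p) p + G i j - G (i + p) (j + p)"
proof -
  have "i + p + p = i + 2 * p" "j + p + p = j + 2 * p" by simp_all
  then show ?thesis unfolding defect_def axes_def by (simp only:)
qed

text \<open>If no scale works, a minimal value of \<open>axes G - (3 + \<beta>) t\<close> over later \<open>t\<close>, relative to the starting scale,
  drops by \<open>4 \<beta>\<close> whenever that scale is halved and the base point moves along the diagonal. After \<open>J\<close> steps it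
  would be negative.\<close>

lemma diagonal_descent:
  fixes \<beta> E0 ec \<rho> x y :: real and i j m W tJ J :: nat
  assumes lip: "step_lipschitz m G" and \<beta>: "0 < \<beta>" "\<beta> \<le> 1/10"
    and dom: "i + j + W \<le> m" and sup: "supported G ec i j x y W" and grow: "axes_grow G m i j W (3 + 4 * \<beta>)"
    and xy: "3 + 6 * \<beta> \<le> x + y" and ij: "real (i + j) \<le> real m / 80"
    and ec: "0 < ec" "ec \<le> \<beta> / 1000" and \<rho>: "0 < \<rho>" "\<rho> \<le> 1/320" "\<rho> \<le> \<beta> / 48"
    and contact: "\<And>k. ec * \<rho> * real W \<le> real k \<and> real k \<le> \<rho> * real W \<Longrightarrow> excess G i j x y k k \<le> ec * (2 * real k)"
    and J: "3 < 4 * \<beta> * real J"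
    and tJ: "4 / \<beta> * (2 ^ J * real tJ) \<le> \<rho> * real W" "ec * \<rho> * real W \<le> \<beta> * real tJ / 1000"
      "3000 \<le> \<beta> * real tJ" "E0 \<le> \<beta> * real tJ"
  shows "\<exists>i j p. 1 \<le> p \<and> 40 * (i + j) \<le> m \<and> 80 * p \<le> m \<and>
     (\<forall>t. 2 * p \<le> t \<and> i + j + t \<le> m \<longrightarrow> 3 * real t + 2 * defect G i j p + E0 \<le> axes G i j t)"
proof (rule ccontr)
  assume noex: "\<not> ?thesis"
  define Z where "Z = ec * \<rho> * real W"
  have Z0: "0 \<le> Z" unfolding Z_def using ec \<rho> by simp
  have Z: "Z \<le> \<beta> * real tJ / 1000" using tJ(2) unfolding Z_def .
  have \<rho>W: "320 * (\<rho> * real W) \<le> real W" using mult_right_mono[OF \<rho>(2), of "real W"] by simp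
  have tJ1: "1 \<le> real tJ"
  proof (rule ccontr)
    assume "\<not> ?thesis"
    then have "tJ = 0" by simp
    then show False using tJ(3) by simp
  qed
  have \<beta>mono: "\<beta> * real tJ \<le> \<beta> * real t" if "tJ \<le> t" for t using that \<beta> by simp
  \<comment> \<open>\<open>contact\<close> speaks only of k \<ge> Z. Below Z the Lipschitz bound
    gives 6 k, so the excess on the diagonal is of order Z all the way up to \<rho> W.\<close>
  have elo: "- 2 * Z - 3 \<le> excess G i j x y k k" and eup: "excess G i j x y k k \<le> 6 * Z"
    if k: "real k \<le> \<rho> * real W" for k
  proof -
    have kW: "k + k \<le> W" using k \<rho>W by linarith
    have eck: "ec * real k \<le> Z" using mult_left_mono[OF k, of ec] ec unfolding Z_def by (simp add: mult.assoc)
    have "- ec * (real k + real k) - 3 \<le> excess G i j x y k k" using sup kW unfolding supported_def by blast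
    then show "- 2 * Z - 3 \<le> excess G i j x y k k" using eck by (simp add: algebra_simps)
    show "excess G i j x y k k \<le> 6 * Z"
    proof (cases "ec * \<rho> * real W \<le> real k")
      case True
      then show ?thesis using contact k eck Z0 by fastforce
    next
      case False
      have "\<bar>G (i + k) (j + k) - G i j\<bar> \<le> 3 * (real k + real k)"
        using step_lipschitz_up[OF lip, of i k j k] kW dom by simp
      moreover have "0 \<le> (x + y) * real k" using xy \<beta> by simp
      ultimately have "excess G i j x y k k \<le> 6 * real k" unfolding excess_def by (simp add: algebra_simps)
      then show ?thesis using False unfolding Z_def by linarith
    qed
  qed
  have diag: "(3 + 6 * \<beta>) * real p - 8 * Z - 3 \<le> G (i + k + p) (j + k + p) - G (i + k) (j + k)"
    if k: "real (k + p) \<le> \<rho> * real W" for k p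
  proof -
    have "real k \<le> \<rho> * real W" using k by linarith
    then have "excess G i j x y k k \<le> 6 * Z" by (rule eup)
    moreover have "- 2 * Z - 3 \<le> excess G i j x y (k + p) (k + p)" by (rule elo[OF k])
    moreover have "G (i + k + p) (j + k + p) - G (i + k) (j + k) =
        (x + y) * real p + excess G i j x y (k + p) (k + p) - excess G i j x y k k"
      unfolding excess_def by (simp add: algebra_simps)
    moreover have "(3 + 6 * \<beta>) * real p \<le> (x + y) * real p" using xy by (intro mult_right_mono) auto
    ultimately show ?thesis by linarith
  qed
  \<comment> \<open>Growth persists at every base point (i + k, j + k): inside the window by the
    supporting slopes, beyond it by \<open>grow\<close>, whose surplus 4 \<beta> gives up one
    \<beta> for the shift of the base.\<close>
  have ax: "(3 + 3 * \<beta>) * real t \<le> axes G (i + k) (j + k) t"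
    if k: "real k \<le> \<rho> * real W" and t: "tJ \<le> t" "i + k + (j + k) + t \<le> m" for k t
  proof -
    have \<beta>t: "\<beta> * real tJ \<le> \<beta> * real t" using \<beta>mono t(1) .
    have ect: "ec * real t \<le> \<beta> * real t / 1000" using mult_right_mono[OF ec(2), of "real t"] by simp
    have xyt: "(3 + 6 * \<beta>) * real t \<le> (x + y) * real t" using xy by (intro mult_right_mono) auto
    show ?thesis
    proof (cases "2 * k + t \<le> W")
      case True
      have A: "- ec * (real (k + t) + real k) - 3 \<le> excess G i j x y (k + t) k"
        using sup[unfolded supported_def, rule_format, of "k + t" k] True by simp
      have B: "- ec * (real k + real (k + t)) - 3 \<le> excess G i j x y k (k + t)"
        using sup[unfolded supported_def, rule_format, of k "k + t"] True by simp
      have eq: "axes G (i + k) (j + k) t = (x + y) * real t + excess G i j x y (k + t) k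
          + excess G i j x y k (k + t) - 2 * excess G i j x y k k"
        unfolding axes_def excess_def by (simp add: algebra_simps)
      have eck: "ec * real k \<le> Z" using mult_left_mono[OF k, of ec] ec unfolding Z_def by (simp add: mult.assoc)
      have "(x + y) * real t - 2 * (ec * real t) - 4 * (ec * real k) - 6 - 12 * Z \<le> axes G (i + k) (j + k) t"
        using A B eq eup[OF k] by (simp add: algebra_simps)
      then have "(3 + 6 * \<beta>) * real t - 2 * (ec * real t) - 16 * Z - 6 \<le> axes G (i + k) (j + k) t"
        using xyt eck by linarith
      then show ?thesis using ect Z \<beta>t tJ(3) by (simp add: algebra_simps)
    next
      case False
      have "(3 + 4 * \<beta>) * real t \<le> axes G i j t"
      proof (cases "W \<le> t")
        case True
        then show ?thesis using grow t(2) unfolding axes_grow_def by simp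
      next
        case False
        have "- ec * real t - 3 \<le> excess G i j x y t 0" "- ec * real t - 3 \<le> excess G i j x y 0 t"
          using sup[unfolded supported_def, rule_format, of t 0] sup[unfolded supported_def, rule_format, of 0 t] False by simp_all
        moreover have "axes G i j t = (x + y) * real t + excess G i j x y t 0 + excess G i j x y 0 t"
          unfolding axes_def excess_def by (simp add: algebra_simps)
        ultimately have "(x + y) * real t - 2 * (ec * real t) - 6 \<le> axes G i j t" by simp
        then show ?thesis using xyt ect \<beta>t tJ(3) by (simp add: algebra_simps)
      qed
      moreover have "axes G i j t - 12 * (real k + real k) \<le> axes G (i + k) (j + k) t"
        by (rule axes_shift[OF lip t(2)])
      moreover have "24 * real k \<le> \<beta> * real t"
      proof -
        have "real W \<le> 2 * real t" using False k \<rho>W by linarith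
        then have "\<rho> * real W \<le> \<beta> / 48 * (2 * real t)" using \<rho> by (intro mult_mono) auto
        then show ?thesis using k by simp
      qed
      ultimately show ?thesis by (simp add: algebra_simps)
    qed
  qed
  define H where "H = (\<lambda>k t. axes G (i + k) (j + k) t - (3 + \<beta>) * real t)"
  have Hlo: "2 * \<beta> * real t \<le> H k t"
    if "real k \<le> \<rho> * real W" "tJ \<le> t" "i + k + (j + k) + t \<le> m" for k t
    using ax[OF that] unfolding H_def by (simp add: algebra_simps)
  define T where "T = 2 ^ J * real tJ"
  \<comment> \<open>At scale T / 2 ^ q the base moves by p \<le> 2 / \<beta> times that scale. The
    bound on k is the geometric sum of these moves; it stays below \<rho> W for every q, so
    \<open>ax\<close> and \<open>diag\<close> remain available.\<close>
  have Q: "\<exists>k t. real k \<le> 4 / \<beta> * T * (1 - 1 / 2 ^ q) \<and> 2 ^ (J - q) * tJ \<le> t \<and> i + k + (j + k) + t \<le> m \<and>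
      H k t \<le> (3 - 4 * \<beta> * real q) * (2 ^ (J - q) * real tJ)" if "q \<le> J" for q
    using that
  proof (induction q)
    case 0
    have T\<beta>: "T \<le> \<rho> * real W"
    proof -
      have "1 * T \<le> 4 / \<beta> * T" using \<beta> unfolding T_def by (intro mult_right_mono) auto
      then show ?thesis using tJ(1) unfolding T_def by simp
    qed
    then have "real (2 ^ J * tJ) \<le> real W" using \<rho>W unfolding T_def by simp
    then have TW: "2 ^ J * tJ \<le> W" using of_nat_le_iff by blast
    let ?t = "2 ^ J * tJ"
    have "\<bar>G (i + ?t) j - G i j\<bar> \<le> 3 * real ?t" "\<bar>G i (j + ?t) - G i j\<bar> \<le> 3 * real ?t"
      using step_lipschitz_fst[OF lip, of i ?t j] step_lipschitz_snd[OF lip, of i j ?t] TW dom by auto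
    then have "axes G i j ?t \<le> 6 * real ?t" unfolding axes_def by simp
    moreover have "0 \<le> \<beta> * real ?t" using \<beta> by simp
    ultimately have "H 0 ?t \<le> 3 * real ?t" unfolding H_def by (simp add: algebra_simps)
    then show ?case using TW dom by (intro exI[of _ 0] exI[of _ ?t]) (auto simp: T_def)
  next
    case (Suc q)
    then obtain k t0 where k: "real k \<le> 4 / \<beta> * T * (1 - 1 / 2 ^ q)" and t0: "2 ^ (J - q) * tJ \<le> t0"
      "i + k + (j + k) + t0 \<le> m" "H k t0 \<le> (3 - 4 * \<beta> * real q) * (2 ^ (J - q) * real tJ)" by auto
    define \<tau> where "\<tau> = 2 ^ (J - q) * tJ"
    have \<tau>T: "real \<tau> = T / 2 ^ q"
    proof -
      have "J = (J - q) + q" using Suc.prems by simp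
      then have "(2::real) ^ J = 2 ^ (J - q) * 2 ^ q" by (metis power_add)
      then show ?thesis unfolding \<tau>_def T_def by simp
    qed
    define S where "S = {t. \<tau> \<le> t \<and> i + k + (j + k) + t \<le> m}"
    have "S \<subseteq> {..m}" unfolding S_def by auto
    then have fin: "finite S" by (rule finite_subset) simp
    have t0S: "t0 \<in> S" using t0 unfolding S_def \<tau>_def by simp
    \<comment> \<open>Minimising over all later t allows a comparison with the t' at which the
      desired inequality fails, wherever that t' lies.\<close>
    obtain u where u: "u \<in> S" "\<And>t. t \<in> S \<Longrightarrow> H k u \<le> H k t"
      using arg_min_if_finite(1)[of S "H k"] arg_min_least[of S _ "H k"] fin t0S by (metis empty_iff)
    have Hu: "H k u \<le> (3 - 4 * \<beta> * real q) * real \<tau>" using u(2)[OF t0S] t0(3) unfolding \<tau>_def by simp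
    have T0: "0 \<le> T" unfolding T_def by simp
    have kT: "4 / \<beta> * T * (1 - 1 / 2 ^ q) \<le> 4 / \<beta> * T * 1" using \<beta> T0 by (intro mult_left_mono) auto
    have KT: "4 / \<beta> * T \<le> \<rho> * real W" using tJ(1) unfolding T_def .
    have k\<rho>: "real k \<le> \<rho> * real W" using k kT KT by linarith
    have \<tau>J: "tJ \<le> \<tau>" unfolding \<tau>_def by simp
    have u': "\<tau> \<le> u" "i + k + (j + k) + u \<le> m" using u(1) unfolding S_def by auto
    have "2 * \<beta> * real u \<le> H k u" using Hlo[OF k\<rho> _ u'(2)] u'(1) \<tau>J by simp
    also have "\<dots> \<le> 3 * real \<tau>" using Hu mult_right_mono[of "3 - 4 * \<beta> * real q" 3 "real \<tau>"] \<beta> by simp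
    finally have u\<tau>: "2 * \<beta> * real u \<le> 3 * real \<tau>" .
    define p where "p = (u + 1) div 2"
    have p: "u \<le> 2 * p" "2 * p \<le> u + 1" unfolding p_def by linarith+
    have \<tau>1: "1 \<le> real \<tau>" using tJ1 \<tau>J by linarith
    have p\<tau>: "real p \<le> 2 / \<beta> * real \<tau>"
    proof -
      have "\<beta> * (2 * real p) \<le> \<beta> * (real u + 1)" using p(2) \<beta> by (intro mult_left_mono) linarith+
      also have "\<dots> \<le> 3 / 2 * real \<tau> + 1 * real \<tau>" using u\<tau> \<beta> \<tau>1 by (simp add: algebra_simps)
      finally have "\<beta> * real p \<le> 2 * real \<tau>" using \<tau>1 by simp
      then show ?thesis using \<beta> by (simp add: field_simps)
    qed
    have p1: "1 \<le> p" using p(1) u'(1) \<tau>1 by linarith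
    have kp: "real (k + p) \<le> 4 / \<beta> * T * (1 - 1 / 2 ^ Suc q)"
    proof -
      have "4 / \<beta> * T * (1 - 1 / 2 ^ Suc q) = 4 / \<beta> * T * (1 - 1 / 2 ^ q) + 2 / \<beta> * (T / 2 ^ q)"
      proof -
        have e: "(1::real) - 1 / 2 ^ Suc q = (1 - 1 / 2 ^ q) + 1 / 2 ^ q / 2" by simp
        show ?thesis unfolding e distrib_left[of _ "1 - 1 / 2 ^ q"] by simp
      qed
      then show ?thesis using k p\<tau> \<tau>T by simp
    qed
    have "4 / \<beta> * T * (1 - 1 / 2 ^ Suc q) \<le> 4 / \<beta> * T * 1" using \<beta> T0 by (intro mult_left_mono) auto
    then have kp\<rho>: "real (k + p) \<le> \<rho> * real W" using kp KT by linarith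
    then have "real (320 * (k + p)) \<le> real W" using \<rho>W by simp
    then have kpW: "320 * (k + p) \<le> W" by (simp only: of_nat_le_iff)
    have "real (80 * (i + j)) \<le> real m" using ij by simp
    then have ijm: "80 * (i + j) \<le> m" by (simp only: of_nat_le_iff)
    have "160 * k \<le> W" "80 * p \<le> W" "W \<le> m" using kpW dom by simp_all
    then have small1: "40 * (i + k + (j + k)) \<le> m" and small2: "80 * p \<le> m" using ijm by simp_all
    have "\<not> (\<forall>t. 2 * p \<le> t \<and> i + k + (j + k) + t \<le> m \<longrightarrow>
        3 * real t + 2 * defect G (i + k) (j + k) p + E0 \<le> axes G (i + k) (j + k) t)"
      using noex p1 small1 small2 by blast
    then obtain t' where t': "2 * p \<le> t'" "i + k + (j + k) + t' \<le> m"
      "axes G (i + k) (j + k) t' < 3 * real t' + 2 * defect G (i + k) (j + k) p + E0" by (auto simp: not_le)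
    have "t' \<in> S" using t' p(1) u'(1) unfolding S_def by simp
    then have "H k u \<le> H k t'" by (rule u(2))
    moreover have "\<beta> * real u \<le> \<beta> * real t'" using t'(1) p(1) \<beta> by (intro mult_left_mono) auto
    ultimately have 1: "H k u + \<beta> * real u < 2 * defect G (i + k) (j + k) p + E0"
      using t'(3) unfolding H_def by (simp add: algebra_simps)
    have 2: "defect G (i + k) (j + k) p = axes G (i + k) (j + k) (2 * p) - axes G (i + (k + p)) (j + (k + p)) p
        - (G (i + k + p) (j + k + p) - G (i + k) (j + k))"
      unfolding defect_axes by (simp add: add.assoc)
    \<comment> \<open>p is u / 2 rounded up, so 2 p may be u + 1; the extra step costs 3 in each of
      two terms.\<close>
    have 3: "axes G (i + k) (j + k) (2 * p) \<le> axes G (i + k) (j + k) u + 6"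
    proof -
      have "2 * p = u \<or> 2 * p = Suc u" using p by linarith
      moreover have "axes G (i + k) (j + k) (Suc u) \<le> axes G (i + k) (j + k) u + 6" if "i + k + (j + k) + Suc u \<le> m"
      proof -
        have "\<bar>G (Suc (i + k + u)) (j + k) - G (i + k + u) (j + k)\<bar> \<le> 3"
          "\<bar>G (i + k) (Suc (j + k + u)) - G (i + k) (j + k + u)\<bar> \<le> 3"
          using lip that unfolding step_lipschitz_def by auto
        then show ?thesis unfolding axes_def by simp
      qed
      moreover have "i + k + (j + k) + 2 * p \<le> m" using kpW dom by simp
      ultimately show ?thesis by auto
    qed
    have 4: "axes G (i + (k + p)) (j + (k + p)) p = H (k + p) p + (3 + \<beta>) * real p" unfolding H_def by simp
    have 5: "(3 + 6 * \<beta>) * real p - 8 * Z - 3 \<le> G (i + k + p) (j + k + p) - G (i + k) (j + k)"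
      by (rule diag[OF kp\<rho>])
    have 6: "axes G (i + k) (j + k) u = H k u + (3 + \<beta>) * real u" unfolding H_def by simp
    have 7: "(6 + 7 * \<beta>) * real u \<le> (6 + 7 * \<beta>) * (2 * real p)" using p(1) \<beta> by (intro mult_left_mono) linarith+
    \<comment> \<open>The failed inequality bounds the defect from below. Expanding it by
      \<open>2\<close> and inserting the diagonal growth (3 + 6 \<beta>) p leaves a gain of 6
      \<beta> u: 2 \<beta> u pays for the errors and 4 \<beta> u is the drop.\<close>
    have "2 * H (k + p) p \<le> H k u - 6 * \<beta> * real u + 16 * Z + 18 + E0"
      using 1 3 5 7 unfolding 2 4 6 by (simp add: algebra_simps)
    moreover have "16 * Z + 18 + E0 \<le> 2 * \<beta> * real u"
      using Z tJ(3,4) \<beta>mono[of u] \<tau>J u'(1) by linarith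
    moreover have "\<beta> * real \<tau> \<le> \<beta> * real u" using u'(1) \<beta> by (intro mult_left_mono) auto
    ultimately have "2 * H (k + p) p \<le> (3 - 4 * \<beta> * real q) * real \<tau> - 4 * (\<beta> * real \<tau>)" using Hu by linarith
    moreover have half: "\<tau> = 2 * (2 ^ (J - Suc q) * tJ)"
    proof -
      have "J - q = Suc (J - Suc q)" using Suc.prems by simp
      then show ?thesis unfolding \<tau>_def by simp
    qed
    ultimately have "H (k + p) p \<le> (3 - 4 * \<beta> * real (Suc q)) * (2 ^ (J - Suc q) * real tJ)"
      by (simp add: algebra_simps)
    moreover have "2 ^ (J - Suc q) * tJ \<le> p" using half p(1) u'(1) by linarith
    moreover have "i + (k + p) + (j + (k + p)) + p \<le> m" using kpW dom by simp
    ultimately show ?case using kp by blast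
  qed
  obtain k t where kt: "real k \<le> 4 / \<beta> * T * (1 - 1 / 2 ^ J)" "tJ \<le> t" "i + k + (j + k) + t \<le> m"
      "H k t \<le> (3 - 4 * \<beta> * real J) * real tJ" using Q[of J] by auto
  have "4 / \<beta> * T * (1 - 1 / 2 ^ J) \<le> 4 / \<beta> * T * 1" using \<beta> unfolding T_def by (intro mult_left_mono) auto
  then have "real k \<le> \<rho> * real W" using kt(1) tJ(1) unfolding T_def by linarith
  then have "2 * \<beta> * real t \<le> H k t" using Hlo kt by blast
  moreover have "0 \<le> 2 * \<beta> * real t" using \<beta> by simp
  moreover have "(3 - 4 * \<beta> * real J) * real tJ < 0" using J tJ1 by (simp add: mult_neg_pos)
  ultimately show False using kt(4) by linarith
qed

text \<open>The parameters are fixed in the order \<beta>, J, ec, \<rho>, window. J halvings lead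
  from a fraction of \<rho> W down to tJ, where the diagonal error ec \<rho> W must still be below
  \<beta> tJ / 1000; hence ec is small against 2 to the power -J.\<close>

lemma selection:
  fixes s E0 :: real
  assumes s: "3/2 < s"
  shows "\<exists>m0. \<forall>m\<ge>m0. \<forall>G. step_lipschitz m G \<longrightarrow> G 0 0 \<le> 1 \<longrightarrow>
     (\<forall>i j. i + j \<le> m \<longrightarrow> s * real (i + j) - 2 \<le> G i j) \<longrightarrow>
     (\<exists>i j p. 1 \<le> p \<and> 40 * (i + j) \<le> m \<and> 80 * p \<le> m \<and>
       (\<forall>t. 2 * p \<le> t \<and> i + j + t \<le> m \<longrightarrow> 3 * real t + 2 * defect G i j p + E0 \<le> axes G i j t))"
proof -
  define \<beta> where "\<beta> = min ((s - 3/2) / 3) (1/10)"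
  have \<beta>: "0 < \<beta>" "\<beta> \<le> 1/10" "\<beta> \<le> 1" using s unfolding \<beta>_def by auto
  have ss: "3/2 + 3 * \<beta> \<le> s"
  proof -
    have "\<beta> \<le> (s - 3/2) / 3" unfolding \<beta>_def by (rule min.cobounded1)
    then show ?thesis by simp
  qed
  define J where "J = nat \<lceil>3 / (4 * \<beta>)\<rceil> + 1"
  have J: "3 < 4 * \<beta> * real J"
  proof -
    have "3 / (4 * \<beta>) < real J" unfolding J_def by linarith
    then show ?thesis using \<beta> by (simp add: field_simps)
  qed
  define ec where "ec = \<beta>\<^sup>2 / (8000 * 2 ^ J)"
  have ec: "0 < ec" "ec \<le> \<beta> / 1000" "ec \<le> \<beta>" "ec \<le> 1"
  proof -
    show "0 < ec" using \<beta> unfolding ec_def by simp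
    have "\<beta>\<^sup>2 / (8000 * 2 ^ J) \<le> \<beta> / 1000"
    proof -
      have "\<beta> * \<beta> \<le> \<beta> * 1" using \<beta> by (intro mult_left_mono) auto
      moreover have "(1000::real) \<le> 8000 * 2 ^ J" using one_le_power[of "2::real" J] by linarith
      ultimately show ?thesis using \<beta> unfolding power2_eq_square by (intro frac_le) auto
    qed
    then show "ec \<le> \<beta> / 1000" unfolding ec_def .
    then show "ec \<le> \<beta>" "ec \<le> 1" using \<beta> by linarith+
  qed
  obtain \<rho> where \<rho>: "0 < \<rho>" "\<rho> \<le> 1/320" "\<rho> \<le> \<beta>/48" and ex: "\<And>W0. \<exists>m0. \<forall>m\<ge>m0. \<forall>G. step_lipschitz m G \<longrightarrow> G 0 0 \<le> 1 \<longrightarrow>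
     (\<forall>i j. i + j \<le> m \<longrightarrow> (3/2 + 3 * \<beta>) * real (i + j) - 2 \<le> G i j) \<longrightarrow>
     (\<exists>i j x y W. i + j + W \<le> m \<and> supported G ec i j x y W \<and> axes_grow G m i j W (3 + 4 * \<beta>) \<and>
        2 * (3/2 + 3 * \<beta>) \<le> x + y \<and> x \<le> 4 \<and> y \<le> 4 \<and> W0 \<le> real W \<and> real (i + j) \<le> real m / 80 \<and>
        (\<forall>k. ec * \<rho> * real W \<le> real k \<and> real k \<le> \<rho> * real W \<longrightarrow>
          excess G i j x y k k \<le> ec * (2 * real k)))"
    using contact_exists[OF refl \<beta>(1,3) ec(1,3,1,4)] by blast
  \<comment> \<open>With tJ about b W, doubling J times and multiplying by 4 / \<beta> stays within
    \<rho> W, the total diagonal travel allowed.\<close>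
  define b where "b = \<beta> * \<rho> / (4 * 2 ^ J)"
  have b: "0 < b" unfolding b_def using \<beta> \<rho> by simp
  define W0 where "W0 = (2 + max 3000 E0 / \<beta>) * 2 / b"
  from ex[of W0] obtain m0 where m0: "\<And>m G. m0 \<le> m \<Longrightarrow> step_lipschitz m G \<Longrightarrow> G 0 0 \<le> 1 \<Longrightarrow>
     (\<forall>i j. i + j \<le> m \<longrightarrow> (3/2 + 3 * \<beta>) * real (i + j) - 2 \<le> G i j) \<Longrightarrow>
     (\<exists>i j x y W. i + j + W \<le> m \<and> supported G ec i j x y W \<and> axes_grow G m i j W (3 + 4 * \<beta>) \<and>
        2 * (3/2 + 3 * \<beta>) \<le> x + y \<and> x \<le> 4 \<and> y \<le> 4 \<and> W0 \<le> real W \<and> real (i + j) \<le> real m / 80 \<and>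
        (\<forall>k. ec * \<rho> * real W \<le> real k \<and> real k \<le> \<rho> * real W \<longrightarrow>
          excess G i j x y k k \<le> ec * (2 * real k)))" by blast
  show ?thesis
  proof (rule exI[of _ m0], intro allI impI)
    fix m G assume m: "m0 \<le> m" and lip: "step_lipschitz m G" and G0: "G 0 0 \<le> 1"
      and low: "\<forall>i j. i + j \<le> m \<longrightarrow> s * real (i + j) - 2 \<le> G i j"
    have low': "\<forall>i j. i + j \<le> m \<longrightarrow> (3/2 + 3 * \<beta>) * real (i + j) - 2 \<le> G i j"
    proof (intro allI impI)
      fix i j assume "i + j \<le> m"
      then have "s * real (i + j) - 2 \<le> G i j" using low by blast
      then show "(3/2 + 3 * \<beta>) * real (i + j) - 2 \<le> G i j"
        using mult_right_mono[OF ss, of "real (i + j)"] by linarith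
    qed
    obtain i j x y W where st: "i + j + W \<le> m" "supported G ec i j x y W" "axes_grow G m i j W (3 + 4 * \<beta>)"
        "2 * (3/2 + 3 * \<beta>) \<le> x + y" "W0 \<le> real W" "real (i + j) \<le> real m / 80"
        "\<And>k. ec * \<rho> * real W \<le> real k \<and> real k \<le> \<rho> * real W \<Longrightarrow> excess G i j x y k k \<le> ec * (2 * real k)"
      using m0[OF m lip G0 low'] by blast
    define tJ where "tJ = nat \<lfloor>b * real W\<rfloor>"
    have bW: "(2 + max 3000 E0 / \<beta>) * 2 \<le> b * real W"
      using st(5) b unfolding W0_def by (simp add: field_simps)
    define M where "M = max 3000 E0 / \<beta>"
    have "0 \<le> M" using \<beta> unfolding M_def by simp
    moreover have "real tJ \<le> b * real W" unfolding tJ_def using b by (intro of_nat_floor) simp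
    moreover have "b * real W - 1 < real tJ" unfolding tJ_def by linarith
    ultimately have tJ: "real tJ \<le> b * real W" and "b * real W \<le> 2 * real tJ \<and> M \<le> real tJ"
      using bW unfolding M_def[symmetric] by (simp_all add: algebra_simps)
    then have tJ': "b * real W \<le> 2 * real tJ" "max 3000 E0 / \<beta> \<le> real tJ" unfolding M_def by blast+
    have xy: "3 + 6 * \<beta> \<le> x + y" using st(4) by simp
    have 1: "4 / \<beta> * (2 ^ J * real tJ) \<le> \<rho> * real W"
    proof -
      have "4 / \<beta> * (2 ^ J * real tJ) \<le> 4 / \<beta> * (2 ^ J * (b * real W))"
        using tJ \<beta> by (intro mult_left_mono) auto
      also have "\<dots> = \<rho> * real W" unfolding b_def using \<beta> by simp
      finally show ?thesis .
    qed
    have 2: "ec * \<rho> * real W \<le> \<beta> * real tJ / 1000"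
    proof -
      have "ec * \<rho> * real W = \<beta> / 2000 * (b * real W)" unfolding ec_def b_def by (simp add: power2_eq_square)
      also have "\<dots> \<le> \<beta> / 2000 * (2 * real tJ)" using tJ'(1) \<beta> by (intro mult_left_mono) auto
      finally show ?thesis by simp
    qed
    have 3: "3000 \<le> \<beta> * real tJ" "E0 \<le> \<beta> * real tJ"
      using tJ'(2) \<beta> by (auto simp: field_simps)
    show "\<exists>i j p. 1 \<le> p \<and> 40 * (i + j) \<le> m \<and> 80 * p \<le> m \<and>
       (\<forall>t. 2 * p \<le> t \<and> i + j + t \<le> m \<longrightarrow> 3 * real t + 2 * defect G i j p + E0 \<le> axes G i j t)"
      using diagonal_descent[OF lip \<beta>(1,2) st(1-3) xy st(6) ec(1,2) \<rho> st(7) J 1 2 3] by blast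
  qed
qed

subsection \<open>The high-low inequality for thickened incidences\<close>

text \<open>Cauchy-Schwarz for the integral of a product of two simple functions, expanded so that
  only measures of pairwise intersections occur. The coefficients may be negative, as the difference
  of strips of two widths requires.\<close>

lemma measure_gram_Cauchy_Schwarz:
  fixes c :: "'i \<Rightarrow> real" and d :: "'j \<Rightarrow> real"
  assumes I: "finite I" "\<And>i. i \<in> I \<Longrightarrow> A i \<in> sets M \<and> emeasure M (A i) < \<infinity>"
    and J: "finite J" "\<And>j. j \<in> J \<Longrightarrow> B j \<in> sets M \<and> emeasure M (B j) < \<infinity>"
  shows "(\<Sum>i\<in>I. \<Sum>j\<in>J. c i * d j * measure M (A i \<inter> B j))\<^sup>2
    \<le> (\<Sum>i\<in>I. \<Sum>i'\<in>I. c i * c i' * measure M (A i \<inter> A i')) *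
       (\<Sum>j\<in>J. \<Sum>j'\<in>J. d j * d j' * measure M (B j \<inter> B j'))"
proof -
  define f where "f = (\<lambda>x. \<Sum>i\<in>I. c i * indicator (A i) x :: real)"
  define g where "g = (\<lambda>x. \<Sum>j\<in>J. d j * indicator (B j) x :: real)"
  have int: "integrable M (indicator (S \<inter> T) :: _ \<Rightarrow> real)"
    if "S \<in> sets M" "T \<in> sets M" "emeasure M S < \<infinity>" for S T
    using that emeasure_mono[of "S \<inter> T" S M] by (intro integrable_real_indicator) (auto intro: order.strict_trans1)
  have prod: "integrable M (\<lambda>x. (\<Sum>i\<in>I'. c' i * indicator (A' i) x) * (\<Sum>j\<in>J'. d' j * indicator (B' j) x) :: real) \<and>
     (\<integral>x. (\<Sum>i\<in>I'. c' i * indicator (A' i) x) * (\<Sum>j\<in>J'. d' j * indicator (B' j) x) \<partial>M) =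
     (\<Sum>i\<in>I'. \<Sum>j\<in>J'. c' i * d' j * measure M (A' i \<inter> B' j))"
    if fA: "\<And>i. i \<in> I' \<Longrightarrow> A' i \<in> sets M \<and> emeasure M (A' i) < \<infinity>"
       and fB: "\<And>j. j \<in> J' \<Longrightarrow> B' j \<in> sets M \<and> emeasure M (B' j) < \<infinity>"
    for I' :: "'x set" and J' :: "'y set" and c' d' A' B'
  proof -
    have eq: "(\<lambda>x. (\<Sum>i\<in>I'. c' i * indicator (A' i) x) * (\<Sum>j\<in>J'. d' j * indicator (B' j) x) :: real) =
       (\<lambda>x. \<Sum>i\<in>I'. \<Sum>j\<in>J'. c' i * d' j * indicator (A' i \<inter> B' j) x)"
      by (simp add: sum_product indicator_inter_arith mult_ac)
    have i: "integrable M (\<lambda>x. c' i * d' j * indicator (A' i \<inter> B' j) x :: real)" if "i \<in> I'" "j \<in> J'" for i j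
      using that fA fB by (intro integrable_mult_right int) auto
    have m: "(\<integral>x. c' i * d' j * indicator (A' i \<inter> B' j) x \<partial>M) = c' i * d' j * measure M (A' i \<inter> B' j)"
      if "i \<in> I'" "j \<in> J'" for i j
    proof -
      have "A' i \<inter> B' j \<inter> space M = A' i \<inter> B' j" using that fA sets.sets_into_space by blast
      then show ?thesis by simp
    qed
    have i': "integrable M (\<lambda>x. \<Sum>j\<in>J'. c' i * d' j * indicator (A' i \<inter> B' j) x :: real)" if "i \<in> I'" for i
      using i that by (intro Bochner_Integration.integrable_sum) auto
    have "integrable M (\<lambda>x. \<Sum>i\<in>I'. \<Sum>j\<in>J'. c' i * d' j * indicator (A' i \<inter> B' j) x :: real)"
      by (rule Bochner_Integration.integrable_sum[OF i'])
    moreover have "(\<integral>x. (\<Sum>i\<in>I'. \<Sum>j\<in>J'. c' i * d' j * indicator (A' i \<inter> B' j) x) \<partial>M) =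
        (\<Sum>i\<in>I'. (\<integral>x. (\<Sum>j\<in>J'. c' i * d' j * indicator (A' i \<inter> B' j) x) \<partial>M))"
      by (rule Bochner_Integration.integral_sum[OF i'])
    moreover have "(\<Sum>i\<in>I'. (\<integral>x. (\<Sum>j\<in>J'. c' i * d' j * indicator (A' i \<inter> B' j) x) \<partial>M)) =
        (\<Sum>i\<in>I'. \<Sum>j\<in>J'. c' i * d' j * measure M (A' i \<inter> B' j))"
    proof (rule sum.cong[OF refl])
      fix i assume i1: "i \<in> I'"
      have "(\<integral>x. (\<Sum>j\<in>J'. c' i * d' j * indicator (A' i \<inter> B' j) x) \<partial>M) =
          (\<Sum>j\<in>J'. (\<integral>x. c' i * d' j * indicator (A' i \<inter> B' j) x \<partial>M))"
        by (rule Bochner_Integration.integral_sum[OF i[OF i1]])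
      also have "\<dots> = (\<Sum>j\<in>J'. c' i * d' j * measure M (A' i \<inter> B' j))"
        by (rule sum.cong[OF refl m[OF i1]])
      finally show "(\<integral>x. (\<Sum>j\<in>J'. c' i * d' j * indicator (A' i \<inter> B' j) x) \<partial>M) = \<dots>" .
    qed
    ultimately show ?thesis unfolding eq by (simp only: simp_thms)
  qed
  define Q where "Q = (\<Sum>i\<in>I. \<Sum>i'\<in>I. c i * c i' * measure M (A i \<inter> A i'))"
  define K where "K = (\<Sum>j\<in>J. \<Sum>j'\<in>J. d j * d j' * measure M (B j \<inter> B j'))"
  define S where "S = (\<Sum>i\<in>I. \<Sum>j\<in>J. c i * d j * measure M (A i \<inter> B j))"
  have ff: "integrable M (\<lambda>x. f x * f x)" "(\<integral>x. f x * f x \<partial>M) = Q"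
    and gg: "integrable M (\<lambda>x. g x * g x)" "(\<integral>x. g x * g x \<partial>M) = K"
    and fg: "integrable M (\<lambda>x. f x * g x)" "(\<integral>x. f x * g x \<partial>M) = S"
    using prod[of I A I A c c] prod[of J B J B d d] prod[of I A J B c d] I J unfolding f_def g_def Q_def K_def S_def by blast+
  have nonneg: "0 \<le> t * t * Q + 2 * t * S + K" for t :: real
  proof -
    have "0 \<le> (\<integral>x. (t * f x + g x) * (t * f x + g x) \<partial>M)" by (intro integral_nonneg_AE) auto
    also have "(\<lambda>x. (t * f x + g x) * (t * f x + g x)) = (\<lambda>x. t * t * (f x * f x) + 2 * t * (f x * g x) + g x * g x)"
      by (simp add: algebra_simps)
    also have "(\<integral>x. t * t * (f x * f x) + 2 * t * (f x * g x) + g x * g x \<partial>M) = t * t * Q + 2 * t * S + K"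
      using ff fg gg by simp
    finally show ?thesis .
  qed
  have "0 \<le> (\<integral>x. f x * f x \<partial>M)" by (intro integral_nonneg_AE) auto
  then have Q0: "0 \<le> Q" using ff by simp
  have "S\<^sup>2 \<le> Q * K"
  proof (cases "Q = 0")
    case True
    have "S = 0"
    proof (rule ccontr)
      assume "S \<noteq> 0"
      then have "2 * (- (K + 1) / (2 * S)) * S + K = -1" by (simp add: field_simps)
      then show False using nonneg[of "- (K + 1) / (2 * S)"] True by simp
    qed
    then show ?thesis using True by simp
  next
    case False
    then have "Q > 0" using Q0 by simp
    then have "(- S / Q) * (- S / Q) * Q + 2 * (- S / Q) * S + K = K - S\<^sup>2 / Q"
      by (simp add: field_simps power2_eq_square)
    then have "S\<^sup>2 / Q \<le> K" using nonneg[of "- S / Q"] by simp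
    then show ?thesis using \<open>Q > 0\<close> by (simp add: field_simps)
  qed
  then show ?thesis unfolding Q_def K_def S_def .
qed

section \<open>Areas of strips and of their crossings\<close>

definition strip :: "real \<Rightarrow> real \<Rightarrow> real \<Rightarrow> real \<Rightarrow> (real \<times> real) set" where
  "strip X a b \<rho> = {z. 0 \<le> fst z \<and> fst z \<le> X \<and> \<bar>snd z - a * fst z - b\<bar> \<le> \<rho>}"

definition square :: "real \<Rightarrow> real \<Rightarrow> real \<Rightarrow> (real \<times> real) set" where
  "square x y h = {x..x + h} \<times> {y..y + h}"

lemma strip_sets [measurable]: "strip X a b \<rho> \<in> sets borel"
proof -
  have "closed {z::real \<times> real. 0 \<le> fst z}" "closed {z::real \<times> real. fst z \<le> X}"
    "closed {z. \<bar>snd z - a * fst z - b\<bar> \<le> \<rho>}"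
    by (intro closed_Collect_le continuous_intros)+
  then have "closed ({z. 0 \<le> fst z} \<inter> {z. fst z \<le> X} \<inter> {z. \<bar>snd z - a * fst z - b\<bar> \<le> \<rho>})" by blast
  moreover have "strip X a b \<rho> = {z. 0 \<le> fst z} \<inter> {z. fst z \<le> X} \<inter> {z. \<bar>snd z - a * fst z - b\<bar> \<le> \<rho>}"
    unfolding strip_def by blast
  ultimately show ?thesis by simp
qed

lemma square_sets [measurable]: "square x y h \<in> sets borel"
  unfolding square_def by (intro borel_closed closed_Times) auto

lemma emeasure_square: "0 \<le> h \<Longrightarrow> emeasure lborel (square x y h) = ennreal (h * h)"
  unfolding square_def lborel_prod[symmetric]
  by (subst lborel.emeasure_pair_measure_Times) (auto simp: ennreal_mult)

lemma emeasure_lborel_slices: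
  fixes A :: "(real \<times> real) set"
  assumes "A \<in> sets borel"
  shows "emeasure lborel A = (\<integral>\<^sup>+x. emeasure lborel {y. (x, y) \<in> A} \<partial>lborel)"
proof -
  have "A \<in> sets (lborel \<Otimes>\<^sub>M lborel)" unfolding lborel_prod using assms by simp
  then show ?thesis
    unfolding lborel_prod[symmetric] by (simp add: lborel.emeasure_pair_measure_alt vimage_def)
qed

lemma emeasure_strip_le:
  assumes "0 \<le> X" "0 \<le> \<rho>"
  shows "emeasure lborel (strip X a b \<rho>) \<le> ennreal (2 * X * \<rho>)"
proof -
  have "emeasure lborel (strip X a b \<rho>) = (\<integral>\<^sup>+x. emeasure lborel {y. (x, y) \<in> strip X a b \<rho>} \<partial>lborel)"
    by (intro emeasure_lborel_slices) simp
  also have "\<dots> \<le> (\<integral>\<^sup>+x. ennreal (2 * \<rho>) * indicator {0..X} x \<partial>lborel)"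
  proof (intro nn_integral_mono)
    fix x :: real
    show "emeasure lborel {y. (x, y) \<in> strip X a b \<rho>} \<le> ennreal (2 * \<rho>) * indicator {0..X} x"
    proof (cases "x \<in> {0..X}")
      case True
      then have "{y. (x, y) \<in> strip X a b \<rho>} = {a * x + b - \<rho> .. a * x + b + \<rho>}"
        unfolding strip_def by (auto simp: abs_le_iff)
      then show ?thesis using True assms by simp
    next
      case False
      then have "{y. (x, y) \<in> strip X a b \<rho>} = {}" unfolding strip_def by auto
      then show ?thesis by simp
    qed
  qed
  also have "\<dots> = ennreal (2 * \<rho>) * ennreal X" using assms by (subst nn_integral_cmult_indicator) auto
  also have "\<dots> = ennreal (2 * X * \<rho>)" using assms by (simp add: ennreal_mult[symmetric] mult_ac)
  finally show ?thesis .
qed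

text \<open>Translating each vertical slice makes the first strip horizontal, and then every
  horizontal slice is an interval of length 2 \<rho>' / |a - a'|. Divided by \<rho> \<rho>' the area
  no longer depends on the widths; this is the source of the cancellation in
  \<open>strip_kernel_inside\<close>.\<close>

lemma emeasure_crossing:
  assumes "a \<noteq> a'" "0 \<le> \<rho>" "0 \<le> \<rho>'"
  shows "emeasure lborel {z::real \<times> real. \<bar>snd z - a * fst z - b\<bar> \<le> \<rho> \<and> \<bar>snd z - a' * fst z - b'\<bar> \<le> \<rho>'}
    = ennreal (4 * \<rho> * \<rho>' / \<bar>a - a'\<bar>)"
proof -
  define A where "A = {z::real \<times> real. \<bar>snd z - a * fst z - b\<bar> \<le> \<rho> \<and> \<bar>snd z - a' * fst z - b'\<bar> \<le> \<rho>'}"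
  have A: "A \<in> sets borel" unfolding A_def
    by (intro borel_closed closed_Collect_conj closed_Collect_le continuous_intros)
  define D where "D = {z::real \<times> real. \<bar>snd z\<bar> \<le> \<rho> \<and> \<bar>snd z + (a - a') * fst z + (b - b')\<bar> \<le> \<rho>'}"
  have D: "D \<in> sets borel" unfolding D_def
    by (intro borel_closed closed_Collect_conj closed_Collect_le continuous_intros)
  have D': "D \<in> sets (lborel \<Otimes>\<^sub>M lborel)" unfolding lborel_prod using D by simp
  have "emeasure lborel A = (\<integral>\<^sup>+x. emeasure lborel {y. (x, y) \<in> A} \<partial>lborel)"
    by (rule emeasure_lborel_slices[OF A])
  also have "\<dots> = (\<integral>\<^sup>+x. emeasure lborel {y. (x, y) \<in> D} \<partial>lborel)"
  proof (intro nn_integral_cong)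
    fix x :: real
    have S: "{y. (x, y) \<in> A} \<in> sets borel"
    proof -
      have "closed {y. \<bar>y - a * x - b\<bar> \<le> \<rho> \<and> \<bar>y - a' * x - b'\<bar> \<le> \<rho>'}"
        by (intro closed_Collect_conj closed_Collect_le continuous_intros)
      then show ?thesis unfolding A_def by simp
    qed
    have "emeasure lborel {y. (x, y) \<in> A} = emeasure (distr lborel borel ((+) (a * x + b))) {y. (x, y) \<in> A}"
      by (simp add: lborel_distr_plus)
    also have "\<dots> = emeasure lborel ((+) (a * x + b) -` {y. (x, y) \<in> A})"
      using S by (subst emeasure_distr) auto
    also have "(+) (a * x + b) -` {y. (x, y) \<in> A} = {y. (x, y) \<in> D}"
      unfolding A_def D_def by (auto simp: algebra_simps)
    finally show "emeasure lborel {y. (x, y) \<in> A} = emeasure lborel {y. (x, y) \<in> D}" .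
  qed
  also have "\<dots> = emeasure lborel D" by (rule emeasure_lborel_slices[OF D, symmetric])
  also have "\<dots> = (\<integral>\<^sup>+y. emeasure lborel {x. (x, y) \<in> D} \<partial>lborel)"
    unfolding lborel_prod[symmetric] using D' by (simp add: lborel_pair.emeasure_pair_measure_alt2 vimage_def)
  also have "\<dots> = (\<integral>\<^sup>+y. ennreal (2 * \<rho>' / \<bar>a - a'\<bar>) * indicator {-\<rho>..\<rho>} y \<partial>lborel)"
  proof (intro nn_integral_cong)
    fix y :: real
    show "emeasure lborel {x. (x, y) \<in> D} = ennreal (2 * \<rho>' / \<bar>a - a'\<bar>) * indicator {-\<rho>..\<rho>} y"
    proof (cases "y \<in> {-\<rho>..\<rho>}")
      case True
      define x0 where "x0 = - (y + b - b') / (a - a')"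
      have iff: "\<bar>y + (a - a') * x + (b - b')\<bar> \<le> \<rho>' \<longleftrightarrow> \<bar>x - x0\<bar> \<le> \<rho>' / \<bar>a - a'\<bar>" for x
      proof -
        have "y + (a - a') * x + (b - b') = (a - a') * (x - x0)" unfolding x0_def using assms(1) by (simp add: field_simps)
        then have "\<bar>y + (a - a') * x + (b - b')\<bar> = \<bar>a - a'\<bar> * \<bar>x - x0\<bar>" by (simp add: abs_mult)
        then show ?thesis using assms(1) by (simp add: field_simps)
      qed
      have "\<bar>y\<bar> \<le> \<rho>" using True by (simp add: abs_le_iff)
      then have "{x. (x, y) \<in> D} = {x. \<bar>x - x0\<bar> \<le> \<rho>' / \<bar>a - a'\<bar>}"
        unfolding D_def by (simp add: iff)
      also have "\<dots> = {x0 - \<rho>' / \<bar>a - a'\<bar> .. x0 + \<rho>' / \<bar>a - a'\<bar>}" by (auto simp: abs_le_iff)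
      finally have "{x. (x, y) \<in> D} = {x0 - \<rho>' / \<bar>a - a'\<bar> .. x0 + \<rho>' / \<bar>a - a'\<bar>}" .
      then show ?thesis using True assms by simp
    next
      case False
      then have "{x. (x, y) \<in> D} = {}" unfolding D_def by auto
      then show ?thesis using False by simp
    qed
  qed
  also have "\<dots> = ennreal (2 * \<rho>' / \<bar>a - a'\<bar>) * ennreal (2 * \<rho>)"
    using assms by (subst nn_integral_cmult_indicator) auto
  also have "\<dots> = ennreal (4 * \<rho> * \<rho>' / \<bar>a - a'\<bar>)" using assms by (simp add: ennreal_mult[symmetric] mult_ac)
  finally show ?thesis unfolding A_def .
qed

lemma emeasure_strip_finite: "0 \<le> X \<Longrightarrow> 0 \<le> \<rho> \<Longrightarrow> emeasure lborel (strip X a b \<rho>) < \<infinity>"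
  using emeasure_strip_le[of X \<rho> a b] by (simp add: order.strict_trans1)

lemma measure_strip_inter_le1:
  assumes "0 \<le> X" "0 \<le> \<rho>"
  shows "measure lborel (strip X a b \<rho> \<inter> B) \<le> 2 * X * \<rho>"
proof -
  have "emeasure lborel (strip X a b \<rho> \<inter> B) \<le> emeasure lborel (strip X a b \<rho>)" by (intro emeasure_mono) auto
  also have "\<dots> \<le> ennreal (2 * X * \<rho>)" by (rule emeasure_strip_le[OF assms])
  finally show ?thesis unfolding measure_def using assms by (intro enn2real_leI) auto
qed

lemma measure_strip_inter_le2:
  assumes "a \<noteq> a'" "0 \<le> \<rho>" "0 \<le> \<rho>'"
  shows "measure lborel (strip X a b \<rho> \<inter> strip X a' b' \<rho>') \<le> 4 * \<rho> * \<rho>' / \<bar>a - a'\<bar>"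
proof -
  let ?A = "{z::real \<times> real. \<bar>snd z - a * fst z - b\<bar> \<le> \<rho> \<and> \<bar>snd z - a' * fst z - b'\<bar> \<le> \<rho>'}"
  have "?A \<in> sets borel" by (intro borel_closed closed_Collect_conj closed_Collect_le continuous_intros)
  then have "emeasure lborel (strip X a b \<rho> \<inter> strip X a' b' \<rho>') \<le> emeasure lborel ?A"
    by (intro emeasure_mono) (auto simp: strip_def)
  also have "\<dots> = ennreal (4 * \<rho> * \<rho>' / \<bar>a - a'\<bar>)" by (rule emeasure_crossing[OF assms])
  finally show ?thesis unfolding measure_def using assms by (intro enn2real_leI) auto
qed

lemma measure_strip_inter_eq:
  assumes "a \<noteq> a'" "0 \<le> \<rho>" "0 \<le> \<rho>'"
    and inside: "\<And>x. \<bar>(a - a') * x + (b - b')\<bar> \<le> \<rho> + \<rho>' \<Longrightarrow> 0 \<le> x \<and> x \<le> X"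
  shows "measure lborel (strip X a b \<rho> \<inter> strip X a' b' \<rho>') = 4 * \<rho> * \<rho>' / \<bar>a - a'\<bar>"
proof -
  have "0 \<le> x \<and> x \<le> X" if "\<bar>y - a * x - b\<bar> \<le> \<rho>" "\<bar>y - a' * x - b'\<bar> \<le> \<rho>'" for x y
  proof (rule inside)
    have "(a - a') * x + (b - b') = (y - a' * x - b') - (y - a * x - b)" by (simp add: algebra_simps)
    then show "\<bar>(a - a') * x + (b - b')\<bar> \<le> \<rho> + \<rho>'" using that by linarith
  qed
  then have "strip X a b \<rho> \<inter> strip X a' b' \<rho>' = {z. \<bar>snd z - a * fst z - b\<bar> \<le> \<rho> \<and> \<bar>snd z - a' * fst z - b'\<bar> \<le> \<rho>'}"
    unfolding strip_def by auto
  moreover have "0 \<le> 4 * \<rho> * \<rho>' / \<bar>a - a'\<bar>" using assms(2,3) by simp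
  ultimately show ?thesis unfolding measure_def by (simp only: emeasure_crossing[OF assms(1-3)] enn2real_ennreal)
qed

lemma strip_inter_empty:
  assumes "\<And>x. 0 \<le> x \<Longrightarrow> x \<le> X \<Longrightarrow> \<rho> + \<rho>' < \<bar>(a - a') * x + (b - b')\<bar>"
  shows "strip X a b \<rho> \<inter> strip X a' b' \<rho>' = {}"
proof -
  have False if "\<bar>y - a * x - b\<bar> \<le> \<rho>" "\<bar>y - a' * x - b'\<bar> \<le> \<rho>'" "0 \<le> x" "x \<le> X" for x y
  proof -
    have "(a - a') * x + (b - b') = (y - a' * x - b') - (y - a * x - b)" by (simp add: algebra_simps)
    then show False using that assms[of x] by linarith
  qed
  then show ?thesis unfolding strip_def by auto
qed

text \<open>The inner product in \<open>L\<^sup>2\<close> of the functions \<open>1 / r\<close> on the strip of half-width \<open>r\<close> minus \<open>1 / r'\<close> on the strip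
  of half-width \<open>r'\<close>, for two lines.\<close>

definition strip_kernel :: "real \<Rightarrow> real \<Rightarrow> real \<Rightarrow> real \<Rightarrow> real \<Rightarrow> real \<Rightarrow> real \<Rightarrow> real" where
  "strip_kernel X r r' a b a' b' =
     measure lborel (strip X a b r \<inter> strip X a' b' r) / (r * r)
   - measure lborel (strip X a b r \<inter> strip X a' b' r') / (r * r')
   - measure lborel (strip X a b r' \<inter> strip X a' b' r) / (r' * r)
   + measure lborel (strip X a b r' \<inter> strip X a' b' r') / (r' * r')"

lemma abs_diff4_le:
  fixes B :: real
  assumes "0 \<le> p \<and> p \<le> B" "0 \<le> q \<and> q \<le> B" "0 \<le> u \<and> u \<le> B" "0 \<le> v \<and> v \<le> B"
  shows "\<bar>p - q - u + v\<bar> \<le> 4 * B"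
  using assms by linarith

lemma strip_kernel_bound_near:
  assumes "0 \<le> X" "0 < r'" "r' \<le> r"
  shows "\<bar>strip_kernel X r r' a b a' b'\<bar> \<le> 8 * X / r'"
proof -
  have r: "0 < r" using assms by linarith
  have *: "0 \<le> measure lborel (strip X a b \<rho> \<inter> strip X a' b' \<rho>') / (\<rho> * \<rho>') \<and>
     measure lborel (strip X a b \<rho> \<inter> strip X a' b' \<rho>') / (\<rho> * \<rho>') \<le> 2 * X / r'" if "0 < \<rho>" "r' \<le> \<rho>'" for \<rho> \<rho>'
  proof -
    have \<rho>': "0 < \<rho>'" using that assms by linarith
    have "measure lborel (strip X a b \<rho> \<inter> strip X a' b' \<rho>') / (\<rho> * \<rho>') \<le> 2 * X * \<rho> / (\<rho> * \<rho>')"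
      using measure_strip_inter_le1[of X \<rho> a b "strip X a' b' \<rho>'"] assms that \<rho>' by (intro divide_right_mono) auto
    also have "\<dots> = 2 * X / \<rho>'" using that by simp
    also have "\<dots> \<le> 2 * X / r'" using that assms by (intro divide_left_mono) auto
    finally show ?thesis using that \<rho>' by simp
  qed
  show ?thesis unfolding strip_kernel_def
    using abs_diff4_le[OF *[of r r] *[of r r'] *[of r' r] *[of r' r']] assms r by simp
qed

lemma strip_kernel_bound_far:
  assumes "a \<noteq> a'" "0 < r'" "r' \<le> r"
  shows "\<bar>strip_kernel X r r' a b a' b'\<bar> \<le> 16 / \<bar>a - a'\<bar>"
proof -
  have r: "0 < r" using assms by linarith
  have *: "0 \<le> measure lborel (strip X a b \<rho> \<inter> strip X a' b' \<rho>') / (\<rho> * \<rho>') \<and>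
     measure lborel (strip X a b \<rho> \<inter> strip X a' b' \<rho>') / (\<rho> * \<rho>') \<le> 4 / \<bar>a - a'\<bar>" if "0 < \<rho>" "0 < \<rho>'" for \<rho> \<rho>'
  proof -
    have "measure lborel (strip X a b \<rho> \<inter> strip X a' b' \<rho>') / (\<rho> * \<rho>') \<le> 4 * \<rho> * \<rho>' / \<bar>a - a'\<bar> / (\<rho> * \<rho>')"
      using measure_strip_inter_le2[OF assms(1), of \<rho> \<rho>' X b b'] that by (intro divide_right_mono) auto
    also have "\<dots> = 4 / \<bar>a - a'\<bar>" using that by simp
    finally show ?thesis using that by simp
  qed
  show ?thesis unfolding strip_kernel_def
    using abs_diff4_le[OF *[of r r] *[of r r'] *[of r' r] *[of r' r']] assms(2) r by simp
qed

lemma strip_kernel_disjoint: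
  assumes "0 < r'" "r' \<le> r" "\<And>x. 0 \<le> x \<Longrightarrow> x \<le> X \<Longrightarrow> 2 * r < \<bar>(a - a') * x + (b - b')\<bar>"
  shows "strip_kernel X r r' a b a' b' = 0"
proof -
  have "strip X a b \<rho> \<inter> strip X a' b' \<rho>' = {}" if "\<rho> \<le> r" "\<rho>' \<le> r" for \<rho> \<rho>'
    using that assms(3) by (intro strip_inter_empty) fastforce
  then show ?thesis unfolding strip_kernel_def using assms by simp
qed

text \<open>All four normalised areas equal 4 / |a - a'| and enter with signs +, -, -, +.\<close>

lemma strip_kernel_inside:
  assumes "a \<noteq> a'" "0 < r'" "r' \<le> r" "\<And>x. \<bar>(a - a') * x + (b - b')\<bar> \<le> 2 * r \<Longrightarrow> 0 \<le> x \<and> x \<le> X"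
  shows "strip_kernel X r r' a b a' b' = 0"
proof -
  have r: "0 < r" using assms by linarith
  have "measure lborel (strip X a b \<rho> \<inter> strip X a' b' \<rho>') / (\<rho> * \<rho>') = 4 / \<bar>a - a'\<bar>"
    if "0 < \<rho>" "\<rho> \<le> r" "0 < \<rho>'" "\<rho>' \<le> r" for \<rho> \<rho>'
  proof -
    have "measure lborel (strip X a b \<rho> \<inter> strip X a' b' \<rho>') = 4 * \<rho> * \<rho>' / \<bar>a - a'\<bar>"
    proof (rule measure_strip_inter_eq[OF assms(1)])
      fix x assume "\<bar>(a - a') * x + (b - b')\<bar> \<le> \<rho> + \<rho>'"
      then show "0 \<le> x \<and> x \<le> X" using that by (intro assms(4)) linarith
    qed (use that in simp_all)
    then show ?thesis using that by simp
  qed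
  then show ?thesis unfolding strip_kernel_def using assms r by simp
qed

text \<open>Crossings that lie fully inside the vertical slab cancel; only those at its two boundary lines contribute.\<close>

lemma strip_kernel_nonzero:
  assumes "strip_kernel X r r' a b a' b' \<noteq> 0" "a \<noteq> a'" "0 < r'" "r' \<le> r" "0 \<le> X"
  shows "\<bar>b - b'\<bar> \<le> 2 * r \<or> \<bar>(a - a') * X + (b - b')\<bar> \<le> 2 * r"
proof (rule ccontr)
  assume neg: "\<not> ?thesis"
  define \<phi> where "\<phi> = (\<lambda>x. (a - a') * x + (b - b'))"
  have \<phi>: "\<phi> x = \<phi> y + (a - a') * (x - y)" for x y unfolding \<phi>_def by (simp add: algebra_simps)
  have 0: "\<bar>\<phi> 0\<bar> > 2 * r" "\<bar>\<phi> X\<bar> > 2 * r" using neg unfolding \<phi>_def by auto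
  \<comment> \<open>Since the kernel is nonzero, the affine function \<phi> is at most 2 r in
    absolute value at some x in the slab and at some z outside it. Monotonicity carries this to the
    boundary point between them.\<close>
  obtain x where x: "0 \<le> x" "x \<le> X" "\<bar>\<phi> x\<bar> \<le> 2 * r"
    using strip_kernel_disjoint[OF assms(3,4), of X a a' b b'] assms(1) unfolding \<phi>_def by (meson not_le)
  obtain z where z: "\<bar>\<phi> z\<bar> \<le> 2 * r" "z < 0 \<or> X < z"
    using strip_kernel_inside[OF assms(2,3,4), of b b' X] assms(1) unfolding \<phi>_def by (meson not_le)
  show False
  proof (cases "a > a'")
    case True
    have mono: "\<phi> u \<le> \<phi> v" if "u \<le> v" for u v using that True unfolding \<phi>_def by simp
    show False using z(2)
    proof
      assume "z < 0"
      then have "\<phi> z \<le> \<phi> 0" "\<phi> 0 \<le> \<phi> x" using mono x by auto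
      then show False using z x 0 by linarith
    next
      assume "X < z"
      then have "\<phi> X \<le> \<phi> z" "\<phi> x \<le> \<phi> X" using mono x by auto
      then show False using z x 0 by linarith
    qed
  next
    case False
    have mono: "\<phi> v \<le> \<phi> u" if "u \<le> v" for u v using that False unfolding \<phi>_def by (simp add: mult_left_mono_neg)
    show False using z(2)
    proof
      assume "z < 0"
      then have "\<phi> 0 \<le> \<phi> z" "\<phi> x \<le> \<phi> 0" using mono x by auto
      then show False using z x 0 by linarith
    next
      assume "X < z"
      then have "\<phi> z \<le> \<phi> X" "\<phi> X \<le> \<phi> x" using mono x by auto
      then show False using z x 0 by linarith
    qed
  qed
qed

section \<open>Summing the kernel over a family of lines\<close>

lemma card_le_cover:
  fixes f :: "'a \<Rightarrow> real"
  assumes "finite L" and c: "\<And>\<beta>. real (card {l \<in> L. S l \<and> \<beta> \<le> f l \<and> f l \<le> \<beta> + r}) \<le> c"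
  shows "real (card {l \<in> L. S l \<and> \<beta> \<le> f l \<and> f l \<le> \<beta> + real (Suc n) * r}) \<le> real (Suc n) * c"
proof (induction n)
  case 0
  then show ?case using c[of \<beta>] by simp
next
  case (Suc n)
  define \<gamma> where "\<gamma> = \<beta> + real (Suc n) * r"
  have "{l \<in> L. S l \<and> \<beta> \<le> f l \<and> f l \<le> \<beta> + real (Suc (Suc n)) * r} \<subseteq>
      {l \<in> L. S l \<and> \<beta> \<le> f l \<and> f l \<le> \<gamma>} \<union> {l \<in> L. S l \<and> \<gamma> \<le> f l \<and> f l \<le> \<gamma> + r}"
    unfolding \<gamma>_def by (auto simp: algebra_simps)
  then have "card {l \<in> L. S l \<and> \<beta> \<le> f l \<and> f l \<le> \<beta> + real (Suc (Suc n)) * r} \<le>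
      card ({l \<in> L. S l \<and> \<beta> \<le> f l \<and> f l \<le> \<gamma>} \<union> {l \<in> L. S l \<and> \<gamma> \<le> f l \<and> f l \<le> \<gamma> + r})"
    using assms(1) by (intro card_mono) auto
  also have "\<dots> \<le> card {l \<in> L. S l \<and> \<beta> \<le> f l \<and> f l \<le> \<gamma>} + card {l \<in> L. S l \<and> \<gamma> \<le> f l \<and> f l \<le> \<gamma> + r}"
    by (rule card_Un_le)
  finally have "real (card {l \<in> L. S l \<and> \<beta> \<le> f l \<and> f l \<le> \<beta> + real (Suc (Suc n)) * r}) \<le>
      real (card {l \<in> L. S l \<and> \<beta> \<le> f l \<and> f l \<le> \<gamma>}) + real (card {l \<in> L. S l \<and> \<gamma> \<le> f l \<and> f l \<le> \<gamma> + r})"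
    by (simp only: of_nat_add[symmetric] of_nat_le_iff)
  then show ?case using Suc.IH c[of \<gamma>] unfolding \<gamma>_def[symmetric] by (simp add: algebra_simps)
qed

lemma sum_le_card_mult:
  fixes f :: "'a \<Rightarrow> real"
  assumes "finite A" "\<And>x. x \<in> A \<Longrightarrow> \<not> S x \<Longrightarrow> f x = 0" "\<And>x. x \<in> A \<Longrightarrow> S x \<Longrightarrow> f x \<le> b"
  shows "sum f A \<le> real (card {x \<in> A. S x}) * b"
proof -
  have "sum f A = sum f {x \<in> A. S x}" using assms by (intro sum.mono_neutral_right) auto
  also have "\<dots> \<le> real (card {x \<in> A. S x}) * b" using assms by (intro sum_bounded_above) auto
  finally show ?thesis .
qed

lemma harm_le_ln:
  assumes "0 < n"
  shows "harm n \<le> 1 + ln (real n)"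
proof -
  obtain k where k: "n = Suc k" using assms by (cases n) auto
  have "harm (Suc k) - ln (real (Suc k)) \<le> harm (Suc 0) - ln (real (Suc 0))"
    using decseqD[OF decseq_harm_diff_ln, of 0 k] by simp
  then show ?thesis unfolding k by (simp add: harm_expand)
qed

text \<open>Lines are sorted by slope difference in units of r. At difference about w r with w \<ge>
  1 the kernel is at most 16 / (r w), and it is nonzero only if the crossing is near one of the two
  boundary lines, which leaves X + 8 parameter boxes of side r. Summing over w gives the harmonic
  number. For the two nearest classes disjointness alone leaves 2 X + 4 boxes, with kernel at most 8
  X / r'.\<close>

lemma strip_kernel_sum:
  fixes la lb :: "'l \<Rightarrow> real" and X N :: nat
  assumes L: "finite L" and r: "0 < r'" "r' \<le> r"
    and N: "\<And>l l'. l \<in> L \<Longrightarrow> l' \<in> L \<Longrightarrow> \<bar>la l' - la l\<bar> \<le> real N * r"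
    and mL: "\<And>\<alpha> \<beta>. real (card {l \<in> L. (\<alpha> \<le> la l \<and> la l \<le> \<alpha> + r) \<and> \<beta> \<le> lb l \<and> lb l \<le> \<beta> + r}) \<le> mL"
    and l: "l \<in> L"
  shows "(\<Sum>l'\<in>L. \<bar>strip_kernel (real X) r r' (la l) (lb l) (la l') (lb l')\<bar>)
     \<le> 32 * (real X + 8)\<^sup>2 * mL / r' * (1 + harm (Suc N))"
proof -
  define K where "K = (\<lambda>l'. \<bar>strip_kernel (real X) r r' (la l) (lb l) (la l') (lb l')\<bar>)"
  define j where "j = (\<lambda>l'. \<lfloor>(la l' - la l) / r\<rfloor>)"
  have r0: "0 < r" using r by linarith
  have mL0: "0 \<le> mL" using mL[of 0 0] by (meson of_nat_0_le_iff order_trans)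
  have jr: "la l + of_int (j l') * r \<le> la l' \<and> la l' \<le> la l + of_int (j l') * r + r" for l'
  proof -
    have "of_int (j l') \<le> (la l' - la l) / r" "(la l' - la l) / r \<le> of_int (j l') + 1" unfolding j_def by linarith+
    then show ?thesis using r0 by (simp add: field_simps)
  qed
  have jN: "j l' \<in> {- int N - 1..int N}" if "l' \<in> L" for l'
  proof -
    have "- real N * r \<le> la l' - la l" "la l' - la l \<le> real N * r" using N[OF l that] by linarith+
    then have "- real N \<le> (la l' - la l) / r" "(la l' - la l) / r \<le> real N"
      using r0 by (simp_all add: field_simps)
    then show ?thesis unfolding j_def by (simp; linarith)
  qed
  have cov: "real (card {l' \<in> {l' \<in> L. j l' = i}. \<beta> \<le> lb l' \<and> lb l' \<le> \<beta> + real (Suc n) * r}) \<le> real (Suc n) * mL" for i \<beta> n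
  proof -
    have "real (card {l' \<in> L. j l' = i \<and> \<beta> \<le> lb l' \<and> lb l' \<le> \<beta> + real (Suc n) * r}) \<le> real (Suc n) * mL"
    proof (rule card_le_cover[OF L])
      fix \<beta>
      have "card {l' \<in> L. j l' = i \<and> \<beta> \<le> lb l' \<and> lb l' \<le> \<beta> + r} \<le>
        card {l' \<in> L. (la l + of_int i * r \<le> la l' \<and> la l' \<le> la l + of_int i * r + r) \<and> \<beta> \<le> lb l' \<and> lb l' \<le> \<beta> + r}"
        using jr L by (intro card_mono) auto
      then show "real (card {l' \<in> L. j l' = i \<and> \<beta> \<le> lb l' \<and> lb l' \<le> \<beta> + r}) \<le> mL"
        using mL[of "la l + of_int i * r" \<beta>] by linarith
    qed
    then show ?thesis by simp
  qed
  have near: "(\<Sum>l'\<in>{l' \<in> L. j l' = i}. K l') \<le> (2 * real X + 4) * mL * (8 * real X / r')" if i: "i = -1 \<or> i = 0" for i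
  proof -
    define n where "n = 2 * X + 3"
    define S where "S = (\<lambda>l'. lb l - (real X + 2) * r \<le> lb l' \<and> lb l' \<le> lb l - (real X + 2) * r + real (Suc n) * r)"
    have z: "K l' = 0" if "l' \<in> {l' \<in> L. j l' = i}" "\<not> S l'" for l'
    proof -
      have j': "j l' = i" using that by simp
      have la: "\<bar>la l - la l'\<bar> \<le> r"
        using jr[of l'] i r0 unfolding j' by (auto simp: abs_le_iff)
      have big: "(real X + 2) * r < \<bar>lb l - lb l'\<bar>"
        using that(2) unfolding S_def n_def by (auto simp: algebra_simps)
      have "strip_kernel (real X) r r' (la l) (lb l) (la l') (lb l') = 0"
      proof (rule strip_kernel_disjoint[OF r])
        fix x :: real assume x: "0 \<le> x" "x \<le> real X"
        have "\<bar>(la l - la l') * x\<bar> \<le> r * real X" unfolding abs_mult using la x r0 by (intro mult_mono) auto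
        then show "2 * r < \<bar>(la l - la l') * x + (lb l - lb l')\<bar>" using big by (simp add: algebra_simps abs_if split: if_splits)
      qed
      then show ?thesis unfolding K_def by simp
    qed
    have "(\<Sum>l'\<in>{l' \<in> L. j l' = i}. K l') \<le> real (card {l' \<in> {l' \<in> L. j l' = i}. S l'}) * (8 * real X / r')"
      using L z strip_kernel_bound_near[of "real X" r' r] r unfolding K_def by (intro sum_le_card_mult) auto
    also have "\<dots> \<le> (real (Suc n) * mL) * (8 * real X / r')"
      unfolding S_def using cov[of i "lb l - (real X + 2) * r" n] r by (intro mult_right_mono) auto
    also have "real (Suc n) = 2 * real X + 4" unfolding n_def by simp
    finally show ?thesis .
  qed
  have far: "(\<Sum>l'\<in>{l' \<in> L. j l' = i}. K l') \<le> (real X + 8) * mL * (16 / (r * w))"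
    if i: "(i = int w \<or> i = - int w - 1)" and w: "1 \<le> w" for i w
  proof -
    have dist: "r * real w \<le> \<bar>la l - la l'\<bar>" if "j l' = i" for l'
    proof -
      from i show ?thesis
      proof
        assume "i = int w"
        then have "of_int (j l') = real w" using that by simp
        then have "la l + real w * r \<le> la l'" using jr[of l'] by simp
        then show ?thesis by (simp add: mult.commute)
      next
        assume "i = - int w - 1"
        then have w': "of_int (j l') = - real w - 1" using that by simp
        have "la l' \<le> la l + (- real w - 1) * r + r" using jr[of l'] unfolding w' by simp
        then show ?thesis by (simp add: algebra_simps)
      qed
    qed
    have rw: "0 < r * real w" using r0 w by simp
    define \<beta>1 where "\<beta>1 = lb l - 2 * r"
    \<comment> \<open>At x = X the slope range of the class, of length r, moves the height by up to
      X r; together with the tolerance 2 r on both sides this gives an interval of length (X + 4)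
      r.\<close>
    define \<beta>2 where "\<beta>2 = lb l - real X * (of_int i + 1) * r - 2 * r"
    define S1 where "S1 = (\<lambda>l'. \<beta>1 \<le> lb l' \<and> lb l' \<le> \<beta>1 + real (Suc 3) * r)"
    define S2 where "S2 = (\<lambda>l'. \<beta>2 \<le> lb l' \<and> lb l' \<le> \<beta>2 + real (Suc (X + 3)) * r)"
    have z: "K l' = 0" if "l' \<in> {l' \<in> L. j l' = i}" "\<not> (S1 l' \<or> S2 l')" for l'
    proof (rule ccontr)
      assume "K l' \<noteq> 0"
      then have nz: "strip_kernel (real X) r r' (la l) (lb l) (la l') (lb l') \<noteq> 0" unfolding K_def by simp
      have j': "j l' = i" using that by simp
      have "la l \<noteq> la l'" using dist[OF j'] rw by auto
      from strip_kernel_nonzero[OF nz this r] have "S1 l' \<or> S2 l'"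
      proof (rule disjE)
        assume "\<bar>lb l - lb l'\<bar> \<le> 2 * r"
        then show ?thesis unfolding S1_def \<beta>1_def by (auto simp: abs_le_iff)
      next
        assume A: "\<bar>(la l - la l') * real X + (lb l - lb l')\<bar> \<le> 2 * r"
        have u: "of_int i * r \<le> la l' - la l" "la l' - la l \<le> (of_int i + 1) * r"
          using jr[of l'] unfolding j' by (simp_all add: algebra_simps)
        have "real X * (of_int i * r) \<le> real X * (la l' - la l)" "real X * (la l' - la l) \<le> real X * ((of_int i + 1) * r)"
          using u by (auto intro!: mult_left_mono)
        then show ?thesis using A unfolding S2_def \<beta>2_def by (auto simp: abs_le_iff algebra_simps)
      qed simp
      then show False using that(2) by simp
    qed
    have b: "K l' \<le> 16 / (r * real w)" if "l' \<in> {l' \<in> L. j l' = i}" for l'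
    proof -
      have j': "j l' = i" using that by simp
      have "la l \<noteq> la l'" using dist[OF j'] rw by auto
      then have "K l' \<le> 16 / \<bar>la l - la l'\<bar>" unfolding K_def using strip_kernel_bound_far r by blast
      also have "\<dots> \<le> 16 / (r * real w)" using dist[OF j'] rw by (intro divide_left_mono) auto
      finally show ?thesis .
    qed
    have "(\<Sum>l'\<in>{l' \<in> L. j l' = i}. K l') \<le> real (card {l' \<in> {l' \<in> L. j l' = i}. S1 l' \<or> S2 l'}) * (16 / (r * real w))"
      using L z b by (intro sum_le_card_mult) auto
    also have "\<dots> \<le> ((real X + 8) * mL) * (16 / (r * real w))"
    proof (rule mult_right_mono)
      have "{l' \<in> {l' \<in> L. j l' = i}. S1 l' \<or> S2 l'} = {l' \<in> {l' \<in> L. j l' = i}. S1 l'} \<union> {l' \<in> {l' \<in> L. j l' = i}. S2 l'}" by auto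
      then have "real (card {l' \<in> {l' \<in> L. j l' = i}. S1 l' \<or> S2 l'}) \<le>
          real (card {l' \<in> {l' \<in> L. j l' = i}. S1 l'}) + real (card {l' \<in> {l' \<in> L. j l' = i}. S2 l'})"
        by (simp only: of_nat_add[symmetric] of_nat_le_iff card_Un_le)
      also have "\<dots> \<le> real (Suc 3) * mL + real (Suc (X + 3)) * mL"
        unfolding S1_def S2_def by (intro add_mono cov)
      also have "\<dots> = (real X + 8) * mL" by (simp add: algebra_simps)
      finally show "real (card {l' \<in> {l' \<in> L. j l' = i}. S1 l' \<or> S2 l'}) \<le> (real X + 8) * mL" .
    qed (use rw in simp)
    finally show ?thesis .
  qed
  define T where "T = (\<lambda>i. \<Sum>l'\<in>{l' \<in> L. j l' = i}. K l')"
  have "(\<Sum>l'\<in>L. K l') = (\<Sum>i\<in>{- int N - 1..int N}. T i)"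
    unfolding T_def using L jN by (intro sum.group[symmetric]) auto
  \<comment> \<open>The classes w and - w - 1 lie on either side of the slope of l at distance at
    least w r; the two with w = 0 are the near ones.\<close>
  also have "\<dots> = (\<Sum>w\<in>{0..N}. T (int w) + T (- int w - 1))"
  proof -
    have "{- int N - 1..int N} = (\<lambda>w. int w) ` {0..N} \<union> (\<lambda>w. - int w - 1) ` {0..N}"
    proof (intro equalityI subsetI)
      fix i assume i: "i \<in> {- int N - 1..int N}"
      show "i \<in> (\<lambda>w. int w) ` {0..N} \<union> (\<lambda>w. - int w - 1) ` {0..N}"
      proof (cases "0 \<le> i")
        case True
        then have "i = int (nat i)" "nat i \<in> {0..N}" using i by auto
        then show ?thesis by blast
      next
        case False
        then have "i = - int (nat (- i - 1)) - 1" "nat (- i - 1) \<in> {0..N}" using i by auto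
        then show ?thesis by blast
      qed
    qed auto
    moreover have "(\<lambda>w. int w) ` {0..N} \<inter> (\<lambda>w. - int w - 1) ` {0..N} = {}" by auto
    ultimately have "(\<Sum>i\<in>{- int N - 1..int N}. T i) = (\<Sum>i\<in>(\<lambda>w. int w) ` {0..N}. T i) + (\<Sum>i\<in>(\<lambda>w. - int w - 1) ` {0..N}. T i)"
      by (simp add: sum.union_disjoint)
    also have "\<dots> = (\<Sum>w\<in>{0..N}. T (int w)) + (\<Sum>w\<in>{0..N}. T (- int w - 1))"
      by (subst (1 2) sum.reindex) (auto simp: inj_on_def)
    finally show ?thesis by (simp add: sum.distrib)
  qed
  also have "\<dots> = T 0 + T (- 1) + (\<Sum>w\<in>{1..N}. T (int w) + T (- int w - 1))"
    by (subst sum.atLeast_Suc_atMost) auto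
  also have "\<dots> \<le> 2 * ((2 * real X + 4) * mL * (8 * real X / r')) + (\<Sum>w\<in>{1..N}. 2 * ((real X + 8) * mL * (16 / (r * real w))))"
  proof (intro add_mono sum_mono)
    show "T 0 + T (- 1) \<le> 2 * ((2 * real X + 4) * mL * (8 * real X / r'))"
      using add_mono[OF near[OF disjI2[OF refl]] near[OF disjI1[OF refl]]] unfolding T_def mult_2 .
    fix w assume w: "w \<in> {1..N}"
    then have "1 \<le> w" by simp
    then show "T (int w) + T (- int w - 1) \<le> 2 * ((real X + 8) * mL * (16 / (r * real w)))"
      using add_mono[OF far[OF disjI1[OF refl], of w] far[OF disjI2[OF refl], of w]] unfolding T_def mult_2 by blast
  qed
  also have "(\<Sum>w\<in>{1..N}. 2 * ((real X + 8) * mL * (16 / (r * real w)))) = 32 * (real X + 8) * mL / r * harm N"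
    unfolding harm_def sum_distrib_left by (intro sum.cong) (auto simp: field_simps)
  also have "2 * ((2 * real X + 4) * mL * (8 * real X / r')) + 32 * (real X + 8) * mL / r * harm N
      \<le> 32 * (real X + 8)\<^sup>2 * mL / r' + 32 * (real X + 8)\<^sup>2 * mL / r' * harm (Suc N)"
  proof (rule add_mono)
    have "2 * ((2 * real X + 4) * mL * (8 * real X / r')) = (32 * (real X * (real X + 2)) * mL) / r'" by (simp add: field_simps)
    also have "\<dots> \<le> 32 * (real X + 8)\<^sup>2 * mL / r'" using r mL0
      by (intro divide_right_mono mult_right_mono) (auto simp: power2_eq_square algebra_simps)
    finally show "2 * ((2 * real X + 4) * mL * (8 * real X / r')) \<le> 32 * (real X + 8)\<^sup>2 * mL / r'" .
    have h: "harm N \<le> (harm (Suc N) :: real)" by (rule harm_mono) simp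
    have "32 * (real X + 8) * mL / r \<le> 32 * (real X + 8)\<^sup>2 * mL / r'"
      using r r0 mL0 by (intro frac_le mult_right_mono mult_left_mono) (auto simp: power2_eq_square algebra_simps)
    then show "32 * (real X + 8) * mL / r * harm N \<le> 32 * (real X + 8)\<^sup>2 * mL / r' * harm (Suc N)"
      using h mL0 r by (intro mult_mono) (auto simp: harm_nonneg)
  qed
  finally show ?thesis unfolding K_def by (simp add: distrib_left)
qed

definition incidences :: "('p \<Rightarrow> real) \<Rightarrow> ('p \<Rightarrow> real) \<Rightarrow> ('l \<Rightarrow> real) \<Rightarrow> ('l \<Rightarrow> real) \<Rightarrow> 'p set \<Rightarrow> 'l set \<Rightarrow> real \<Rightarrow> ('p \<times> 'l) set" where
  "incidences px py la lb P L \<rho> = {(p, l). p \<in> P \<and> l \<in> L \<and> \<bar>py p - la l * px p - lb l\<bar> \<le> \<rho>}"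

lemma square_strip_deviation:
  assumes "z \<in> square x y h" "\<bar>a\<bar> \<le> R" "0 \<le> h"
  shows "\<bar>(snd z - a * fst z - b) - (y - a * x - b)\<bar> \<le> (1 + R) * h"
proof -
  have z: "0 \<le> fst z - x" "fst z - x \<le> h" "0 \<le> snd z - y" "snd z - y \<le> h" using assms(1) unfolding square_def by auto
  have "\<bar>a * (fst z - x)\<bar> \<le> R * h" unfolding abs_mult using assms z by (intro mult_mono) auto
  moreover have "(snd z - a * fst z - b) - (y - a * x - b) = (snd z - y) - a * (fst z - x)" by (simp add: algebra_simps)
  moreover have "(1 + R) * h = h + R * h" by (simp add: algebra_simps)
  ultimately show ?thesis using z by linarith
qed

lemma sum_Times_bool:
  fixes f :: "'l \<times> bool \<Rightarrow> real"
  shows "(\<Sum>j\<in>L \<times> (UNIV :: bool set). f j) = (\<Sum>l\<in>L. f (l, True) + f (l, False))"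
  unfolding sum.cartesian_product[symmetric, of "\<lambda>l b. f (l, b)", simplified]
  by (simp add: UNIV_bool add.commute)

text \<open>A high-low argument in physical space. Points become squares of side h, and a line
  becomes its strip function at width r minus that at width r'. The integral of the product compares
  the two incidence counts. Cauchy-Schwarz bounds it by the overlaps of squares times the kernel
  sum, in which the crossings inside the slab have cancelled. Over a square the height above a line
  varies by at most (1 + R) h, whence the shifts of both thresholds.\<close>

lemma incidences_high_low:
  fixes px py :: "'p \<Rightarrow> real" and la lb :: "'l \<Rightarrow> real" and X N :: nat
  assumes fin: "finite P" "finite L" and r: "0 < r'" "r' \<le> r" and h: "0 < h" "h \<le> 1"
    and px: "\<And>p. p \<in> P \<Longrightarrow> 0 \<le> px p \<and> px p + 1 \<le> real X"
    and R: "\<And>l. l \<in> L \<Longrightarrow> \<bar>la l\<bar> \<le> R" and N: "2 * R \<le> real N * r"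
    and mP: "\<And>p. p \<in> P \<Longrightarrow> real (card {p' \<in> P. \<bar>px p' - px p\<bar> \<le> h \<and> \<bar>py p' - py p\<bar> \<le> h}) \<le> mP"
    and mL: "\<And>\<alpha> \<beta>. real (card {l \<in> L. (\<alpha> \<le> la l \<and> la l \<le> \<alpha> + r) \<and> \<beta> \<le> lb l \<and> lb l \<le> \<beta> + r}) \<le> mL"
  shows "real (card (incidences px py la lb P L (r - (1 + R) * h))) / r \<le>
      real (card (incidences px py la lb P L (r' + (1 + R) * h))) / r' +
      sqrt (real (card P) * mP * (real (card L) * (32 * (real X + 8)\<^sup>2 * mL / r' * (1 + harm (Suc N))))) / h"
proof -
  define Inc where "Inc = incidences px py la lb P L"
  define Sq where "Sq = (\<lambda>p. square (px p) (py p) h)"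
  define St where "St = (\<lambda>l. strip (real X) (la l) (lb l))"
  \<comment> \<open>The Boolean selects the width. With the signed weights \<open>d\<close>, the
    Gram sum over \<open>L \<times> UNIV\<close> becomes the double sum of
    \<open>strip_kernel\<close>.\<close>
  define B where "B = (\<lambda>(l, t). St l (if t then r else r'))"
  define d where "d = (\<lambda>(l::'l, t). if t then 1 / r else - 1 / r')"
  have r0: "0 < r" using r by linarith
  define \<mu> where "\<mu> = (measure lborel :: (real \<times> real) set \<Rightarrow> real)"
  have Sq_meas: "Sq p \<in> sets lborel \<and> emeasure lborel (Sq p) < \<infinity>" for p
    unfolding Sq_def using h by (simp add: emeasure_square)
  have St_meas: "St l \<rho> \<in> sets lborel \<and> emeasure lborel (St l \<rho>) < \<infinity>" if "0 \<le> \<rho>" for l \<rho>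
    unfolding St_def using that emeasure_strip_finite[of "real X" \<rho>] by simp
  have B_meas: "B j \<in> sets lborel \<and> emeasure lborel (B j) < \<infinity>" for j
    unfolding B_def using St_meas r r0 by (cases j) auto
  have Sq_le: "\<mu> (Sq p \<inter> A) \<le> h * h" for p A
  proof -
    have "emeasure lborel (Sq p \<inter> A) \<le> emeasure lborel (Sq p)" using Sq_meas by (intro emeasure_mono) auto
    also have "\<dots> = ennreal (h * h)" unfolding Sq_def using h by (simp add: emeasure_square)
    finally show ?thesis unfolding \<mu>_def measure_def using h by (intro enn2real_leI) auto
  qed
  have \<mu>0: "0 \<le> \<mu> A" for A unfolding \<mu>_def by simp
  define Q where "Q = (\<Sum>p\<in>P. \<Sum>p'\<in>P. \<mu> (Sq p \<inter> Sq p'))"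
  define K where "K = (\<Sum>l\<in>L. \<Sum>l'\<in>L. strip_kernel (real X) r r' (la l) (lb l) (la l') (lb l'))"
  define S where "S = (\<Sum>p\<in>P. \<Sum>l\<in>L. \<mu> (Sq p \<inter> St l r) / r - \<mu> (Sq p \<inter> St l r') / r')"
  have "S\<^sup>2 \<le> Q * K"
  proof -
    have "(\<Sum>p\<in>P. \<Sum>j\<in>L \<times> UNIV. 1 * d j * measure lborel (Sq p \<inter> B j))\<^sup>2 \<le>
       (\<Sum>p\<in>P. \<Sum>p'\<in>P. 1 * 1 * measure lborel (Sq p \<inter> Sq p')) *
       (\<Sum>j\<in>L \<times> UNIV. \<Sum>j'\<in>L \<times> UNIV. d j * d j' * measure lborel (B j \<inter> B j'))"
      using fin Sq_meas B_meas by (intro measure_gram_Cauchy_Schwarz) auto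
    moreover have "(\<Sum>p\<in>P. \<Sum>j\<in>L \<times> UNIV. 1 * d j * measure lborel (Sq p \<inter> B j)) = S"
      unfolding S_def sum_Times_bool d_def B_def \<mu>_def by simp
    moreover have "(\<Sum>j\<in>L \<times> UNIV. \<Sum>j'\<in>L \<times> UNIV. d j * d j' * measure lborel (B j \<inter> B j')) = K"
      unfolding K_def sum_Times_bool d_def B_def strip_kernel_def St_def
      by (simp add: sum.distrib sum_subtractf sum_negf)
    ultimately show ?thesis unfolding Q_def \<mu>_def by simp
  qed
  moreover have "Q \<le> real (card P) * mP * (h * h)"
  proof -
    have "(\<Sum>p'\<in>P. \<mu> (Sq p \<inter> Sq p')) \<le> mP * (h * h)" if p: "p \<in> P" for p
    proof -
      have "(\<Sum>p'\<in>P. \<mu> (Sq p \<inter> Sq p')) \<le> real (card {p' \<in> P. \<bar>px p' - px p\<bar> \<le> h \<and> \<bar>py p' - py p\<bar> \<le> h}) * (h * h)"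
      proof (rule sum_le_card_mult[OF fin(1)])
        fix p' assume "p' \<in> P" "\<not> (\<bar>px p' - px p\<bar> \<le> h \<and> \<bar>py p' - py p\<bar> \<le> h)"
        then have "Sq p \<inter> Sq p' = {}" unfolding Sq_def square_def by (auto simp: abs_le_iff)
        then show "\<mu> (Sq p \<inter> Sq p') = 0" unfolding \<mu>_def by simp
      qed (rule Sq_le)
      also have "\<dots> \<le> mP * (h * h)" using mP[OF p] by (intro mult_right_mono) auto
      finally show ?thesis .
    qed
    then have "Q \<le> (\<Sum>p\<in>P. mP * (h * h))" unfolding Q_def by (intro sum_mono) auto
    then show ?thesis by simp
  qed
  moreover have "0 \<le> Q" unfolding Q_def using \<mu>0 by (intro sum_nonneg) auto
  moreover define Kb where "Kb = 32 * (real X + 8)\<^sup>2 * mL / r' * (1 + harm (Suc N))"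
  have Kle: "K \<le> real (card L) * Kb"
  proof -
    have "(\<Sum>l'\<in>L. strip_kernel (real X) r r' (la l) (lb l) (la l') (lb l')) \<le> Kb" if l: "l \<in> L" for l
    proof -
      have NR: "\<bar>la l2 - la l1\<bar> \<le> real N * r" if "l1 \<in> L" "l2 \<in> L" for l1 l2
        using R[OF that(1)] R[OF that(2)] N by linarith
      have "(\<Sum>l'\<in>L. strip_kernel (real X) r r' (la l) (lb l) (la l') (lb l'))
          \<le> (\<Sum>l'\<in>L. \<bar>strip_kernel (real X) r r' (la l) (lb l) (la l') (lb l')\<bar>)" by (intro sum_mono) auto
      also have "\<dots> \<le> Kb" unfolding Kb_def by (rule strip_kernel_sum[OF fin(2) r NR mL l])
      finally show ?thesis .
    qed
    then have "K \<le> (\<Sum>l\<in>L. Kb)" unfolding K_def by (intro sum_mono) auto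
    then show ?thesis by simp
  qed
  moreover have "0 \<le> real (card L) * Kb"
  proof -
    have "0 \<le> mL" using mL[of 0 0] by (meson of_nat_0_le_iff order_trans)
    moreover have "0 \<le> (harm (Suc N) :: real)" by (rule harm_nonneg)
    ultimately show ?thesis unfolding Kb_def using r
      by (intro mult_nonneg_nonneg divide_nonneg_nonneg add_nonneg_nonneg) simp_all
  qed
  ultimately have "S\<^sup>2 \<le> (real (card P) * mP * (h * h)) * (real (card L) * Kb)"
    using mult_left_mono[OF Kle, of Q] mult_right_mono[of Q "real (card P) * mP * (h * h)" "real (card L) * Kb"]
    by linarith
  then have "S\<^sup>2 \<le> h\<^sup>2 * (real (card P) * mP * (real (card L) * Kb))" by (simp add: power2_eq_square mult_ac)
  then have "sqrt (S\<^sup>2) \<le> sqrt (h\<^sup>2 * (real (card P) * mP * (real (card L) * Kb)))" by (rule real_sqrt_le_mono)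
  then have Sle: "S \<le> h * sqrt (real (card P) * mP * (real (card L) * Kb))" using h by (simp add: real_sqrt_mult)
  have split: "S = (\<Sum>p\<in>P. \<Sum>l\<in>L. \<mu> (Sq p \<inter> St l r)) / r - (\<Sum>p\<in>P. \<Sum>l\<in>L. \<mu> (Sq p \<inter> St l r')) / r'"
    unfolding S_def by (simp add: sum_subtractf sum_divide_distrib)
  have Inc_card: "real (card (Inc \<rho>)) * (h * h) = (\<Sum>p\<in>P. \<Sum>l\<in>L. if \<bar>py p - la l * px p - lb l\<bar> \<le> \<rho> then h * h else 0)" for \<rho>
  proof -
    define C where "C = (\<lambda>z. \<bar>py (fst z) - la (snd z) * px (fst z) - lb (snd z)\<bar> \<le> \<rho>)"
    have "(\<Sum>p\<in>P. \<Sum>l\<in>L. if \<bar>py p - la l * px p - lb l\<bar> \<le> \<rho> then h * h else 0) =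
        (\<Sum>z\<in>P \<times> L. if C z then h * h else 0)"
      unfolding C_def by (simp add: sum.cartesian_product split_beta)
    also have "\<dots> = (\<Sum>z\<in>{z \<in> P \<times> L. C z}. h * h)" using fin by (simp only: sum.inter_filter finite_cartesian_product)
    also have "{z \<in> P \<times> L. C z} = Inc \<rho>" unfolding Inc_def incidences_def C_def by auto
    finally show ?thesis by simp
  qed
  have lower: "real (card (Inc (r - (1 + R) * h))) * (h * h) \<le> (\<Sum>p\<in>P. \<Sum>l\<in>L. \<mu> (Sq p \<inter> St l r))"
    unfolding Inc_card
  proof (intro sum_mono)
    fix p l assume pl: "p \<in> P" "l \<in> L"
    show "(if \<bar>py p - la l * px p - lb l\<bar> \<le> r - (1 + R) * h then h * h else 0) \<le> \<mu> (Sq p \<inter> St l r)"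
    proof (cases "\<bar>py p - la l * px p - lb l\<bar> \<le> r - (1 + R) * h")
      case True
      have "Sq p \<subseteq> St l r"
      proof
        fix z assume z: "z \<in> Sq p"
        then have "\<bar>snd z - la l * fst z - lb l\<bar> \<le> r"
          using square_strip_deviation[of z "px p" "py p" h "la l" R "lb l"] R[OF pl(2)] h True unfolding Sq_def by linarith
        then show "z \<in> St l r" using z px[OF pl(1)] h unfolding Sq_def square_def St_def strip_def by auto
      qed
      then have "Sq p \<inter> St l r = Sq p" by blast
      then have "\<mu> (Sq p \<inter> St l r) = h * h"
        unfolding \<mu>_def measure_def Sq_def using h by (simp add: emeasure_square)
      then show ?thesis by simp
    qed (use \<mu>0 in simp)
  qed
  have upper: "(\<Sum>p\<in>P. \<Sum>l\<in>L. \<mu> (Sq p \<inter> St l r')) \<le> real (card (Inc (r' + (1 + R) * h))) * (h * h)"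
    unfolding Inc_card
  proof (intro sum_mono)
    fix p l assume pl: "p \<in> P" "l \<in> L"
    show "\<mu> (Sq p \<inter> St l r') \<le> (if \<bar>py p - la l * px p - lb l\<bar> \<le> r' + (1 + R) * h then h * h else 0)"
    proof (cases "\<bar>py p - la l * px p - lb l\<bar> \<le> r' + (1 + R) * h")
      case True
      then show ?thesis using Sq_le by simp
    next
      case False
      have "Sq p \<inter> St l r' = {}"
      proof -
        have "\<not> \<bar>snd z - la l * fst z - lb l\<bar> \<le> r'" if "z \<in> Sq p" for z
          using square_strip_deviation[of z "px p" "py p" h "la l" R "lb l"] R[OF pl(2)] h False that unfolding Sq_def by linarith
        then show ?thesis unfolding St_def strip_def by blast
      qed
      then show ?thesis using False unfolding \<mu>_def by simp
    qed
  qed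
  have "real (card (Inc (r - (1 + R) * h))) * (h * h) / r \<le>
      real (card (Inc (r' + (1 + R) * h))) * (h * h) / r' + h * sqrt (real (card P) * mP * (real (card L) * Kb))"
    using divide_right_mono[OF lower, of r] divide_right_mono[OF upper, of r'] r r0 Sle split by linarith
  then have "(h * h) * (real (card (Inc (r - (1 + R) * h))) / r) \<le>
      (h * h) * (real (card (Inc (r' + (1 + R) * h))) / r' + sqrt (real (card P) * mP * (real (card L) * Kb)) / h)"
    using h by (simp add: algebra_simps)
  then show ?thesis unfolding Inc_def[symmetric] Kb_def[symmetric]
    by (rule mult_left_le_imp_le) (use h in simp)
qed

subsection \<open>Fibres of finite colourings\<close>

definition fibre :: "'a set \<Rightarrow> ('a \<Rightarrow> 'c) \<Rightarrow> 'a \<Rightarrow> 'a set" where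
  "fibre X f u = {v \<in> X. f v = f u}"

lemma finite_fibre: "finite X \<Longrightarrow> finite (fibre X f u)"
  unfolding fibre_def by simp

lemma card_eq_sum_fibres:
  assumes "finite X" "Y \<subseteq> X"
  shows "card Y = (\<Sum>k\<in>f ` X. card {v \<in> Y. f v = k})"
proof -
  have fY: "finite Y" using assms finite_subset by blast
  have "card Y = (\<Sum>v\<in>Y. 1)" by simp
  also have "\<dots> = (\<Sum>k\<in>f ` X. \<Sum>v\<in>{v \<in> Y. f v = k}. 1)"
    using assms fY by (intro sum.group[symmetric]) auto
  finally show ?thesis by simp
qed

lemma card_light_fibres:
  assumes "finite X" "X \<noteq> {}"
  shows "real (card {u \<in> X. real (card (fibre X f u)) < real (card X) / (4 * real (card (f ` X)))}) \<le> real (card X) / 4"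
proof -
  define N where "N = card (f ` X)"
  have N: "0 < N" unfolding N_def using assms by (simp add: card_gt_0_iff)
  define b where "b = real (card X) / (4 * real N)"
  define Y where "Y = {u \<in> X. real (card (fibre X f u)) < b}"
  have "real (card {v \<in> Y. f v = k}) \<le> b" if k: "k \<in> f ` X" for k
  proof (cases "{v \<in> Y. f v = k} = {}")
    case True
    then have "real (card {v \<in> Y. f v = k}) = 0" by (simp only: card.empty of_nat_0)
    moreover have "0 \<le> b" unfolding b_def by simp
    ultimately show ?thesis by linarith
  next
    case False
    then obtain u where u: "u \<in> Y" "f u = k" by auto
    have "{v \<in> Y. f v = k} \<subseteq> fibre X f u" using u unfolding Y_def fibre_def by auto
    then have "card {v \<in> Y. f v = k} \<le> card (fibre X f u)" using assms by (intro card_mono finite_fibre)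
    then show ?thesis using u(1) unfolding Y_def by simp
  qed
  then have "(\<Sum>k\<in>f ` X. real (card {v \<in> Y. f v = k})) \<le> (\<Sum>k\<in>f ` X. b)" by (intro sum_mono) auto
  moreover have "real (card Y) = (\<Sum>k\<in>f ` X. real (card {v \<in> Y. f v = k}))"
    using card_eq_sum_fibres[OF assms(1), of Y f] unfolding Y_def by simp
  ultimately have "real (card Y) \<le> real N * b" unfolding N_def by simp
  then show ?thesis using N unfolding Y_def b_def N_def[symmetric] by simp
qed

lemma card_fibre_pairs:
  assumes "finite X" "X \<noteq> {}" "Y \<subseteq> X"
  shows "(real (card Y))\<^sup>2 / real (card (f ` X)) \<le> real (card {(u, v). u \<in> Y \<and> v \<in> Y \<and> f u = f v})"
proof -
  have fY: "finite Y" using assms finite_subset by blast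
  have "0 < card (f ` X)" using assms by (simp add: card_gt_0_iff)
  have "{(u, v). u \<in> Y \<and> v \<in> Y \<and> f u = f v} = (SIGMA u:Y. {v \<in> Y. f v = f u})" by auto
  then have "card {(u, v). u \<in> Y \<and> v \<in> Y \<and> f u = f v} = (\<Sum>u\<in>Y. card {v \<in> Y. f v = f u})"
    using fY by simp
  also have "\<dots> = (\<Sum>k\<in>f ` X. \<Sum>u\<in>{u \<in> Y. f u = k}. card {v \<in> Y. f v = f u})"
    using fY assms by (intro sum.group[symmetric]) auto
  also have "\<dots> = (\<Sum>k\<in>f ` X. (card {v \<in> Y. f v = k})\<^sup>2)"
    by (intro sum.cong) (auto simp: power2_eq_square)
  finally have *: "real (card {(u, v). u \<in> Y \<and> v \<in> Y \<and> f u = f v}) = (\<Sum>k\<in>f ` X. (real (card {v \<in> Y. f v = k}))\<^sup>2)"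
    by simp
  have "(real (card Y))\<^sup>2 = (\<Sum>k\<in>f ` X. real (card {v \<in> Y. f v = k}))\<^sup>2"
    using card_eq_sum_fibres[OF assms(1,3), of f] by simp
  also have "\<dots> \<le> (\<Sum>k\<in>f ` X. (real (card {v \<in> Y. f v = k}))\<^sup>2) * real (card (f ` X))"
    by (rule sum_squared_le_sum_of_squares)
  finally show ?thesis unfolding * using \<open>0 < card (f ` X)\<close> by (simp add: field_simps)
qed

lemma card_le_image_mult:
  fixes M :: real
  assumes "finite N" "\<And>u. u \<in> N \<Longrightarrow> real (card {v \<in> N. f v = f u}) \<le> M"
  shows "real (card N) \<le> real (card (f ` N)) * M"
proof -
  have "real (card N) = (\<Sum>k\<in>f ` N. real (card {v \<in> N. f v = k}))"
    using card_eq_sum_fibres[OF assms(1) subset_refl, of f] by simp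
  also have "\<dots> \<le> (\<Sum>k\<in>f ` N. M)" using assms(2) by (intro sum_mono) auto
  finally show ?thesis by simp
qed

definition chained :: "'a set \<Rightarrow> ('a \<Rightarrow> 'q) \<Rightarrow> ('a \<Rightarrow> 'c) \<Rightarrow> ('a \<Rightarrow> 't) \<Rightarrow> ('a \<times> 'a) set" where
  "chained X Q c T = {(y, z). y \<in> X \<and> z \<in> X \<and> (\<exists>u\<in>X. \<exists>u'\<in>X. Q u = Q y \<and> c u = c u' \<and> T u' = T z)}"

text \<open>Cauchy-Schwarz for walks \<open>y - u - u' - z\<close> whose consecutive vertices agree under \<open>Q\<close>, \<open>c\<close> and \<open>T\<close>.\<close>

lemma card_chained:
  fixes \<mu>1 \<mu>2 :: real
  assumes X: "finite X" "X \<noteq> {}"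
    and \<mu>1: "\<And>u u'. u \<in> X \<Longrightarrow> u' \<in> X \<Longrightarrow> c u = c u' \<Longrightarrow>
      real (card {v \<in> X. \<exists>v'\<in>X. Q v = Q u \<and> c v = c v' \<and> T v' = T u'}) \<le> \<mu>1"
    and \<mu>2: "\<And>u u'. u \<in> X \<Longrightarrow> u' \<in> X \<Longrightarrow> c u = c u' \<Longrightarrow>
      real (card {v' \<in> X. \<exists>v\<in>X. Q v = Q u \<and> c v = c v' \<and> T v' = T u'}) \<le> \<mu>2"
  shows "(real (card X)) ^ 4 \<le> 64 * (real (card (c ` X)) * real (card (Q ` X)) * real (card (T ` X))) * (\<mu>1 * \<mu>2)
     * real (card (chained X Q c T))"
proof -
  define n where "n = real (card X)"
  define NQ where "NQ = real (card (Q ` X))"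
  define NT where "NT = real (card (T ` X))"
  define Nc where "Nc = real (card (c ` X))"
  have pos: "0 < n" "0 < NQ" "0 < NT" "0 < Nc" unfolding n_def NQ_def NT_def Nc_def
    using X by (simp_all add: card_gt_0_iff)
  define BQ where "BQ = {u \<in> X. real (card (fibre X Q u)) < n / (4 * NQ)}"
  define BT where "BT = {u \<in> X. real (card (fibre X T u)) < n / (4 * NT)}"
  define Y where "Y = X - (BQ \<union> BT)"
  have fY: "finite Y" "Y \<subseteq> X" unfolding Y_def using X by auto
  have "real (card BQ) \<le> n / 4" "real (card BT) \<le> n / 4"
    unfolding BQ_def BT_def n_def NQ_def NT_def by (rule card_light_fibres[OF X])+
  moreover have "card X \<le> card Y + (card BQ + card BT)"
  proof -
    have "X \<subseteq> Y \<union> (BQ \<union> BT)" unfolding Y_def by blast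
    then have "card X \<le> card (Y \<union> (BQ \<union> BT))" using X fY unfolding BQ_def BT_def by (intro card_mono) auto
    also have "\<dots> \<le> card Y + (card BQ + card BT)" using card_Un_le[of Y "BQ \<union> BT"] card_Un_le[of BQ BT] by linarith
    finally show ?thesis .
  qed
  ultimately have Yn: "n / 2 \<le> real (card Y)" unfolding n_def by linarith
  define Pr where "Pr = {(u, v). u \<in> Y \<and> v \<in> Y \<and> c u = c v}"
  have "Pr \<subseteq> Y \<times> Y" unfolding Pr_def by auto
  then have fPr: "finite Pr" using fY(1) by (meson finite_SigmaI finite_subset)
  have Prn: "(n / 2)\<^sup>2 / Nc \<le> real (card Pr)"
  proof -
    have "(n / 2)\<^sup>2 \<le> (real (card Y))\<^sup>2" using Yn pos by (intro power_mono) auto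
    then have "(n / 2)\<^sup>2 / Nc \<le> (real (card Y))\<^sup>2 / Nc" using pos by (intro divide_right_mono) auto
    also have "\<dots> \<le> real (card Pr)" unfolding Nc_def Pr_def by (rule card_fibre_pairs[OF X fY(2)])
    finally show ?thesis .
  qed
  \<comment> \<open>Walks, stored as inner pair and end pair. Both inner vertices avoid light
    fibres, so every inner pair extends in at least n / (4 NQ) times n / (4 NT) ways.\<close>
  define Wt where "Wt = (SIGMA p:Pr. fibre X Q (fst p) \<times> fibre X T (snd p))"
  have "real (card Pr) * (n / (4 * NQ) * (n / (4 * NT))) \<le> real (card Wt)"
  proof -
    have "n / (4 * NQ) * (n / (4 * NT)) \<le> real (card (fibre X Q (fst p) \<times> fibre X T (snd p)))" if p: "p \<in> Pr" for p
    proof -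
      have "n / (4 * NQ) \<le> real (card (fibre X Q (fst p)))" "n / (4 * NT) \<le> real (card (fibre X T (snd p)))"
        using p unfolding Pr_def Y_def BQ_def BT_def by auto
      then show ?thesis using pos unfolding card_cartesian_product of_nat_mult by (intro mult_mono) auto
    qed
    then have "(\<Sum>p\<in>Pr. n / (4 * NQ) * (n / (4 * NT))) \<le> (\<Sum>p\<in>Pr. real (card (fibre X Q (fst p) \<times> fibre X T (snd p))))"
      by (rule sum_mono)
    also have "\<dots> = real (card Wt)"
    proof -
      have "card Wt = (\<Sum>p\<in>Pr. card (fibre X Q (fst p) \<times> fibre X T (snd p)))"
      proof -
        have "\<forall>p\<in>Pr. finite (fibre X Q (fst p) \<times> fibre X T (snd p))"
          by (intro ballI finite_cartesian_product finite_fibre X(1))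
        then show ?thesis unfolding Wt_def by (rule card_SigmaI[OF fPr])
      qed
      then show ?thesis by simp
    qed
    finally show ?thesis by simp
  qed
  then have 1: "(n / 2)\<^sup>2 / Nc * (n / (4 * NQ) * (n / (4 * NT))) \<le> real (card Wt)"
    using mult_right_mono[OF Prn, of "n / (4 * NQ) * (n / (4 * NT))"] pos by (meson order_trans divide_nonneg_pos mult_nonneg_nonneg zero_less_mult_iff less_imp_le zero_less_numeral)
  define E where "E = chained X Q c T"
  \<comment> \<open>Conversely, the walks with given ends have their inner vertices in sets A and B
    determined by any one of these walks, hence number at most \<mu>1 \<mu>2.\<close>
  have "real (card Wt) \<le> real (card (snd ` Wt)) * (\<mu>1 * \<mu>2)"
  proof (rule card_le_image_mult)
    show fW: "finite Wt" unfolding Wt_def by (intro finite_SigmaI finite_cartesian_product fPr finite_fibre X(1))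
    fix t assume t: "t \<in> Wt"
    obtain u u' y z where t': "t = ((u, u'), (y, z))" by (metis surj_pair)
    have uu: "u \<in> X" "u' \<in> X" "c u = c u'" "Q y = Q u" "T z = T u'"
      using t fY unfolding t' Wt_def Pr_def fibre_def by auto
    define A where "A = {v \<in> X. \<exists>v'\<in>X. Q v = Q u \<and> c v = c v' \<and> T v' = T u'}"
    define B where "B = {v' \<in> X. \<exists>v\<in>X. Q v = Q u \<and> c v = c v' \<and> T v' = T u'}"
    have "fst ` {v \<in> Wt. snd v = snd t} \<subseteq> A \<times> B"
      unfolding t' Wt_def Pr_def fibre_def A_def B_def using fY uu by force
    moreover have "inj_on fst {v \<in> Wt. snd v = snd t}" by (auto simp: inj_on_def prod_eq_iff)
    moreover have "finite (A \<times> B)" unfolding A_def B_def using X by simp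
    ultimately have "card {v \<in> Wt. snd v = snd t} \<le> card (A \<times> B)"
      using card_image[of fst "{v \<in> Wt. snd v = snd t}"] card_mono[of "A \<times> B" "fst ` {v \<in> Wt. snd v = snd t}"] by linarith
    then have "real (card {v \<in> Wt. snd v = snd t}) \<le> real (card A) * real (card B)"
      by (simp only: card_cartesian_product of_nat_mult[symmetric] of_nat_le_iff)
    also have "\<dots> \<le> \<mu>1 * \<mu>2" using \<mu>1[OF uu(1-3)] \<mu>2[OF uu(1-3)] unfolding A_def B_def
      by (intro mult_mono) (auto intro: order_trans[OF of_nat_0_le_iff])
    finally show "real (card {v \<in> Wt. snd v = snd t}) \<le> \<mu>1 * \<mu>2" .
  qed
  moreover have "real (card (snd ` Wt)) \<le> real (card E)"
  proof -
    have "snd ` Wt \<subseteq> E" unfolding Wt_def Pr_def E_def chained_def fibre_def using fY by force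
    moreover have "finite E" unfolding E_def chained_def
      by (rule finite_subset[of _ "X \<times> X"]) (use X in auto)
    ultimately show ?thesis by (simp add: card_mono)
  qed
  moreover have "0 \<le> \<mu>1 * \<mu>2"
  proof -
    obtain x where "x \<in> X" using X by blast
    then have "0 \<le> \<mu>1" "0 \<le> \<mu>2" using \<mu>1[of x x] \<mu>2[of x x] of_nat_0_le_iff order_trans by blast+
    then show ?thesis by simp
  qed
  ultimately have "(n / 2)\<^sup>2 / Nc * (n / (4 * NQ) * (n / (4 * NT))) \<le> real (card E) * (\<mu>1 * \<mu>2)"
    using 1 mult_right_mono[of "real (card (snd ` Wt))" "real (card E)" "\<mu>1 * \<mu>2"] by linarith
  moreover have "(n / 2)\<^sup>2 / Nc * (n / (4 * NQ) * (n / (4 * NT))) = n ^ 4 / (64 * (Nc * NQ * NT))"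
    by (simp add: power2_eq_square power4_eq_xxxx)
  moreover have D: "0 < 64 * (Nc * NQ * NT)" using pos by simp
  ultimately have "n ^ 4 \<le> real (card E) * (\<mu>1 * \<mu>2) * (64 * (Nc * NQ * NT))"
    by (simp only: pos_divide_le_eq[OF D])
  then show ?thesis unfolding n_def NQ_def NT_def Nc_def E_def by (simp add: mult_ac)
qed

lemma heavy_class:
  assumes "finite E" "finite X" "X \<noteq> {}" "g ` E \<subseteq> X"
  shows "\<exists>x\<in>X. real (card E) \<le> real (card (V ` X)) * real (card {e \<in> E. V (g e) = V x})"
proof -
  define M where "M = Max ((\<lambda>x. real (card {e \<in> E. V (g e) = V x})) ` X)"
  obtain x where x: "x \<in> X" "real (card {e \<in> E. V (g e) = V x}) = M"
    using Max_in[of "(\<lambda>x. real (card {e \<in> E. V (g e) = V x})) ` X"] assms unfolding M_def by fastforce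
  have le: "real (card {e \<in> E. V (g e) = V x}) \<le> M" if "x \<in> X" for x
    unfolding M_def using that assms by (intro Max_ge) auto
  have "real (card E) \<le> real (card ((V \<circ> g) ` E)) * M"
  proof (rule card_le_image_mult[OF assms(1)])
    fix u assume "u \<in> E"
    then have "g u \<in> X" using assms by auto
    from le[OF this] show "real (card {v \<in> E. (V \<circ> g) v = (V \<circ> g) u}) \<le> M" by simp
  qed
  also have "\<dots> \<le> real (card (V ` X)) * M"
  proof (rule mult_right_mono)
    have "(V \<circ> g) ` E \<subseteq> V ` X" using assms by auto
    then show "real (card ((V \<circ> g) ` E)) \<le> real (card (V ` X))" using assms by (simp add: card_mono)
  qed (use x in \<open>metis of_nat_0_le_iff\<close>)
  finally show ?thesis using x by blast
qed

text \<open>Pigeonholing for all colourings at once: each u gets the vector of the levels of its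
  fibre sizes in base q, and the most frequent vector is kept. Sizes are measured in X before the
  selection, so that one selection serves all k and no colouring spoils another.\<close>

lemma regular_subset:
  fixes f :: "'k \<Rightarrow> 'a \<Rightarrow> 'c" and q :: real
  assumes X: "finite X" "X \<noteq> {}" and K: "finite K" and q: "1 < q" and lv: "real (card X) < q ^ lv"
  shows "\<exists>X1\<subseteq>X. X1 \<noteq> {} \<and> card X \<le> lv ^ card K * card X1 \<and>
    (\<forall>k\<in>K. \<exists>M. (\<forall>u\<in>X1. real (card (fibre X1 (f k) u)) \<le> M) \<and>
        M * real (card (f k ` X1)) \<le> q * real (lv ^ card K) * real (card X1))"
proof -
  define lev where "lev = (\<lambda>k u. nat \<lfloor>log q (real (card (fibre X (f k) u)))\<rfloor>)"
  have fib1: "1 \<le> real (card (fibre X (f k) u))" if "u \<in> X" for k u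
  proof -
    have "u \<in> fibre X (f k) u" using that unfolding fibre_def by simp
    then have "card (fibre X (f k) u) > 0" using finite_fibre[OF X(1)] by (auto simp: card_gt_0_iff)
    then show ?thesis by simp
  qed
  have lev: "q ^ lev k u \<le> real (card (fibre X (f k) u))" "real (card (fibre X (f k) u)) < q ^ Suc (lev k u)" "lev k u < lv"
    if u: "u \<in> X" for k u
  proof -
    define s where "s = real (card (fibre X (f k) u))"
    have s1: "1 \<le> s" unfolding s_def by (rule fib1[OF u])
    then have l0: "0 \<le> log q s" using q by simp
    have "real (lev k u) \<le> log q s" "log q s < real (lev k u) + 1" using l0 unfolding lev_def s_def[symmetric] by linarith+
    then have "q powr real (lev k u) \<le> s" "s < q powr real (Suc (lev k u))"
      using q s1 by (simp_all add: le_log_iff log_less_iff add.commute)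
    then show 1: "q ^ lev k u \<le> real (card (fibre X (f k) u))" "real (card (fibre X (f k) u)) < q ^ Suc (lev k u)"
      using q unfolding s_def[symmetric] by (simp_all only: powr_realpow)
    have "card (fibre X (f k) u) \<le> card X" unfolding fibre_def using X by (intro card_mono) auto
    then have "q ^ lev k u < q ^ lv" using 1 lv by linarith
    then show "lev k u < lv" using q by (simp add: power_less_imp_less_exp)
  qed
  define col where "col = (\<lambda>u. \<lambda>k\<in>K. lev k u)"
  have colX: "col ` X \<subseteq> K \<rightarrow>\<^sub>E {..<lv}" unfolding col_def using lev(3) by auto
  have "finite (K \<rightarrow>\<^sub>E {..<lv})" using K by (simp add: finite_PiE)
  then have colc: "card (col ` X) \<le> lv ^ card K"
    using card_mono[OF _ colX] K by (simp add: card_funcsetE)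
  obtain x where x: "x \<in> X" "real (card X) \<le> real (card (col ` X)) * real (card {e \<in> X. col (id e) = col x})"
    using heavy_class[OF X(1) X, of id col] by auto
  define X1 where "X1 = {e \<in> X. col e = col x}"
  have X1: "X1 \<subseteq> X" "x \<in> X1" "finite X1" unfolding X1_def using x X by auto
  have "card X \<le> card (col ` X) * card X1"
    using x(2) unfolding X1_def id_def by (simp only: of_nat_mult[symmetric] of_nat_le_iff)
  also have "\<dots> \<le> lv ^ card K * card X1" using colc by simp
  finally have cX: "card X \<le> lv ^ card K * card X1" .
  have "\<exists>M. (\<forall>u\<in>X1. real (card (fibre X1 (f k) u)) \<le> M) \<and>
        M * real (card (f k ` X1)) \<le> q * real (lv ^ card K) * real (card X1)" if k: "k \<in> K" for k
  proof (intro exI conjI ballI)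
    have same: "lev k u = lev k x" if "u \<in> X1" for u
      using that k unfolding X1_def col_def by (metis (mono_tags, lifting) mem_Collect_eq restrict_apply')
    show "real (card (fibre X1 (f k) u)) \<le> q ^ Suc (lev k x)" if u: "u \<in> X1" for u
    proof -
      have "card (fibre X1 (f k) u) \<le> card (fibre X (f k) u)"
        using X X1 unfolding fibre_def by (intro card_mono) auto
      then show ?thesis using lev(2)[of u k] same[OF u] u X1 by fastforce
    qed
    \<comment> \<open>Every colour that still occurs on X1 has a fibre of at least
      \<open>q ^ lev k x\<close> points in X, though perhaps few of them in X1.\<close>
    have "real (card (f k ` X1)) * q ^ lev k x \<le> real (card X)"
    proof -
      have "(\<Sum>y\<in>f k ` X1. q ^ lev k x) \<le> (\<Sum>y\<in>f k ` X1. real (card {v \<in> X. f k v = y}))"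
      proof (rule sum_mono)
        fix y assume "y \<in> f k ` X1"
        then obtain u where u: "u \<in> X1" "y = f k u" by blast
        then show "q ^ lev k x \<le> real (card {v \<in> X. f k v = y})"
          using lev(1)[of u k] same[of u] X1 unfolding fibre_def by auto
      qed
      also have "\<dots> \<le> (\<Sum>y\<in>f k ` X. real (card {v \<in> X. f k v = y}))"
        using X X1 by (intro sum_mono2) auto
      also have "\<dots> = real (card X)" using card_eq_sum_fibres[OF X(1) subset_refl, of "f k"] by simp
      finally show ?thesis by simp
    qed
    also have "real (card X) \<le> real (lv ^ card K) * real (card X1)" using cX by (simp only: of_nat_mult[symmetric] of_nat_le_iff)
    finally have "q * (real (card (f k ` X1)) * q ^ lev k x) \<le> q * (real (lv ^ card K) * real (card X1))"
      using q by (intro mult_left_mono) auto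
    then show "q ^ Suc (lev k x) * real (card (f k ` X1)) \<le> q * real (lv ^ card K) * real (card X1)"
      by (simp add: mult_ac)
  qed
  then show ?thesis using X1 cX by blast
qed

subsection \<open>Flags and their cells\<close>

type_synonym flag = "real \<times> real \<times> real"

abbreviation fx :: "flag \<Rightarrow> real" where "fx u \<equiv> fst u"
abbreviation fa :: "flag \<Rightarrow> real" where "fa u \<equiv> fst (snd u)"
abbreviation fb :: "flag \<Rightarrow> real" where "fb u \<equiv> snd (snd u)"

definition dev :: "flag \<Rightarrow> flag \<Rightarrow> real" where
  "dev u v = (fa u - fa v) * fx u + (fb u - fb v)"

text \<open>Additivity of \<open>dev\<close> fails only by slope gap times abscissa gap. Within a
  cell this is at most \<alpha> \<beta>, the scale of \<open>dev\<close> itself, so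
  \<open>dev\<close> can be treated there like a distance up to constants.\<close>

lemma dev_cocycle: "dev p r = dev p q + dev q r + (fa q - fa r) * (fx p - fx q)"
  unfolding dev_def by (simp add: algebra_simps)

lemma dev_triangle:
  assumes "\<bar>dev p q\<bar> \<le> A" "\<bar>dev q r\<bar> \<le> B" "\<bar>fa q - fa r\<bar> \<le> k" "\<bar>fx p - fx q\<bar> \<le> l"
  shows "\<bar>dev p r\<bar> \<le> A + B + k * l"
proof -
  have "\<bar>(fa q - fa r) * (fx p - fx q)\<bar> \<le> k * l" unfolding abs_mult using assms by (intro mult_mono) auto
  then show ?thesis using assms unfolding dev_cocycle[of p r q] by linarith
qed

lemma dev_swap:
  assumes "\<bar>dev u v\<bar> \<le> A" "\<bar>fa v - fa u\<bar> \<le> k" "\<bar>fx v - fx u\<bar> \<le> l"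
  shows "\<bar>dev v u\<bar> \<le> A + k * l"
proof -
  have "\<bar>(fa v - fa u) * (fx v - fx u)\<bar> \<le> k * l" unfolding abs_mult using assms by (intro mult_mono) auto
  moreover have "dev v u = (fa v - fa u) * (fx v - fx u) - dev u v" unfolding dev_def by (simp add: algebra_simps)
  ultimately show ?thesis using assms(1) by linarith
qed

text \<open>The third coordinate measures the height of the point over the slope rounded down to a multiple of \<open>\<beta>\<close>; this
  bounds \<^const>\<open>dev\<close> by \<open>2 \<alpha> \<beta>\<close> within a cell, although \<open>fb\<close> itself may vary much more.\<close>

definition cell :: "real \<Rightarrow> real \<Rightarrow> flag \<Rightarrow> int \<times> int \<times> int" where
  "cell \<alpha> \<beta> u = (\<lfloor>fx u / \<alpha>\<rfloor>, \<lfloor>fa u / \<beta>\<rfloor>, \<lfloor>(fb u + (fa u - \<beta> * \<lfloor>fa u / \<beta>\<rfloor>) * fx u) / (\<alpha> * \<beta>)\<rfloor>)"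

lemma floor_div_eq_imp:
  fixes x y c :: real
  assumes "\<lfloor>x / c\<rfloor> = \<lfloor>y / c\<rfloor>" "0 < c"
  shows "\<bar>x - y\<bar> \<le> c"
proof -
  have "\<bar>x / c - y / c\<bar> \<le> 1" using assms(1) by linarith
  then show ?thesis using assms(2) by (simp add: diff_divide_distrib[symmetric] abs_divide)
qed

lemma floor_div_remainder:
  fixes x c :: real
  assumes "0 < c"
  shows "0 \<le> x - c * \<lfloor>x / c\<rfloor>" "x - c * \<lfloor>x / c\<rfloor> \<le> c"
proof -
  have "c * \<lfloor>x / c\<rfloor> \<le> c * (x / c)" using assms by (intro mult_left_mono) auto
  then show "0 \<le> x - c * \<lfloor>x / c\<rfloor>" using assms by simp
  have "c * (x / c) \<le> c * (\<lfloor>x / c\<rfloor> + 1)" using assms by (intro mult_left_mono) linarith+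
  then have "x \<le> c * \<lfloor>x / c\<rfloor> + c" using assms by (simp add: distrib_left)
  then show "x - c * \<lfloor>x / c\<rfloor> \<le> c" by linarith
qed

lemma cell_eqD:
  assumes "cell \<alpha> \<beta> u = cell \<alpha> \<beta> v" "0 < \<alpha>" "0 < \<beta>"
  shows "\<bar>fx u - fx v\<bar> \<le> \<alpha>" "\<bar>fa u - fa v\<bar> \<le> \<beta>" "\<bar>dev u v\<bar> \<le> 2 * (\<alpha> * \<beta>)"
proof -
  define a0 where "a0 = \<beta> * \<lfloor>fa u / \<beta>\<rfloor>"
  have a0v: "a0 = \<beta> * \<lfloor>fa v / \<beta>\<rfloor>" using assms(1) unfolding a0_def cell_def by simp
  show x: "\<bar>fx u - fx v\<bar> \<le> \<alpha>" using assms floor_div_eq_imp unfolding cell_def by blast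
  show "\<bar>fa u - fa v\<bar> \<le> \<beta>" using assms floor_div_eq_imp unfolding cell_def by blast
  have "\<lfloor>(fb u + (fa u - a0) * fx u) / (\<alpha> * \<beta>)\<rfloor> = \<lfloor>(fb v + (fa v - a0) * fx v) / (\<alpha> * \<beta>)\<rfloor>"
  proof -
    from assms(1) have h: "\<lfloor>fa u / \<beta>\<rfloor> = \<lfloor>fa v / \<beta>\<rfloor>" and "\<lfloor>(fb u + (fa u - \<beta> * \<lfloor>fa u / \<beta>\<rfloor>) * fx u) / (\<alpha> * \<beta>)\<rfloor> =
        \<lfloor>(fb v + (fa v - \<beta> * \<lfloor>fa v / \<beta>\<rfloor>) * fx v) / (\<alpha> * \<beta>)\<rfloor>"
      unfolding cell_def prod.inject by blast+
    then show ?thesis unfolding a0_def by (simp only: h)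
  qed
  then have z: "\<bar>(fb u + (fa u - a0) * fx u) - (fb v + (fa v - a0) * fx v)\<bar> \<le> \<alpha> * \<beta>"
    using assms by (intro floor_div_eq_imp) auto
  have "0 \<le> fa v - a0" "fa v - a0 \<le> \<beta>" unfolding a0v by (rule floor_div_remainder[OF assms(3)])+
  then have "\<bar>(fx u - fx v) * (fa v - a0)\<bar> \<le> \<alpha> * \<beta>" unfolding abs_mult using x assms by (intro mult_mono) auto
  moreover have "dev u v = (fb u + (fa u - a0) * fx u) - (fb v + (fa v - a0) * fx v) - (fx u - fx v) * (fa v - a0)"
    unfolding dev_def by (simp add: algebra_simps)
  ultimately show "\<bar>dev u v\<bar> \<le> 2 * (\<alpha> * \<beta>)" using z by linarith
qed

lemma card_int_interval_le:
  fixes y k :: real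
  assumes "0 \<le> k"
  shows "real (card {\<lfloor>y - k\<rfloor>..\<lfloor>y + k\<rfloor>}) \<le> 2 * k + 2"
proof -
  have "\<lfloor>y - k\<rfloor> \<le> \<lfloor>y + k\<rfloor>" using assms by (intro floor_mono) auto
  then have "real (card {\<lfloor>y - k\<rfloor>..\<lfloor>y + k\<rfloor>}) = real_of_int (\<lfloor>y + k\<rfloor> - \<lfloor>y - k\<rfloor> + 1)" by simp
  then show ?thesis by linarith
qed

lemma floor_in_interval:
  fixes x y k :: real
  assumes "\<bar>x - y\<bar> \<le> k"
  shows "\<lfloor>x\<rfloor> \<in> {\<lfloor>y - k\<rfloor>..\<lfloor>y + k\<rfloor>}"
  using assms by (auto intro!: floor_mono)

definition near :: "real \<Rightarrow> real \<Rightarrow> real \<Rightarrow> real \<Rightarrow> real \<Rightarrow> flag \<Rightarrow> flag \<Rightarrow> bool" where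
  "near \<alpha> \<beta> kx ka kz u v \<longleftrightarrow> \<bar>fx v - fx u\<bar> \<le> kx * \<alpha> \<and> \<bar>fa v - fa u\<bar> \<le> ka * \<beta> \<and> \<bar>dev u v\<bar> \<le> kz * (\<alpha> * \<beta>)"

text \<open>The last coordinate of a cell is read over the rounded slope q, so its range depends on
  q and the boxes form a dependent product. Passing from \<open>dev u v\<close> to heights over
  slope q costs a remainder below \<beta> times kx \<alpha>, hence kz + kx.\<close>

lemma card_cells_near:
  assumes pos: "0 < \<alpha>" "0 < \<beta>" "0 \<le> kx" "0 \<le> ka" "0 \<le> kz"
    and N: "\<And>v. v \<in> N \<Longrightarrow> near \<alpha> \<beta> kx ka kz u v"
  shows "real (card (cell \<alpha> \<beta> ` N)) \<le> (2 * kx + 2) * (2 * ka + 2) * (2 * (kz + kx) + 2)" "finite (cell \<alpha> \<beta> ` N)"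
proof -
  define A where "A = {\<lfloor>fx u / \<alpha> - kx\<rfloor>..\<lfloor>fx u / \<alpha> + kx\<rfloor>}"
  define B where "B = {\<lfloor>fa u / \<beta> - ka\<rfloor>..\<lfloor>fa u / \<beta> + ka\<rfloor>}"
  define c where "c = (\<lambda>q::int. (fb u + (fa u - \<beta> * q) * fx u) / (\<alpha> * \<beta>))"
  define C where "C = (\<lambda>q. {\<lfloor>c q - (kz + kx)\<rfloor>..\<lfloor>c q + (kz + kx)\<rfloor>})"
  have sub: "cell \<alpha> \<beta> ` N \<subseteq> A \<times> (SIGMA q:B. C q)"
  proof
    fix t assume "t \<in> cell \<alpha> \<beta> ` N"
    then obtain v where v: "v \<in> N" "t = cell \<alpha> \<beta> v" by blast
    define q where "q = \<lfloor>fa v / \<beta>\<rfloor>"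
    have n: "\<bar>fx v - fx u\<bar> \<le> kx * \<alpha>" "\<bar>fa v - fa u\<bar> \<le> ka * \<beta>" "\<bar>dev u v\<bar> \<le> kz * (\<alpha> * \<beta>)"
      using N[OF v(1)] unfolding near_def by auto
    have "\<bar>fx v / \<alpha> - fx u / \<alpha>\<bar> \<le> kx"
      using n(1) pos by (simp add: diff_divide_distrib[symmetric] abs_divide pos_divide_le_eq)
    then have 1: "\<lfloor>fx v / \<alpha>\<rfloor> \<in> A" unfolding A_def by (rule floor_in_interval)
    have "\<bar>fa v / \<beta> - fa u / \<beta>\<bar> \<le> ka"
      using n(2) pos by (simp add: diff_divide_distrib[symmetric] abs_divide pos_divide_le_eq)
    then have 2: "q \<in> B" unfolding B_def q_def by (rule floor_in_interval)
    have "0 \<le> fa v - \<beta> * q" "fa v - \<beta> * q \<le> \<beta>" unfolding q_def by (rule floor_div_remainder[OF pos(2)])+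
    then have "\<bar>(fa v - \<beta> * q) * (fx v - fx u)\<bar> \<le> \<beta> * (kx * \<alpha>)" unfolding abs_mult using n(1) pos by (intro mult_mono) auto
    moreover have "(fb v + (fa v - \<beta> * q) * fx v) - (fb u + (fa u - \<beta> * q) * fx u) = (fa v - \<beta> * q) * (fx v - fx u) - dev u v"
      unfolding dev_def by (simp add: algebra_simps)
    ultimately have "\<bar>(fb v + (fa v - \<beta> * q) * fx v) - (fb u + (fa u - \<beta> * q) * fx u)\<bar> \<le> (kz + kx) * (\<alpha> * \<beta>)"
      using n(3) by (simp add: algebra_simps)
    then have "\<bar>(fb v + (fa v - \<beta> * q) * fx v) / (\<alpha> * \<beta>) - c q\<bar> \<le> kz + kx"
      unfolding c_def using pos by (simp add: diff_divide_distrib[symmetric] abs_divide pos_divide_le_eq)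
    then have 3: "\<lfloor>(fb v + (fa v - \<beta> * q) * fx v) / (\<alpha> * \<beta>)\<rfloor> \<in> C q" unfolding C_def by (rule floor_in_interval)
    show "t \<in> A \<times> (SIGMA q:B. C q)" unfolding v(2) cell_def q_def[symmetric] using 1 2 3 by simp
  qed
  have fin: "finite A" "finite B" "\<And>q. finite (C q)" unfolding A_def B_def C_def by auto
  then have fS: "finite (A \<times> (SIGMA q:B. C q))" by (intro finite_cartesian_product finite_SigmaI) auto
  show "finite (cell \<alpha> \<beta> ` N)" by (rule finite_subset[OF sub fS])
  have cA: "real (card A) \<le> 2 * kx + 2" unfolding A_def by (rule card_int_interval_le[OF pos(3)])
  have cB: "real (card B) \<le> 2 * ka + 2" unfolding B_def by (rule card_int_interval_le[OF pos(4)])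
  have cC: "real (card (C q)) \<le> 2 * (kz + kx) + 2" for q unfolding C_def using pos by (intro card_int_interval_le) auto
  have "card (SIGMA q:B. C q) = (\<Sum>q\<in>B. card (C q))" by (rule card_SigmaI) (use fin in auto)
  then have "real (card (SIGMA q:B. C q)) = (\<Sum>q\<in>B. real (card (C q)))" by simp
  also have "\<dots> \<le> (\<Sum>q\<in>B. 2 * (kz + kx) + 2)" by (rule sum_mono[OF cC])
  also have "\<dots> \<le> (2 * ka + 2) * (2 * (kz + kx) + 2)" using cB pos by (simp add: mult_right_mono)
  finally have cS: "real (card (SIGMA q:B. C q)) \<le> (2 * ka + 2) * (2 * (kz + kx) + 2)" .
  have "real (card (cell \<alpha> \<beta> ` N)) \<le> real (card (A \<times> (SIGMA q:B. C q)))"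
    using card_mono[OF fS sub] by simp
  also have "\<dots> = real (card A) * real (card (SIGMA q:B. C q))" by (simp only: card_cartesian_product of_nat_mult)
  also have "\<dots> \<le> (2 * kx + 2) * ((2 * ka + 2) * (2 * (kz + kx) + 2))"
    using cA cS pos by (intro mult_mono) auto
  finally show "real (card (cell \<alpha> \<beta> ` N)) \<le> (2 * kx + 2) * (2 * ka + 2) * (2 * (kz + kx) + 2)" by (simp add: mult.assoc)
qed

lemma card_near:
  assumes pos: "0 < \<alpha>" "0 < \<beta>" "0 \<le> kx" "0 \<le> ka" "0 \<le> kz" and X: "finite X" and "0 \<le> M"
    and M: "\<And>u. u \<in> X \<Longrightarrow> real (card (fibre X (cell \<alpha> \<beta>) u)) \<le> M"
    and N: "N \<subseteq> X" "\<And>v. v \<in> N \<Longrightarrow> near \<alpha> \<beta> kx ka kz u v"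
  shows "real (card N) \<le> (2 * kx + 2) * (2 * ka + 2) * (2 * (kz + kx) + 2) * M"
proof -
  have fN: "finite N" using N X finite_subset by blast
  have MN: "real (card {v \<in> N. cell \<alpha> \<beta> v = cell \<alpha> \<beta> u'}) \<le> M" if "u' \<in> N" for u'
  proof -
    have "card {v \<in> N. cell \<alpha> \<beta> v = cell \<alpha> \<beta> u'} \<le> card (fibre X (cell \<alpha> \<beta>) u')"
      using X N(1) unfolding fibre_def by (intro card_mono) auto
    then show ?thesis using M[of u'] that N(1) by fastforce
  qed
  have "real (card N) \<le> real (card (cell \<alpha> \<beta> ` N)) * M" by (rule card_le_image_mult[OF fN MN])
  also have "\<dots> \<le> (2 * kx + 2) * (2 * ka + 2) * (2 * (kz + kx) + 2) * M"
    using card_cells_near(1)[OF pos N(2)] \<open>0 \<le> M\<close> by (intro mult_right_mono) auto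
  finally show ?thesis .
qed

lemma card_cells_refine:
  assumes pos: "0 < \<alpha>" "0 < \<beta>" "0 \<le> kx" "0 \<le> ka" "0 \<le> kz" and X: "finite X"
    and ref: "\<And>u v. u \<in> X \<Longrightarrow> v \<in> X \<Longrightarrow> f v = f u \<Longrightarrow> near \<alpha> \<beta> kx ka kz u v"
  shows "real (card (cell \<alpha> \<beta> ` X)) \<le> real (card (f ` X)) * ((2 * kx + 2) * (2 * ka + 2) * (2 * (kz + kx) + 2))"
proof -
  have "cell \<alpha> \<beta> ` X \<subseteq> (\<Union>k\<in>f ` X. cell \<alpha> \<beta> ` {v \<in> X. f v = k})" by auto
  then have "card (cell \<alpha> \<beta> ` X) \<le> card (\<Union>k\<in>f ` X. cell \<alpha> \<beta> ` {v \<in> X. f v = k})"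
    using X by (intro card_mono) auto
  also have "\<dots> \<le> (\<Sum>k\<in>f ` X. card (cell \<alpha> \<beta> ` {v \<in> X. f v = k}))"
    using X by (intro card_UN_le) auto
  finally have "real (card (cell \<alpha> \<beta> ` X)) \<le> (\<Sum>k\<in>f ` X. real (card (cell \<alpha> \<beta> ` {v \<in> X. f v = k})))"
    by (simp only: of_nat_sum[symmetric] of_nat_le_iff)
  also have "\<dots> \<le> (\<Sum>k\<in>f ` X. (2 * kx + 2) * (2 * ka + 2) * (2 * (kz + kx) + 2))"
  proof (rule sum_mono)
    fix k assume "k \<in> f ` X"
    then obtain u where u: "u \<in> X" "k = f u" by blast
    show "real (card (cell \<alpha> \<beta> ` {v \<in> X. f v = k})) \<le> (2 * kx + 2) * (2 * ka + 2) * (2 * (kz + kx) + 2)"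
      by (rule card_cells_near(1)[OF pos, of _ u]) (use u ref in auto)
  qed
  finally show ?thesis by simp
qed

section \<open>Separation, packing and rescaling\<close>

definition unit_flags :: "flag set" where
  "unit_flags = {u. 0 \<le> fx u \<and> fx u \<le> 1 \<and> 0 \<le> fa u \<and> fa u \<le> 1 \<and> 0 \<le> fb u \<and> fb u \<le> 2}"

definition separated :: "real \<Rightarrow> flag set \<Rightarrow> bool" where
  "separated \<delta> X \<longleftrightarrow> (\<forall>u\<in>X. \<forall>v\<in>X. u \<noteq> v \<longrightarrow> \<delta> < \<bar>dev u v\<bar>)"

lemma dev_unit_flags_le:
  assumes "u \<in> unit_flags" "v \<in> unit_flags"
  shows "\<bar>dev u v\<bar> \<le> 3"
proof -
  have "\<bar>(fa u - fa v) * fx u\<bar> \<le> 1 * 1" unfolding abs_mult using assms unfolding unit_flags_def by (intro mult_mono) auto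
  moreover have "\<bar>fb u - fb v\<bar> \<le> 2" using assms unfolding unit_flags_def by (auto simp: abs_le_iff)
  ultimately show ?thesis unfolding dev_def by linarith
qed

text \<open>Boxes of side \<delta> / 2 in slope and intercept alone suffice: two flags in one box
  have \<open>dev\<close> at most \<delta>, whatever their abscissae in [0, 1]. The crude bound
  serves to limit the number of size levels and to exclude large \<delta>.\<close>

lemma separated_card_le:
  assumes "finite X" "X \<subseteq> unit_flags" "separated \<delta> X" "0 < \<delta>" "\<delta> \<le> 1"
  shows "real (card X) \<le> 36 / \<delta>\<^sup>2"
proof -
  define g where "g = (\<lambda>u. (\<lfloor>fa u / (\<delta>/2)\<rfloor>, \<lfloor>fb u / (\<delta>/2)\<rfloor>))"
  have inj: "inj_on g X"
  proof (rule inj_onI, rule ccontr)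
    fix u v assume uv: "u \<in> X" "v \<in> X" "g u = g v" "u \<noteq> v"
    have "\<bar>fa u - fa v\<bar> \<le> \<delta>/2" "\<bar>fb u - fb v\<bar> \<le> \<delta>/2"
    proof -
      have "\<lfloor>fa u / (\<delta>/2)\<rfloor> = \<lfloor>fa v / (\<delta>/2)\<rfloor>" "\<lfloor>fb u / (\<delta>/2)\<rfloor> = \<lfloor>fb v / (\<delta>/2)\<rfloor>"
        using uv(3) unfolding g_def by (simp_all only: prod.inject)
      then show "\<bar>fa u - fa v\<bar> \<le> \<delta>/2" "\<bar>fb u - fb v\<bar> \<le> \<delta>/2"
        using assms(4) floor_div_eq_imp[of _ "\<delta>/2"] by simp_all
    qed
    moreover have "0 \<le> fx u" "fx u \<le> 1" using uv(1) assms(2) unfolding unit_flags_def by auto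
    ultimately have "\<bar>(fa u - fa v) * fx u\<bar> \<le> \<delta>/2 * 1" unfolding abs_mult using assms(4) by (intro mult_mono) auto
    then have "\<bar>dev u v\<bar> \<le> \<delta>" unfolding dev_def using \<open>\<bar>fb u - fb v\<bar> \<le> \<delta>/2\<close> by linarith
    then show False using assms(3) uv unfolding separated_def by fastforce
  qed
  have sub: "g ` X \<subseteq> {\<lfloor>1/\<delta> - 1/\<delta>\<rfloor>..\<lfloor>1/\<delta> + 1/\<delta>\<rfloor>} \<times> {\<lfloor>2/\<delta> - 2/\<delta>\<rfloor>..\<lfloor>2/\<delta> + 2/\<delta>\<rfloor>}"
  proof
    fix t assume "t \<in> g ` X"
    then obtain u where u: "u \<in> X" "t = g u" by blast
    have "0 \<le> fa u" "fa u \<le> 1" "0 \<le> fb u" "fb u \<le> 2" using u assms(2) unfolding unit_flags_def by auto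
    then have "\<bar>fa u / (\<delta>/2) - 1/\<delta>\<bar> \<le> 1/\<delta>" "\<bar>fb u / (\<delta>/2) - 2/\<delta>\<bar> \<le> 2/\<delta>"
      using assms(4) by (auto simp: abs_le_iff field_simps)
    then show "t \<in> {\<lfloor>1/\<delta> - 1/\<delta>\<rfloor>..\<lfloor>1/\<delta> + 1/\<delta>\<rfloor>} \<times> {\<lfloor>2/\<delta> - 2/\<delta>\<rfloor>..\<lfloor>2/\<delta> + 2/\<delta>\<rfloor>}"
      unfolding u(2) g_def by (intro SigmaI floor_in_interval)
  qed
  have "real (card X) = real (card (g ` X))" using inj by (simp add: card_image)
  also have "\<dots> \<le> real (card ({\<lfloor>1/\<delta> - 1/\<delta>\<rfloor>..\<lfloor>1/\<delta> + 1/\<delta>\<rfloor>} \<times> {\<lfloor>2/\<delta> - 2/\<delta>\<rfloor>..\<lfloor>2/\<delta> + 2/\<delta>\<rfloor>}))"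
    by (simp only: of_nat_le_iff) (rule card_mono[OF _ sub], simp)
  also have "\<dots> \<le> (2 * (1/\<delta>) + 2) * (2 * (2/\<delta>) + 2)"
    unfolding card_cartesian_product of_nat_mult
    using assms(4) by (intro mult_mono card_int_interval_le) auto
  also have "\<dots> \<le> (6/\<delta>) * (6/\<delta>)"
    using assms(4,5) by (intro mult_mono) (auto simp: field_simps)
  finally show ?thesis by (simp add: power2_eq_square)
qed

text \<open>Self-similarity of the problem: a cell expands to unit size and \<open>dev\<close> is
  divided exactly by \<alpha> \<beta>, so the flags of a cell form a smaller instance with a larger
  separation.\<close>

lemma rescale_fibre:
  fixes \<alpha> \<beta> :: real
  assumes X: "X \<subseteq> unit_flags" and \<alpha>: "0 < \<alpha>" "\<alpha> \<le> 1" and \<beta>: "0 < \<beta>" "\<beta> \<le> 1"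
  shows "\<exists>\<phi>. inj_on \<phi> (fibre X (cell \<alpha> \<beta>) u) \<and> \<phi> ` fibre X (cell \<alpha> \<beta>) u \<subseteq> unit_flags \<and>
    (\<forall>v v'. dev (\<phi> v) (\<phi> v') = dev v v' / (\<alpha> * \<beta>))"
proof -
  define x0 where "x0 = \<alpha> * \<lfloor>fx u / \<alpha>\<rfloor>"
  define a0 where "a0 = \<beta> * \<lfloor>fa u / \<beta>\<rfloor>"
  define z0 where "z0 = (\<alpha> * \<beta>) * \<lfloor>(fb u + (fa u - a0) * fx u) / (\<alpha> * \<beta>)\<rfloor>"
  \<comment> \<open>The height is taken at the left end \<open>x0\<close> of the cell, which lowers
    it by up to \<alpha> \<beta>. Adding \<alpha> \<beta> brings the result into [0, 2], the
    intercept range allowed in \<open>unit_flags\<close>.\<close>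
  define \<phi> where "\<phi> = (\<lambda>v. ((fx v - x0) / \<alpha>, (fa v - a0) / \<beta>, (fb v + (fa v - a0) * x0 - z0 + \<alpha> * \<beta>) / (\<alpha> * \<beta>)))"
  have dev: "dev (\<phi> v) (\<phi> v') = dev v v' / (\<alpha> * \<beta>)" for v v'
    unfolding dev_def \<phi>_def using \<alpha> \<beta> by (simp add: field_simps)
  have "\<phi> v \<in> unit_flags" if v: "v \<in> fibre X (cell \<alpha> \<beta>) u" for v
  proof -
    have eq: "\<lfloor>fx v / \<alpha>\<rfloor> = \<lfloor>fx u / \<alpha>\<rfloor>" "\<lfloor>fa v / \<beta>\<rfloor> = \<lfloor>fa u / \<beta>\<rfloor>"
      "\<lfloor>(fb v + (fa v - a0) * fx v) / (\<alpha> * \<beta>)\<rfloor> = \<lfloor>(fb u + (fa u - a0) * fx u) / (\<alpha> * \<beta>)\<rfloor>"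
      using v unfolding fibre_def cell_def a0_def by auto
    have x: "0 \<le> fx v - x0" "fx v - x0 \<le> \<alpha>" unfolding x0_def eq(1)[symmetric] by (rule floor_div_remainder[OF \<alpha>(1)])+
    have a: "0 \<le> fa v - a0" "fa v - a0 \<le> \<beta>" unfolding a0_def eq(2)[symmetric] by (rule floor_div_remainder[OF \<beta>(1)])+
    have ab: "0 < \<alpha> * \<beta>" using \<alpha> \<beta> by simp
    have z: "0 \<le> fb v + (fa v - a0) * fx v - z0" "fb v + (fa v - a0) * fx v - z0 \<le> \<alpha> * \<beta>"
      unfolding z0_def eq(3)[symmetric] by (rule floor_div_remainder[OF ab])+
    have "0 \<le> (fa v - a0) * (fx v - x0)" "(fa v - a0) * (fx v - x0) \<le> \<beta> * \<alpha>"
      using x a \<alpha> \<beta> by (auto intro: mult_mono)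
    then have "0 \<le> fb v + (fa v - a0) * x0 - z0 + \<alpha> * \<beta>" "fb v + (fa v - a0) * x0 - z0 + \<alpha> * \<beta> \<le> 2 * (\<alpha> * \<beta>)"
      using z by (auto simp: algebra_simps)
    then show ?thesis unfolding unit_flags_def \<phi>_def using x a \<alpha> \<beta> ab by (simp add: pos_divide_le_eq)
  qed
  moreover have "inj \<phi>"
  proof (rule injI)
    fix v v' assume "\<phi> v = \<phi> v'"
    then have "fx v = fx v'" "fa v = fa v'" "fb v = fb v'" unfolding \<phi>_def using \<alpha> \<beta> by auto
    then show "v = v'" by (simp add: prod_eq_iff)
  qed
  ultimately show ?thesis using dev by (intro exI[of _ \<phi>]) (auto intro: inj_on_subset)
qed

subsection \<open>Covering numbers and incidences of flags\<close>

definition cov :: "flag set \<Rightarrow> real \<Rightarrow> nat \<Rightarrow> nat \<Rightarrow> real" where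
  "cov X w i j = real (card (cell (w ^ i) (w ^ j) ` X))"

lemma cov_ge1:
  assumes "finite X" "X \<noteq> {}"
  shows "1 \<le> cov X w i j"
proof -
  have "0 < card (cell (w ^ i) (w ^ j) ` X)" using assms by (simp add: card_gt_0_iff)
  then show ?thesis unfolding cov_def by simp
qed

text \<open>A refined cell meets at most 84 (1 / w)^2 cells of the next shape, a coarsened one at
  most 128; both are below (1 / w)^3 because 1 / w \<ge> 128.\<close>

lemma cov_steps:
  assumes X: "finite X" and w: "0 < w" "w \<le> 1/128"
  shows "cov X w (Suc i) j \<le> cov X w i j * (1 / w) ^ 3" "cov X w i (Suc j) \<le> cov X w i j * (1 / w) ^ 3"
    "cov X w i j \<le> cov X w (Suc i) j * (1 / w) ^ 3" "cov X w i j \<le> cov X w i (Suc j) * (1 / w) ^ 3"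
proof -
  define v where "v = 1 / w"
  have v: "128 \<le> v" unfolding v_def using w by (simp add: field_simps)
  have wv: "w * v = 1" unfolding v_def using w by simp
  have pos: "0 < w ^ k" for k using w by simp
  have up: "(2 * v + 2) * (2 * 1 + 2) * (2 * (2 * v + v) + 2) \<le> v ^ 3" "(2 * 1 + 2) * (2 * v + 2) * (2 * (2 * v + 1) + 2) \<le> v ^ 3"
    "(2 * 1 + 2) * (2 * 1 + 2) * (2 * (2 + 1) + 2) \<le> v ^ 3"
  proof -
    have "(2 * v + 2) * 4 * (6 * v + 2) \<le> (3 * v) * 4 * (7 * v)" using v by (intro mult_mono) auto
    also have "\<dots> = 84 * (v * v)" by simp
    also have "\<dots> \<le> v * (v * v)" using v by (intro mult_right_mono) auto
    finally show "(2 * v + 2) * (2 * 1 + 2) * (2 * (2 * v + v) + 2) \<le> v ^ 3" by (simp add: power3_eq_cube mult.assoc)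
    have "4 * (2 * v + 2) * (4 * v + 4) \<le> 4 * (3 * v) * (5 * v)" using v by (intro mult_mono) auto
    also have "\<dots> = 60 * (v * v)" by simp
    also have "\<dots> \<le> v * (v * v)" using v by (intro mult_right_mono) auto
    finally show "(2 * 1 + 2) * (2 * v + 2) * (2 * (2 * v + 1) + 2) \<le> v ^ 3" by (simp add: power3_eq_cube algebra_simps)
    have "128 * (1 * 1) \<le> v * (v * v)" using v by (intro mult_mono) auto
    then show "(2 * 1 + 2) * (2 * 1 + 2) * (2 * (2 + 1) + 2) \<le> v ^ 3" by (simp add: power3_eq_cube)
  qed
  have fin: "cov X w i' j' \<le> cov X w i j * (1 / w) ^ 3"
    if k: "0 \<le> kx" "0 \<le> ka" "0 \<le> kz" "(2 * kx + 2) * (2 * ka + 2) * (2 * (kz + kx) + 2) \<le> v ^ 3"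
      and s: "w ^ i \<le> kx * w ^ i'" "w ^ j \<le> ka * w ^ j'" "2 * (w ^ i * w ^ j) \<le> kz * (w ^ i' * w ^ j')"
    for i j i' j' kx ka kz
  proof -
    have "cov X w i' j' \<le> cov X w i j * ((2 * kx + 2) * (2 * ka + 2) * (2 * (kz + kx) + 2))"
      unfolding cov_def
    proof (rule card_cells_refine[OF pos pos k(1-3) X])
      fix u v' assume "cell (w ^ i) (w ^ j) v' = cell (w ^ i) (w ^ j) u"
      from cell_eqD[OF this[symmetric] pos pos]
      show "near (w ^ i') (w ^ j') kx ka kz u v'" unfolding near_def using s by (auto simp: abs_minus_commute)
    qed
    also have "\<dots> \<le> cov X w i j * v ^ 3" using k(4) by (intro mult_left_mono) (auto simp: cov_def)
    finally show ?thesis unfolding v_def .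
  qed
  have e: "v * w ^ Suc k = w ^ k" for k using wv by (simp add: mult.assoc[symmetric] mult.commute)
  have l: "w ^ Suc k \<le> 1 * w ^ k" for k using w by (simp add: mult_left_le_one_le)
  show "cov X w (Suc i) j \<le> cov X w i j * (1 / w) ^ 3"
  proof (rule fin[of v 1 "2 * v"])
    have "2 * v * (w ^ Suc i * w ^ j) = 2 * ((v * w ^ Suc i) * w ^ j)" by (simp only: ac_simps)
    then show "2 * (w ^ i * w ^ j) \<le> 2 * v * (w ^ Suc i * w ^ j)" unfolding e by (rule eq_refl[OF sym])
    show "w ^ i \<le> v * w ^ Suc i" unfolding e by simp
  qed (use v up in simp_all)
  show "cov X w i (Suc j) \<le> cov X w i j * (1 / w) ^ 3"
  proof (rule fin[of 1 v "2 * v"])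
    have "2 * v * (w ^ i * w ^ Suc j) = 2 * (w ^ i * (v * w ^ Suc j))" by (simp only: ac_simps)
    then show "2 * (w ^ i * w ^ j) \<le> 2 * v * (w ^ i * w ^ Suc j)" unfolding e by (rule eq_refl[OF sym])
    show "w ^ j \<le> v * w ^ Suc j" unfolding e by simp
  qed (use v up in simp_all)
  have l2: "2 * (w ^ Suc i * w ^ j) \<le> 2 * (w ^ i * w ^ j)" "2 * (w ^ i * w ^ Suc j) \<le> 2 * (w ^ i * w ^ j)"
    using l[of i] l[of j] w by (auto intro!: mult_mono simp del: power_Suc)
  show "cov X w i j \<le> cov X w (Suc i) j * (1 / w) ^ 3"
    by (rule fin[of 1 1 2]) (use up(3) l l2 in \<open>auto simp del: power_Suc\<close>)
  show "cov X w i j \<le> cov X w i (Suc j) * (1 / w) ^ 3"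
    by (rule fin[of 1 1 2]) (use up(3) l l2 in \<open>auto simp del: power_Suc\<close>)
qed

text \<open>The three cell shapes have the same product of sides s, so each of the three links
  contributes at most 2 s. The cross terms pair a slope gap with an abscissa gap and add at most 3
  s, which makes 9.\<close>

lemma chained_dev:
  assumes w: "0 < w" "w \<le> 1"
    and yz: "(y, z) \<in> chained X (cell (w ^ (i + 2 * p)) (w ^ j)) (cell (w ^ (i + p)) (w ^ (j + p))) (cell (w ^ i) (w ^ (j + 2 * p)))"
  shows "\<bar>dev y z\<bar> \<le> 9 * (w ^ i * w ^ j * w ^ (2 * p))" "\<bar>fx y - fx z\<bar> \<le> 3 * w ^ i" "\<bar>fa y - fa z\<bar> \<le> 3 * w ^ j"
proof -
  obtain u u' where c: "cell (w ^ (i + 2 * p)) (w ^ j) y = cell (w ^ (i + 2 * p)) (w ^ j) u"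
    "cell (w ^ (i + p)) (w ^ (j + p)) u = cell (w ^ (i + p)) (w ^ (j + p)) u'"
    "cell (w ^ i) (w ^ (j + 2 * p)) u' = cell (w ^ i) (w ^ (j + 2 * p)) z"
    using yz unfolding chained_def by force
  have pos: "0 < w ^ k" for k using w by simp
  have le1: "w ^ k \<le> 1" for k using w by (simp add: power_le_one)
  note c1 = cell_eqD[OF c(1) pos pos]
  note c2 = cell_eqD[OF c(2) pos pos]
  note c3 = cell_eqD[OF c(3) pos pos]
  have xs: "w ^ (i + 2 * p) \<le> w ^ i" "w ^ (i + p) \<le> w ^ i" "w ^ (j + 2 * p) \<le> w ^ j" "w ^ (j + p) \<le> w ^ j"
    using w by (auto intro!: power_decreasing)
  show "\<bar>fx y - fx z\<bar> \<le> 3 * w ^ i" using c1(1) c2(1) c3(1) xs by linarith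
  show "\<bar>fa y - fa z\<bar> \<le> 3 * w ^ j" using c1(2) c2(2) c3(2) xs by linarith
  define s where "s = w ^ i * w ^ j * w ^ (2 * p)"
  have e1: "w ^ (i + 2 * p) * w ^ j = s" "w ^ i * w ^ (j + 2 * p) = s"
    unfolding s_def by (simp_all add: power_add)
  have e2: "w ^ (i + p) * w ^ (j + p) = s"
    unfolding s_def mult_2 power_add by (simp only: ac_simps)
  have uz: "\<bar>dev u z\<bar> \<le> 2 * s + 2 * s + w ^ (j + 2 * p) * w ^ (i + p)"
    by (rule dev_triangle[of u u']) (use c2 c3 e1(2) e2 in simp_all)
  have "w ^ (j + 2 * p) * w ^ (i + p) \<le> s"
  proof -
    have "w ^ (j + 2 * p) * w ^ (i + p) = s * w ^ p" unfolding s_def by (simp add: power_add mult_ac)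
    also have "\<dots> \<le> s * 1" using le1[of p] pos unfolding s_def by (intro mult_left_mono) (auto simp: less_imp_le)
    finally show ?thesis by simp
  qed
  then have uz': "\<bar>dev u z\<bar> \<le> 5 * s" using uz by linarith
  have "\<bar>fa u - fa z\<bar> \<le> 2 * w ^ j" using c2(2) c3(2) xs by linarith
  then have "\<bar>dev y z\<bar> \<le> 2 * s + 5 * s + (2 * w ^ j) * w ^ (i + 2 * p)"
    using c1 e1 uz' by (intro dev_triangle[of y u]) simp_all
  also have "\<dots> = 9 * s" using e1(1) by (simp add: mult_ac)
  finally show "\<bar>dev y z\<bar> \<le> 9 * (w ^ i * w ^ j * w ^ (2 * p))" unfolding s_def .
qed

text \<open>Bounds the number of inner vertices for fixed ends. Two possible first inner vertices
  share a cell of width w ^ (i + 2 * p), and going round the walk their slopes differ by at most 3 w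
  ^ (j + p). Their \<open>dev\<close> is known only up to (1 / w) ^ p times the product of these
  sides, so about (1 / w) ^ p cells of that shape are needed; the second vertex is symmetric. The
  constant is 384 = 8 * 4 * 12.\<close>

lemma card_chained_cells:
  assumes X: "finite X" "X \<noteq> {}" and w: "0 < w" "w \<le> 1"
    and M1: "\<And>u. u \<in> X \<Longrightarrow> real (card (fibre X (cell (w ^ (i + 2 * p)) (w ^ (j + p))) u)) \<le> M1"
    and M2: "\<And>u. u \<in> X \<Longrightarrow> real (card (fibre X (cell (w ^ (i + p)) (w ^ (j + 2 * p))) u)) \<le> M2"
  shows "real (card X) ^ 4 \<le> 64 * (cov X w (i + p) (j + p) * cov X w (i + 2 * p) j * cov X w i (j + 2 * p)) *
     ((384 * (1 / w) ^ p * M1) * (384 * (1 / w) ^ p * M2)) *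
     real (card (chained X (cell (w ^ (i + 2 * p)) (w ^ j)) (cell (w ^ (i + p)) (w ^ (j + p))) (cell (w ^ i) (w ^ (j + 2 * p)))))"
proof -
  define v where "v = (1 / w) ^ p"
  have v1: "1 \<le> v" unfolding v_def using w by (intro one_le_power) (simp add: field_simps)
  have vw: "v * w ^ p = 1" unfolding v_def using w by (simp add: power_mult_distrib[symmetric])
  have pos: "0 < w ^ k" for k using w by simp
  have M0: "0 \<le> M1" "0 \<le> M2" using X M1 M2 by (meson all_not_in_conv of_nat_0_le_iff order_trans)+
  have xs: "w ^ (j + 2 * p) \<le> w ^ (j + p)" "w ^ (i + 2 * p) \<le> w ^ (i + p)"
    using w by (auto intro!: power_decreasing)
  have e: "v * (w ^ (i + 2 * p) * w ^ (j + p)) = w ^ (i + 2 * p) * w ^ j" "v * (w ^ (i + p) * w ^ (j + 2 * p)) = w ^ i * w ^ (j + 2 * p)"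
  proof -
    have "v * (w ^ (i + 2 * p) * w ^ (j + p)) = (v * w ^ p) * (w ^ (i + 2 * p) * w ^ j)" by (simp add: power_add mult_ac)
    then show "v * (w ^ (i + 2 * p) * w ^ (j + p)) = w ^ (i + 2 * p) * w ^ j" unfolding vw by simp
    have "v * (w ^ (i + p) * w ^ (j + 2 * p)) = (v * w ^ p) * (w ^ i * w ^ (j + 2 * p))" by (simp add: power_add mult_ac)
    then show "v * (w ^ (i + p) * w ^ (j + 2 * p)) = w ^ i * w ^ (j + 2 * p)" unfolding vw by simp
  qed
  show ?thesis unfolding cov_def v_def[symmetric]
  proof (rule card_chained[OF X])
    fix u u' assume u: "u \<in> X" "u' \<in> X" "cell (w ^ (i + p)) (w ^ (j + p)) u = cell (w ^ (i + p)) (w ^ (j + p)) u'"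
    note c = cell_eqD[OF u(3) pos pos]
    define N1 where "N1 = {y \<in> X. \<exists>y'\<in>X. cell (w ^ (i + 2 * p)) (w ^ j) y = cell (w ^ (i + 2 * p)) (w ^ j) u \<and>
        cell (w ^ (i + p)) (w ^ (j + p)) y = cell (w ^ (i + p)) (w ^ (j + p)) y' \<and>
        cell (w ^ i) (w ^ (j + 2 * p)) y' = cell (w ^ i) (w ^ (j + 2 * p)) u'}"
    have "real (card N1) \<le> (2 * 1 + 2) * (2 * 3 + 2) * (2 * (2 * v + 1) + 2) * M1"
    proof (rule card_near[OF pos pos _ _ _ X(1) M0(1) M1])
      fix y assume "y \<in> N1"
      then obtain y' where y: "cell (w ^ (i + 2 * p)) (w ^ j) y = cell (w ^ (i + 2 * p)) (w ^ j) u"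
        "cell (w ^ (i + p)) (w ^ (j + p)) y = cell (w ^ (i + p)) (w ^ (j + p)) y'"
        "cell (w ^ i) (w ^ (j + 2 * p)) y' = cell (w ^ i) (w ^ (j + 2 * p)) u'" unfolding N1_def by blast
      note a = cell_eqD[OF y(1)[symmetric] pos pos]
      note b = cell_eqD[OF y(2) pos pos]
      note d = cell_eqD[OF y(3) pos pos]
      have "\<bar>fa y - fa u\<bar> \<le> 3 * w ^ (j + p)" using b(2) d(2) c(2) xs by linarith
      then show "near (w ^ (i + 2 * p)) (w ^ (j + p)) 1 3 (2 * v) u y"
        unfolding near_def mult.assoc[of 2 v] e using a by (simp add: abs_minus_commute)
    qed (use v1 in \<open>auto simp: N1_def\<close>)
    also have "\<dots> \<le> 384 * v * M1" using v1 M0 by (intro mult_right_mono) auto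
    finally show "real (card {y \<in> X. \<exists>y'\<in>X. cell (w ^ (i + 2 * p)) (w ^ j) y = cell (w ^ (i + 2 * p)) (w ^ j) u \<and>
        cell (w ^ (i + p)) (w ^ (j + p)) y = cell (w ^ (i + p)) (w ^ (j + p)) y' \<and>
        cell (w ^ i) (w ^ (j + 2 * p)) y' = cell (w ^ i) (w ^ (j + 2 * p)) u'}) \<le> 384 * v * M1" unfolding N1_def .
    define N2 where "N2 = {y' \<in> X. \<exists>y\<in>X. cell (w ^ (i + 2 * p)) (w ^ j) y = cell (w ^ (i + 2 * p)) (w ^ j) u \<and>
        cell (w ^ (i + p)) (w ^ (j + p)) y = cell (w ^ (i + p)) (w ^ (j + p)) y' \<and>
        cell (w ^ i) (w ^ (j + 2 * p)) y' = cell (w ^ i) (w ^ (j + 2 * p)) u'}"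
    have "real (card N2) \<le> (2 * 3 + 2) * (2 * 1 + 2) * (2 * (2 * v + 3) + 2) * M2"
    proof (rule card_near[OF pos pos _ _ _ X(1) M0(2) M2])
      fix y' assume "y' \<in> N2"
      then obtain y where y: "cell (w ^ (i + 2 * p)) (w ^ j) y = cell (w ^ (i + 2 * p)) (w ^ j) u"
        "cell (w ^ (i + p)) (w ^ (j + p)) y = cell (w ^ (i + p)) (w ^ (j + p)) y'"
        "cell (w ^ i) (w ^ (j + 2 * p)) y' = cell (w ^ i) (w ^ (j + 2 * p)) u'" unfolding N2_def by blast
      note a = cell_eqD[OF y(1)[symmetric] pos pos]
      note b = cell_eqD[OF y(2) pos pos]
      note d = cell_eqD[OF y(3)[symmetric] pos pos]
      have "\<bar>fx y' - fx u'\<bar> \<le> 3 * w ^ (i + p)" using a(1) b(1) c(1) xs by linarith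
      then show "near (w ^ (i + p)) (w ^ (j + 2 * p)) 3 1 (2 * v) u' y'"
        unfolding near_def mult.assoc[of 2 v] e using d by (simp add: abs_minus_commute)
    qed (use v1 in \<open>auto simp: N2_def\<close>)
    also have "\<dots> \<le> 384 * v * M2" using v1 M0 by (intro mult_right_mono) auto
    finally show "real (card {y' \<in> X. \<exists>y\<in>X. cell (w ^ (i + 2 * p)) (w ^ j) y = cell (w ^ (i + 2 * p)) (w ^ j) u \<and>
        cell (w ^ (i + p)) (w ^ (j + p)) y = cell (w ^ (i + p)) (w ^ (j + p)) y' \<and>
        cell (w ^ i) (w ^ (j + 2 * p)) y' = cell (w ^ i) (w ^ (j + 2 * p)) u'}) \<le> 384 * v * M2" unfolding N2_def .
  qed
qed

section \<open>Passing from one scale to the next\<close>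

definition flag_incidences :: "flag set \<Rightarrow> flag set \<Rightarrow> real \<Rightarrow> (flag \<times> flag) set" where
  "flag_incidences P L \<rho> = {(y, z). y \<in> P \<and> z \<in> L \<and> \<bar>dev y z\<bar> \<le> \<rho>}"

text \<open>The first flag of a chain need not share the cell of the last one. The constants leave
  room for 3 + 1 in the sides and for 9 + 2 + 3 in \<open>dev\<close>.\<close>

definition vicinity :: "flag set \<Rightarrow> real \<Rightarrow> real \<Rightarrow> flag \<Rightarrow> flag set" where
  "vicinity X \<alpha> \<beta> z0 = {y \<in> X. \<bar>fx y - fx z0\<bar> \<le> 4 * \<alpha> \<and> \<bar>fa y - fa z0\<bar> \<le> 4 * \<beta> \<and> \<bar>dev y z0\<bar> \<le> 20 * (\<alpha> * \<beta>)}"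

text \<open>Coordinates relative to \<open>z0\<close> turn first flags into points, second flags
  into lines and \<open>dev\<close> into vertical distance, so \<open>incidences_high_low\<close>
  applies. Crowding of points is counted by cells of shape (\<alpha> \<tau>, \<beta>), crowding of
  lines by cells of shape (\<alpha>, \<beta> \<tau>). The error therefore contains
  \<open>MP * mL\<close>, the product that \<open>axes\<close> later controls.\<close>

lemma flag_incidence_step:
  assumes X: "finite X" and z0: "z0 \<in> X" and \<alpha>: "0 < \<alpha>" and \<beta>: "0 < \<beta>" and \<tau>: "0 < \<tau>" "\<tau> \<le> 1" and w: "0 < w" "w \<le> 1/2"
    and M: "\<And>u. u \<in> X \<Longrightarrow> real (card (fibre X (cell \<alpha> \<beta>) u)) \<le> M"
    and MP: "\<And>u. u \<in> X \<Longrightarrow> real (card (fibre X (cell (\<alpha> * \<tau>) \<beta>) u)) \<le> MP"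
    and mL: "\<And>u. u \<in> X \<Longrightarrow> real (card (fibre X (cell \<alpha> (\<beta> * \<tau>)) u)) \<le> mL"
    and N: "2 / (9 * \<tau>) \<le> real N"
  defines "P \<equiv> vicinity X \<alpha> \<beta> z0" and "L \<equiv> fibre X (cell \<alpha> \<beta>) z0"
  shows "w / 2 * real (card (flag_incidences P L (9 * (\<alpha> * \<beta> * \<tau>)))) \<le> real (card (flag_incidences P L (9 * (\<alpha> * \<beta> * (w * \<tau>)))))
     + 7 * sqrt (10 ^ 15 * M\<^sup>2 * MP * mL / (w * \<tau>) * (1 + harm (Suc N)))"
proof -
  have M0: "0 \<le> M" "0 \<le> MP" "0 \<le> mL" using M[OF z0] MP[OF z0] mL[OF z0] by (meson of_nat_0_le_iff order_trans)+
  have \<alpha>\<beta>: "0 < \<alpha> * \<beta>" using \<alpha> \<beta> by simp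
  have fin: "finite P" "finite L" unfolding P_def L_def vicinity_def fibre_def using X by simp_all
  have PX: "P \<subseteq> X" "L \<subseteq> X" unfolding P_def L_def vicinity_def fibre_def by auto
  have Pd: "\<bar>fx y - fx z0\<bar> \<le> 4 * \<alpha>" "\<bar>fa y - fa z0\<bar> \<le> 4 * \<beta>" "\<bar>dev y z0\<bar> \<le> 20 * (\<alpha> * \<beta>)" if "y \<in> P" for y
    using that unfolding P_def vicinity_def by auto
  have Ld: "\<bar>fx z - fx z0\<bar> \<le> \<alpha>" "\<bar>fa z - fa z0\<bar> \<le> \<beta>" if "z \<in> L" for z
    using that cell_eqD[OF _ \<alpha> \<beta>, of z z0] unfolding L_def fibre_def by auto
  have cL: "real (card L) \<le> M" unfolding L_def by (rule M[OF z0])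
  have cP: "real (card P) \<le> 8200 * M"
  proof -
    have "real (card P) \<le> (2 * 4 + 2) * (2 * 4 + 2) * (2 * (36 + 4) + 2) * M"
    proof (rule card_near[OF \<alpha> \<beta> _ _ _ X M0(1) M PX(1)])
      fix y assume y: "y \<in> P"
      have "\<bar>dev z0 y\<bar> \<le> 20 * (\<alpha> * \<beta>) + (4 * \<beta>) * (4 * \<alpha>)"
        using Pd[OF y] by (intro dev_swap) (auto simp: abs_minus_commute)
      then show "near \<alpha> \<beta> 4 4 36 z0 y" unfolding near_def using Pd[OF y] by (simp add: algebra_simps)
    qed auto
    then show ?thesis by simp
  qed
  \<comment> \<open>The vicinity reaches 4 \<alpha> to both sides. The shift by 4 puts the abscissae
    into [0, 8], so a slab of width 9 contains all unit squares; \<open>lb\<close> compensates for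
    the shift.\<close>
  define px where "px = (\<lambda>y::flag. (fx y - fx z0) / \<alpha> + 4)"
  define py where "py = (\<lambda>y. dev y z0 / (\<alpha> * \<beta>))"
  define la where "la = (\<lambda>z::flag. (fa z - fa z0) / \<beta>)"
  define lb where "lb = (\<lambda>z. - dev z0 z / (\<alpha> * \<beta>) - 4 * la z)"
  have dev_eq: "py y - la z * px y - lb z = dev y z / (\<alpha> * \<beta>)" for y z
  proof -
    have "la z * ((fx y - fx z0) / \<alpha>) = (fa z - fa z0) * (fx y - fx z0) / (\<alpha> * \<beta>)" unfolding la_def by simp
    then have "py y - la z * px y - lb z = (dev y z0 + dev z0 z - (fa z - fa z0) * (fx y - fx z0)) / (\<alpha> * \<beta>)"
      unfolding py_def px_def lb_def by (simp add: algebra_simps add_divide_distrib diff_divide_distrib)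
    also have "dev y z0 + dev z0 z - (fa z - fa z0) * (fx y - fx z0) = dev y z"
      unfolding dev_cocycle[of y z z0] by (simp add: algebra_simps)
    finally show ?thesis .
  qed
  have inc_eq: "incidences px py la lb P L \<rho> = flag_incidences P L (\<rho> * (\<alpha> * \<beta>))" for \<rho>
    unfolding incidences_def flag_incidences_def dev_eq using \<alpha>\<beta> by (simp add: abs_divide pos_divide_le_eq)
  \<comment> \<open>With R = 1 these choices give r - 2 h = 9 \<tau> and r' + 2 h = 9 w \<tau>: the
    same threshold 9 at two consecutive scales, so the step can be iterated.\<close>
  define r where "r = 9 * \<tau> + 2 * (w * \<tau>)"
  define r' where "r' = 7 * (w * \<tau>)"
  define h where "h = w * \<tau>"
  have h: "0 < h" "h \<le> \<tau>" "h \<le> \<tau> / 2" unfolding h_def using w \<tau> by auto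
  have r10: "r \<le> 10 * \<tau>" using h(3) unfolding r_def h_def by simp
  have r9: "9 * \<tau> \<le> r" using h(1) unfolding r_def h_def by simp
  have px8: "0 \<le> px y \<and> px y + 1 \<le> real (9::nat)" if "y \<in> P" for y
    using Pd(1)[OF that] \<alpha> unfolding px_def by (auto simp: abs_le_iff field_simps)
  have la1: "\<bar>la z\<bar> \<le> 1" if "z \<in> L" for z
    using Ld(2)[OF that] \<beta> unfolding la_def by (simp add: abs_divide)
  have N': "2 * 1 \<le> real N * r"
  proof -
    have "2 = 2 / (9 * \<tau>) * (9 * \<tau>)" using \<tau> by simp
    also have "\<dots> \<le> real N * r" using N r9 \<tau> by (intro mult_mono) auto
    finally show ?thesis by simp
  qed
  have mP: "real (card {p' \<in> P. \<bar>px p' - px p\<bar> \<le> h \<and> \<bar>py p' - py p\<bar> \<le> h}) \<le> 1008 * MP" if p: "p \<in> P" for p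
  proof -
    have "real (card {p' \<in> P. \<bar>px p' - px p\<bar> \<le> h \<and> \<bar>py p' - py p\<bar> \<le> h}) \<le> (2 * 1 + 2) * (2 * 8 + 2) * (2 * (5 + 1) + 2) * MP"
    proof (rule card_near[OF _ \<beta> _ _ _ X M0(2) MP])
      fix p' assume p': "p' \<in> {p' \<in> P. \<bar>px p' - px p\<bar> \<le> h \<and> \<bar>py p' - py p\<bar> \<le> h}"
      have "\<bar>fx p' - fx p\<bar> / \<alpha> \<le> \<tau>" using p' h \<alpha> unfolding px_def by (simp add: diff_divide_distrib[symmetric] abs_divide)
      then have x: "\<bar>fx p' - fx p\<bar> \<le> \<alpha> * \<tau>" using \<alpha> by (simp add: field_simps)
      have "\<bar>dev p' z0 - dev p z0\<bar> / (\<alpha> * \<beta>) \<le> \<tau>" using p' h \<alpha>\<beta> unfolding py_def by (simp add: diff_divide_distrib[symmetric] abs_divide)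
      then have d: "\<bar>dev p' z0 - dev p z0\<bar> \<le> \<alpha> * \<beta> * \<tau>" using \<alpha>\<beta> by (simp add: field_simps)
      have p'P: "p' \<in> P" using p' by simp
      have a: "\<bar>fa p' - fa p\<bar> \<le> 8 * \<beta>" using Pd(2)[OF p] Pd(2)[OF p'P] by linarith
      have "\<bar>(fa z0 - fa p') * (fx p - fx p')\<bar> \<le> (4 * \<beta>) * (\<alpha> * \<tau>)"
        unfolding abs_mult using Pd(2)[OF p'P] x \<alpha> \<beta> \<tau> by (intro mult_mono) (auto simp: abs_minus_commute)
      moreover have "dev p p' = (dev p z0 - dev p' z0) + (fa z0 - fa p') * (fx p - fx p')"
        unfolding dev_def by (simp add: algebra_simps)
      ultimately have "\<bar>dev p p'\<bar> \<le> 5 * (\<alpha> * \<tau> * \<beta>)" using d by (simp add: algebra_simps)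
      then show "near (\<alpha> * \<tau>) \<beta> 1 8 5 p p'" unfolding near_def using x a by simp
    qed (use \<alpha> \<tau> PX in auto)
    then show ?thesis by simp
  qed
  have mL': "real (card {l \<in> L. (a' \<le> la l \<and> la l \<le> a' + r) \<and> b' \<le> lb l \<and> lb l \<le> b' + r}) \<le> 17000 * mL" for a' b'
  proof (cases "{l \<in> L. (a' \<le> la l \<and> la l \<le> a' + r) \<and> b' \<le> lb l \<and> lb l \<le> b' + r} = {}")
    case True
    then have "real (card {l \<in> L. (a' \<le> la l \<and> la l \<le> a' + r) \<and> b' \<le> lb l \<and> lb l \<le> b' + r}) = 0" by (simp only: card.empty of_nat_0)
    then show ?thesis using M0 by simp
  next
    case False
    then obtain z1 where z1: "z1 \<in> L" "a' \<le> la z1" "la z1 \<le> a' + r" "b' \<le> lb z1" "lb z1 \<le> b' + r" by blast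
    have "real (card {l \<in> L. (a' \<le> la l \<and> la l \<le> a' + r) \<and> b' \<le> lb l \<and> lb l \<le> b' + r}) \<le> (2 * 2 + 2) * (2 * 10 + 2) * (2 * (60 + 2) + 2) * (mL)"
      (is "?lhs \<le> _")
    proof (rule card_near[OF \<alpha> _ _ _ _ X M0(3) mL])
      fix z assume "z \<in> {l \<in> L. (a' \<le> la l \<and> la l \<le> a' + r) \<and> b' \<le> lb l \<and> lb l \<le> b' + r}"
      then have z: "z \<in> L" "a' \<le> la z" "la z \<le> a' + r" "b' \<le> lb z" "lb z \<le> b' + r" by auto
      have x: "\<bar>fx z - fx z1\<bar> \<le> 2 * \<alpha>" using Ld(1)[OF z(1)] Ld(1)[OF z1(1)] by linarith
      have la: "\<bar>la z - la z1\<bar> \<le> 10 * \<tau>" using z z1 r10 by linarith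
      then have "\<bar>fa z - fa z1\<bar> / \<beta> \<le> 10 * \<tau>" unfolding la_def using \<beta> by (simp add: diff_divide_distrib[symmetric] abs_divide)
      then have a: "\<bar>fa z - fa z1\<bar> \<le> 10 * (\<beta> * \<tau>)" using \<beta> by (simp add: field_simps)
      have "\<bar>lb z - lb z1\<bar> \<le> 10 * \<tau>" using z z1 r10 by linarith
      then have "\<bar>- (lb z - lb z1) - 4 * (la z - la z1)\<bar> \<le> 50 * \<tau>"
        using la unfolding abs_le_iff by auto
      moreover have "dev z0 z / (\<alpha> * \<beta>) - dev z0 z1 / (\<alpha> * \<beta>) = - (lb z - lb z1) - 4 * (la z - la z1)"
        unfolding lb_def by simp
      ultimately have "\<bar>dev z0 z / (\<alpha> * \<beta>) - dev z0 z1 / (\<alpha> * \<beta>)\<bar> \<le> 50 * \<tau>" by (simp only:)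
      then have "\<bar>dev z0 z - dev z0 z1\<bar> / (\<alpha> * \<beta>) \<le> 50 * \<tau>" using \<alpha>\<beta> by (simp add: diff_divide_distrib[symmetric] abs_divide)
      then have d: "\<bar>dev z0 z - dev z0 z1\<bar> \<le> 50 * (\<alpha> * \<beta> * \<tau>)" using \<alpha>\<beta> by (simp add: field_simps)
      have "\<bar>(fa z1 - fa z) * (fx z1 - fx z0)\<bar> \<le> (10 * (\<beta> * \<tau>)) * \<alpha>"
        unfolding abs_mult using a Ld(1)[OF z1(1)] \<alpha> \<beta> \<tau> by (intro mult_mono) (auto simp: abs_minus_commute)
      moreover have "dev z1 z = (dev z0 z - dev z0 z1) + (fa z1 - fa z) * (fx z1 - fx z0)"
        unfolding dev_def by (simp add: algebra_simps)
      ultimately have "\<bar>dev z1 z\<bar> \<le> 60 * (\<alpha> * (\<beta> * \<tau>))" using d by (simp add: algebra_simps)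
      then show "near \<alpha> (\<beta> * \<tau>) 2 10 60 z1 z" unfolding near_def using x a by simp
    qed (use \<beta> \<tau> PX in auto)
    also have "\<dots> \<le> 17000 * mL" using M0 by simp
    finally show ?thesis .
  qed
  have r': "0 < r'" "r' \<le> r" using h \<tau> unfolding r'_def r_def h_def by auto
  have h1: "h \<le> 1" using h \<tau> by linarith
  define A where "A = real (card P) * (1008 * MP) * (real (card L) * (32 * (real (9::nat) + 8)\<^sup>2 * (17000 * mL) / r' * (1 + harm (Suc N))))"
  define S where "S = sqrt A"
  have HL: "real (card (incidences px py la lb P L (r - (1 + 1) * h))) / r \<le>
      real (card (incidences px py la lb P L (r' + (1 + 1) * h))) / r' + S / h"
    unfolding S_def A_def by (rule incidences_high_low[OF fin r' h(1) h1 px8 la1 N' mP mL'])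
  define J1 where "J1 = real (card (flag_incidences P L (9 * (\<alpha> * \<beta> * \<tau>))))"
  define J2 where "J2 = real (card (flag_incidences P L (9 * (\<alpha> * \<beta> * (w * \<tau>)))))"
  have e1: "(r - (1 + 1) * h) * (\<alpha> * \<beta>) = 9 * (\<alpha> * \<beta> * \<tau>)" "(r' + (1 + 1) * h) * (\<alpha> * \<beta>) = 9 * (\<alpha> * \<beta> * (w * \<tau>))"
    unfolding r_def r'_def h_def by (simp_all add: algebra_simps)
  have "J1 / r \<le> J2 / r' + S / h" using HL unfolding inc_eq e1 J1_def J2_def .
  then have "r' * (J1 / r) \<le> r' * (J2 / r' + S / h)" using r' by (intro mult_left_mono) auto
  also have "\<dots> = J2 + 7 * S"
  proof -
    have r'h: "r' = 7 * h" unfolding r'_def h_def by simp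
    show ?thesis unfolding r'h using h(1) by (simp add: field_simps)
  qed
  finally have 1: "r' / r * J1 \<le> J2 + 7 * S" by simp
  have "w / 2 \<le> r' / r"
  proof -
    have "w / 2 * r \<le> w / 2 * (10 * \<tau>)" using r10 w by (intro mult_left_mono) auto
    also have "\<dots> \<le> r'" unfolding r'_def using w \<tau> by simp
    finally show ?thesis using r' by (simp add: pos_le_divide_eq)
  qed
  then have 2: "w / 2 * J1 \<le> r' / r * J1" unfolding J1_def by (intro mult_right_mono) auto
  have H0: "0 \<le> (harm (Suc N) :: real)" by (rule harm_nonneg)
  \<comment> \<open>8200, 1008 and 17000 bound numbers of neighbouring cells, 32 * 17^2 comes from
    the kernel sum and 7 from r'; the product is below 10 ^ 15.\<close>
  have "A \<le> 10 ^ 15 * M\<^sup>2 * MP * mL / (w * \<tau>) * (1 + harm (Suc N))"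
  proof -
    define B where "B = MP * mL / (w * \<tau>) * (1 + harm (Suc N))"
    have B0: "0 \<le> B" unfolding B_def using M0 w \<tau> H0 by (intro mult_nonneg_nonneg divide_nonneg_nonneg) auto
    have "A = (real (card P) * real (card L)) * ((1008 * 32 * 289 * 17000 / 7) * B)"
      unfolding A_def B_def r'_def using w \<tau> by (simp add: field_simps power2_eq_square)
    also have "\<dots> \<le> ((8200 * M) * M) * ((1008 * 32 * 289 * 17000 / 7) * B)"
      using cP cL M0 B0 by (intro mult_right_mono mult_mono) auto
    also have "\<dots> = (8200 * 1008 * 32 * 289 * 17000 / 7) * (M\<^sup>2 * B)" by (simp add: power2_eq_square)
    also have "\<dots> \<le> 10 ^ 15 * (M\<^sup>2 * B)" using B0 by (intro mult_right_mono) auto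
    finally show ?thesis unfolding B_def by (simp add: mult.assoc)
  qed
  then have "S \<le> sqrt (10 ^ 15 * M\<^sup>2 * MP * mL / (w * \<tau>) * (1 + harm (Suc N)))"
    unfolding S_def by (rule real_sqrt_le_mono)
  then show ?thesis using 1 2 unfolding J1_def J2_def by linarith
qed

text \<open>Fibres exceed the average size by a factor (1 / w)^2 at most: one factor 1 / w is the
  base of the size levels, the other covers the number of level vectors.\<close>

definition regular :: "flag set \<Rightarrow> real \<Rightarrow> nat \<Rightarrow> bool" where
  "regular X w m \<longleftrightarrow> (\<forall>i j. i + j \<le> m \<longrightarrow>
     (\<forall>u\<in>X. real (card (fibre X (cell (w ^ i) (w ^ j)) u)) \<le> (1 / w)\<^sup>2 * real (card X) / cov X w i j))"

definition cross_ratio :: "flag set \<Rightarrow> real \<Rightarrow> nat \<Rightarrow> nat \<Rightarrow> nat \<Rightarrow> real" where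
  "cross_ratio X w i j p = cov X w (i + 2 * p) j * cov X w i (j + 2 * p) * cov X w (i + p) (j + p) /
     (cov X w (i + 2 * p) (j + p) * cov X w (i + p) (j + 2 * p) * cov X w i j)"

definition close_pairs :: "flag set \<Rightarrow> real \<Rightarrow> nat \<Rightarrow> nat \<Rightarrow> flag \<Rightarrow> nat \<Rightarrow> real" where
  "close_pairs X w i j z0 t = real (card (flag_incidences (vicinity X (w ^ i) (w ^ j) z0)
     (fibre X (cell (w ^ i) (w ^ j)) z0) (9 * (w ^ i * w ^ j * w ^ t))))"

lemma cross_ratio_pos:
  assumes "finite X" "X \<noteq> {}"
  shows "0 < cross_ratio X w i j p"
proof -
  have "0 < cov X w i j" for i j using cov_ge1[OF assms, of w i j] by linarith
  then show ?thesis unfolding cross_ratio_def by simp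
qed

lemma cov_steps_iterated:
  assumes X: "finite X" and w: "0 < w" "w \<le> 1/128"
  shows "cov X w (i + k) j \<le> cov X w i j * (1 / w) ^ (3 * k)" "cov X w i (j + k) \<le> cov X w i j * (1 / w) ^ (3 * k)"
    "cov X w i j \<le> cov X w (i + k) j * (1 / w) ^ (3 * k)" "cov X w i j \<le> cov X w i (j + k) * (1 / w) ^ (3 * k)"
proof -
  note st = cov_steps[OF X w]
  have c: "a \<le> b * (1 / w) ^ (3 * Suc k)" if "a \<le> c * (1 / w) ^ 3" "c \<le> b * (1 / w) ^ (3 * k)" for a b c :: real and k
  proof -
    have "c * (1 / w) ^ 3 \<le> b * (1 / w) ^ (3 * k) * (1 / w) ^ 3" using that(2) w by (intro mult_right_mono) auto
    also have "\<dots> = b * (1 / w) ^ (3 * Suc k)" by (simp add: power_add)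
    finally show ?thesis using that(1) by linarith
  qed
  show "cov X w (i + k) j \<le> cov X w i j * (1 / w) ^ (3 * k)"
  proof (induction k)
    case (Suc k)
    show ?case by (rule c[OF _ Suc.IH]) (use st(1)[of "i + k" j] in simp)
  qed simp
  show "cov X w i (j + k) \<le> cov X w i j * (1 / w) ^ (3 * k)"
  proof (induction k)
    case (Suc k)
    show ?case by (rule c[OF _ Suc.IH]) (use st(2)[of i "j + k"] in simp)
  qed simp
  show "cov X w i j \<le> cov X w (i + k) j * (1 / w) ^ (3 * k)"
  proof (induction k arbitrary: i)
    case (Suc k)
    show ?case by (rule c[OF st(3)]) (use Suc.IH[of "Suc i"] in simp)
  qed simp
  show "cov X w i j \<le> cov X w i (j + k) * (1 / w) ^ (3 * k)"
  proof (induction k arbitrary: j)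
    case (Suc k)
    show ?case by (rule c[OF st(4)]) (use Suc.IH[of "Suc j"] in simp)
  qed simp
qed

text \<open>Each covering number in the numerator is compared with one in the denominator; the three
  shifts have lengths 2 p, p and p, and every unit costs (1 / w)^3.\<close>

lemma cross_ratio_le:
  assumes X: "finite X" "X \<noteq> {}" and w: "0 < w" "w \<le> 1/128"
  shows "cross_ratio X w i j p \<le> (1 / w) ^ (12 * p)"
proof -
  note st = cov_steps_iterated[OF X(1) w]
  have c0: "0 < cov X w i j" for i j using cov_ge1[OF X, of w i j] by linarith
  have "cov X w (i + 2 * p) j * cov X w i (j + 2 * p) * cov X w (i + p) (j + p)
     \<le> (cov X w i j * (1 / w) ^ (3 * (2 * p))) * (cov X w (i + p) (j + 2 * p) * (1 / w) ^ (3 * p)) * (cov X w (i + p + p) (j + p) * (1 / w) ^ (3 * p))"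
    by (intro mult_mono mult_nonneg_nonneg st(1) st(3) less_imp_le[OF c0]) (use w in auto)
  also have "\<dots> = (1 / w) ^ (12 * p) * (cov X w (i + 2 * p) (j + p) * cov X w (i + p) (j + 2 * p) * cov X w i j)"
  proof -
    have "(1 / w) ^ (12 * p) = (1 / w) ^ (3 * (2 * p)) * (1 / w) ^ (3 * p) * (1 / w) ^ (3 * p)"
      unfolding power_add[symmetric] by (rule arg_cong[where f = "power (1 / w)"]) simp
    moreover have "i + p + p = i + 2 * p" by simp
    ultimately show ?thesis by (simp only: ac_simps)
  qed
  finally show ?thesis unfolding cross_ratio_def using c0 by (simp add: pos_divide_le_eq)
qed

text \<open>Regularity replaces the multiplicities of chains by n / c4 and n / c5, and then the
  covering numbers combine to q c. A cell holding a fraction 1 / c of the chained pairs, sorted by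
  second flag, provides \<open>z0\<close>. The exponent 2 p + 5 consists of 2 p from the
  multiplicities, 4 from regularity and 1 for the constant 64 * 384^2.\<close>

lemma close_pairs_start:
  assumes X: "finite X" "X \<noteq> {}" and reg: "regular X w m" and w: "0 < w" "64 * 384\<^sup>2 \<le> 1 / w" and m: "i + j + 3 * p \<le> m"
  shows "\<exists>z0\<in>X. (real (card X) / cov X w i j)\<^sup>2 \<le> (1 / w) ^ (2 * p + 5) * cross_ratio X w i j p * close_pairs X w i j z0 (2 * p)"
proof -
  define v where "v = 1 / w"
  define n where "n = real (card X)"
  have n0: "0 < n" unfolding n_def using X by (simp add: card_gt_0_iff)
  have v0: "0 < v" unfolding v_def using w by simp
  have w1: "w \<le> 1" using w by (simp add: pos_le_divide_eq)
  have pos: "0 < w ^ k" for k using w by simp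
  have c0: "0 < cov X w i j" for i j using cov_ge1[OF X, of w i j] by linarith
  have M: "real (card (fibre X (cell (w ^ i) (w ^ j)) u)) \<le> v\<^sup>2 * n / cov X w i j" if "u \<in> X" "i + j \<le> m" for u i j
    using reg that unfolding regular_def v_def n_def by blast
  define E where "E = chained X (cell (w ^ (i + 2 * p)) (w ^ j)) (cell (w ^ (i + p)) (w ^ (j + p))) (cell (w ^ i) (w ^ (j + 2 * p)))"
  define c1 where "c1 = cov X w (i + p) (j + p)"
  define c2 where "c2 = cov X w (i + 2 * p) j"
  define c3 where "c3 = cov X w i (j + 2 * p)"
  define c4 where "c4 = cov X w (i + 2 * p) (j + p)"
  define c5 where "c5 = cov X w (i + p) (j + 2 * p)"
  define c where "c = cov X w i j"
  note cd = c1_def c2_def c3_def c4_def c5_def c_def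
  have cp: "0 < c1" "0 < c2" "0 < c3" "0 < c4" "0 < c5" "0 < c" unfolding cd using c0 by simp_all
  define q where "q = cross_ratio X w i j p"
  have q0: "0 < q" unfolding q_def by (rule cross_ratio_pos[OF X])
  have q: "c1 * c2 * c3 / (c4 * c5) = q * c"
    unfolding q_def cross_ratio_def cd[symmetric] using cp by (simp add: field_simps)
  have ES: "E \<subseteq> X \<times> X" unfolding E_def chained_def by auto
  have fE: "finite E" using finite_subset[OF ES] X by simp
  have "n ^ 4 \<le> 64 * (c1 * c2 * c3) * ((384 * v ^ p * (v\<^sup>2 * n / c4)) * (384 * v ^ p * (v\<^sup>2 * n / c5))) * real (card E)"
    unfolding n_def v_def E_def cd
    by (rule card_chained_cells[OF X w(1) w1]) (use M m in \<open>auto simp: n_def v_def\<close>)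
  also have "\<dots> = n\<^sup>2 * ((64 * 384\<^sup>2) * v ^ (2 * p + 4) * (c1 * c2 * c3 / (c4 * c5)) * real (card E))"
  proof -
    have "v ^ (2 * p + 4) = v ^ p * v ^ p * (v\<^sup>2 * v\<^sup>2)"
      unfolding power_add[symmetric] by (rule arg_cong[where f = "power v"]) simp
    then show ?thesis using cp by (simp add: field_simps power2_eq_square)
  qed
  finally have "n\<^sup>2 * n\<^sup>2 \<le> n\<^sup>2 * ((64 * 384\<^sup>2) * v ^ (2 * p + 4) * (q * c) * real (card E))"
    unfolding q by (simp add: power2_eq_square power4_eq_xxxx mult.assoc)
  then have n2: "n\<^sup>2 \<le> (64 * 384\<^sup>2) * v ^ (2 * p + 4) * (q * c) * real (card E)"
    using n0 by (subst (asm) mult_le_cancel_left_pos) auto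
  obtain z0 where z0: "z0 \<in> X" "real (card E) \<le> c * real (card {e \<in> E. cell (w ^ i) (w ^ j) (snd e) = cell (w ^ i) (w ^ j) z0})"
    using heavy_class[OF fE X, of snd "cell (w ^ i) (w ^ j)"] ES unfolding c_def cov_def by force
  define J where "J = close_pairs X w i j z0 (2 * p)"
  have "{e \<in> E. cell (w ^ i) (w ^ j) (snd e) = cell (w ^ i) (w ^ j) z0}
      \<subseteq> flag_incidences (vicinity X (w ^ i) (w ^ j) z0) (fibre X (cell (w ^ i) (w ^ j)) z0) (9 * (w ^ i * w ^ j * w ^ (2 * p)))"
  proof
    fix e assume e: "e \<in> {e \<in> E. cell (w ^ i) (w ^ j) (snd e) = cell (w ^ i) (w ^ j) z0}"
    obtain y z where yz: "e = (y, z)" by (cases e)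
    have E: "(y, z) \<in> chained X (cell (w ^ (i + 2 * p)) (w ^ j)) (cell (w ^ (i + p)) (w ^ (j + p))) (cell (w ^ i) (w ^ (j + 2 * p)))"
      and cz: "cell (w ^ i) (w ^ j) z = cell (w ^ i) (w ^ j) z0" using e yz unfolding E_def by auto
    have yzX: "y \<in> X" "z \<in> X" using E unfolding chained_def by auto
    note d = chained_dev[OF w(1) w1 E]
    note c = cell_eqD[OF cz pos pos]
    have 1: "\<bar>fx y - fx z0\<bar> \<le> 4 * w ^ i" "\<bar>fa y - fa z0\<bar> \<le> 4 * w ^ j" using d c by linarith+
    have "\<bar>dev y z0\<bar> \<le> 9 * (w ^ i * w ^ j * w ^ (2 * p)) + 2 * (w ^ i * w ^ j) + w ^ j * (3 * w ^ i)"
      by (rule dev_triangle[of y z]) (use d c in simp_all)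
    moreover have "w ^ i * w ^ j * w ^ (2 * p) \<le> w ^ i * w ^ j * 1"
      using w w1 by (intro mult_left_mono power_le_one) auto
    moreover have "0 < w ^ i * w ^ j" using pos by simp
    moreover have "w ^ j * (3 * w ^ i) = 3 * (w ^ i * w ^ j)" by simp
    ultimately have "\<bar>dev y z0\<bar> \<le> 20 * (w ^ i * w ^ j)" by linarith
    then show "e \<in> flag_incidences (vicinity X (w ^ i) (w ^ j) z0) (fibre X (cell (w ^ i) (w ^ j)) z0) (9 * (w ^ i * w ^ j * w ^ (2 * p)))"
      unfolding yz flag_incidences_def vicinity_def fibre_def using 1 d(1) yzX cz by simp
  qed
  moreover have "finite (flag_incidences (vicinity X (w ^ i) (w ^ j) z0) (fibre X (cell (w ^ i) (w ^ j)) z0) (9 * (w ^ i * w ^ j * w ^ (2 * p))))"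
    by (rule finite_subset[of _ "X \<times> X"]) (use X in \<open>auto simp: flag_incidences_def vicinity_def fibre_def\<close>)
  ultimately have "real (card {e \<in> E. cell (w ^ i) (w ^ j) (snd e) = cell (w ^ i) (w ^ j) z0}) \<le> J"
    unfolding J_def close_pairs_def of_nat_le_iff by (rule card_mono[rotated])
  then have EJ: "real (card E) \<le> c * J" using z0(2) cp(6) by (meson less_imp_le mult_left_mono order_trans)
  have J0: "0 \<le> J" unfolding J_def close_pairs_def by simp
  have "n\<^sup>2 \<le> v * v ^ (2 * p + 4) * (q * c) * (c * J)"
    using w(2) v0 q0 cp(6) EJ J0
    by (intro order_trans[OF n2] mult_mono mult_nonneg_nonneg) (auto simp: v_def[symmetric] less_imp_le)
  also have "\<dots> = (v ^ (2 * p + 5) * q * J) * c\<^sup>2"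
  proof -
    have "v ^ (2 * p + 5) = v * v ^ (2 * p + 4)" by (simp add: eval_nat_numeral)
    then show ?thesis by (simp only: power2_eq_square ac_simps)
  qed
  finally have "(n / c)\<^sup>2 \<le> v ^ (2 * p + 5) * q * J"
    using cp(6) by (simp add: power_divide pos_divide_le_eq)
  then show ?thesis using z0(1) unfolding n_def c_def v_def q_def J_def by blast
qed

text \<open>The 26 in \<open>S\<close> balances the squared error. With v = 1 / w its losses are v
  for 10 ^ 15, v^8 from the four regular cell sizes, v ^ (t + 1) from the width and v^2 for the
  harmonic factor, together v ^ (t + 12). Since 3 t + 26 = (t + 12) + 2 (t + 7), what remains is the
  square of w ^ (t + 7).\<close>

lemma close_pairs_step:
  assumes X: "finite X" "X \<noteq> {}" and reg: "regular X w m" and w: "0 < w" "10 ^ 15 \<le> 1 / w" "real m + 3 \<le> 1 / w" and m: "i + j + t \<le> m"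
    and z0: "z0 \<in> X" and t: "1 \<le> t"
    and S: "(1 / w) ^ (3 * t + 26) * (cross_ratio X w i j p)\<^sup>2 * (cov X w i j)\<^sup>2 \<le> cov X w (i + t) j * cov X w i (j + t)"
  shows "w / 2 * close_pairs X w i j z0 t \<le> close_pairs X w i j z0 (Suc t)
    + 7 * ((real (card X) / cov X w i j)\<^sup>2 * w ^ (t + 7) / cross_ratio X w i j p)"
proof -
  define v where "v = 1 / w"
  define n where "n = real (card X)"
  have n0: "0 < n" unfolding n_def using X by (simp add: card_gt_0_iff)
  have v: "10 ^ 15 \<le> v" "real m + 3 \<le> v" unfolding v_def using w by simp_all
  have v2: "2 \<le> v" using v(1) by simp
  have v0: "0 < v" unfolding v_def using w by simp
  have wv: "w * v = 1" unfolding v_def using w by simp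
  have w1: "w \<le> 1/2" using w by (simp add: pos_le_divide_eq)
  have pos: "0 < w ^ k" for k using w by simp
  have c0: "0 < cov X w i j" for i j using cov_ge1[OF X, of w i j] by linarith
  have M: "real (card (fibre X (cell (w ^ i) (w ^ j)) u)) \<le> v\<^sup>2 * n / cov X w i j" if "u \<in> X" "i + j \<le> m" for u i j
    using reg that unfolding regular_def v_def n_def by blast
  define c where "c = cov X w i j"
  define cP where "cP = cov X w (i + t) j"
  define cL where "cL = cov X w i (j + t)"
  have cp: "0 < c" "0 < cP" "0 < cL" unfolding c_def cP_def cL_def using c0 by simp_all
  define q where "q = cross_ratio X w i j p"
  have q0: "0 < q" unfolding q_def by (rule cross_ratio_pos[OF X])
  have vt: "v \<le> v ^ t" using self_le_power[of v t] v t by simp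
  define N where "N = nat \<lceil>2 / (9 * w ^ t)\<rceil>"
  have Neq: "2 / (9 * w ^ t) = 2 / 9 * v ^ t" unfolding v_def using w by (simp add: field_simps)
  have N1: "2 / (9 * w ^ t) \<le> real N" unfolding N_def by linarith
  have "real N \<le> 2 / 9 * v ^ t + 1"
  proof -
    have "0 \<le> \<lceil>2 / (9 * w ^ t)\<rceil>" using pos[of t] by (simp add: less_le_trans[of "-1" 0])
    then have "real N = of_int \<lceil>2 / (9 * w ^ t)\<rceil>" unfolding N_def by (rule of_nat_nat)
    then show ?thesis unfolding Neq by linarith
  qed
  moreover have "v ^ t * 2 \<le> v ^ t * v" using v v0 by (intro mult_left_mono) auto
  ultimately have "real (Suc N) \<le> v ^ t * v" using vt v2 unfolding of_nat_Suc by linarith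
  then have N2: "real (Suc N) \<le> v ^ Suc t" by (simp add: mult.commute)
  have "harm (Suc N) \<le> 1 + ln (real (Suc N))" by (rule harm_le_ln) simp
  also have "ln (real (Suc N)) \<le> ln (v ^ Suc t)" using N2 v0 by (subst ln_le_cancel_iff) (auto simp del: power_Suc)
  also have "ln (v ^ Suc t) = real (Suc t) * ln v" using v0 by (simp add: ln_realpow del: power_Suc)
  \<comment> \<open>The crude bound of ln v by v is enough: with m + 3 \<le> v the harmonic factor
    stays below v^2.\<close>
  also have "\<dots> \<le> real (Suc m) * v" using m v ln_le_minus_one[OF v0] by (intro mult_mono) auto
  finally have "1 + harm (Suc N) \<le> 2 + real (Suc m) * v" by simp
  also have "\<dots> \<le> (real m + 3) * v" using v by (simp add: algebra_simps)
  also have "\<dots> \<le> v * v" using v v0 by (intro mult_right_mono) auto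
  finally have H: "1 + harm (Suc N) \<le> v\<^sup>2" by (simp add: power2_eq_square)
  have H0: "0 \<le> 1 + (harm (Suc N) :: real)" using harm_nonneg[of "Suc N", where ?'a = real] by linarith
  have step: "w / 2 * close_pairs X w i j z0 t \<le> close_pairs X w i j z0 (Suc t) +
      7 * sqrt (10 ^ 15 * (v\<^sup>2 * n / c)\<^sup>2 * (v\<^sup>2 * n / cP) * (v\<^sup>2 * n / cL) / (w * w ^ t) * (1 + harm (Suc N)))"
    unfolding close_pairs_def power_Suc
    by (rule flag_incidence_step[OF X(1) z0 pos pos pos _ w(1) w1 _ _ _ N1])
      (use M m w w1 in \<open>auto simp: c_def cP_def cL_def power_add[symmetric] power_le_one\<close>)
  have "10 ^ 15 * (v\<^sup>2 * n / c)\<^sup>2 * (v\<^sup>2 * n / cP) * (v\<^sup>2 * n / cL) / (w * w ^ t) * (1 + harm (Suc N))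
      \<le> ((n / c)\<^sup>2 * w ^ (t + 7) / q)\<^sup>2" (is "?A \<le> ?B")
  proof -
    have i: "1 / (w * w ^ t) = v ^ (t + 1)" unfolding v_def by (simp add: power_one_over)
    have r: "n\<^sup>2 / (cP * cL) \<le> (n / c)\<^sup>2 * w ^ (3 * t + 26) / q\<^sup>2"
    proof -
      define b where "b = v ^ (3 * t + 26) * q\<^sup>2 * c\<^sup>2"
      have b: "0 < b" "b \<le> cP * cL" unfolding b_def using S v0 q0 cp unfolding v_def q_def c_def cP_def cL_def by auto
      have "n\<^sup>2 / (cP * cL) \<le> n\<^sup>2 / b" using b n0 cp by (intro divide_left_mono) auto
      also have "\<dots> = (n / c)\<^sup>2 * w ^ (3 * t + 26) / q\<^sup>2" unfolding b_def v_def using w q0 cp by (simp add: field_simps)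
      finally show ?thesis .
    qed
    have "?A = 10 ^ 15 * (n / c)\<^sup>2 * (v ^ 8 * v ^ (t + 1)) * (n\<^sup>2 / (cP * cL)) * (1 + harm (Suc N))"
      unfolding i[symmetric] using cp w by (simp add: field_simps power2_eq_square eval_nat_numeral)
    also have "\<dots> \<le> v * (n / c)\<^sup>2 * (v ^ 8 * v ^ (t + 1)) * ((n / c)\<^sup>2 * w ^ (3 * t + 26) / q\<^sup>2) * v\<^sup>2"
      using v v0 r H H0 cp w q0 n0 by (intro mult_mono mult_nonneg_nonneg) (auto simp: less_imp_le)
    also have "\<dots> = ((n / c)\<^sup>2)\<^sup>2 / q\<^sup>2 * (v * v ^ 8 * v ^ (t + 1) * v ^ 2 * w ^ (3 * t + 26))"
    proof -
      have "v * x * (a8 * a1) * (x * wt / qq) * v2 = x\<^sup>2 / qq * (v * a8 * a1 * v2 * wt)" for x a8 a1 wt qq v2 :: real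
        by (simp add: power2_eq_square)
      then show ?thesis .
    qed
    also have "v * v ^ 8 * v ^ (t + 1) * v ^ 2 * w ^ (3 * t + 26) = (w ^ (t + 7))\<^sup>2"
    proof -
      have "3 * t + 26 = (t + 12) + (t + 7) * 2" by simp
      moreover have "v * v ^ 8 * v ^ (t + 1) * v ^ 2 = v ^ (t + 12)"
      proof -
        have "v * v ^ 8 * v ^ (t + 1) * v ^ 2 = v ^ (1 + 8 + (t + 1) + 2)" by (simp only: power_add power_one_right)
        then show ?thesis by (simp add: add.commute)
      qed
      moreover have "v ^ (t + 12) * w ^ (t + 12) = 1" using wv by (simp add: power_mult_distrib[symmetric] mult.commute)
      ultimately show ?thesis by (simp only: power_add[of w "t + 12"] mult.assoc[symmetric] power_mult[symmetric] mult_1_left)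
    qed
    also have "((n / c)\<^sup>2)\<^sup>2 / q\<^sup>2 * (w ^ (t + 7))\<^sup>2 = ?B" by (simp only: power_mult_distrib power_divide times_divide_eq_left)
    finally show ?thesis .
  qed
  then have "sqrt (10 ^ 15 * (v\<^sup>2 * n / c)\<^sup>2 * (v\<^sup>2 * n / cP) * (v\<^sup>2 * n / cL) / (w * w ^ t) * (1 + harm (Suc N)))
      \<le> (n / c)\<^sup>2 * w ^ (t + 7) / q"
    using pos[of "t + 7"] q0 by (intro real_le_lsqrt) (auto simp: less_imp_le)
  then show ?thesis using step unfolding n_def c_def q_def by linarith
qed

subsection \<open>Separated sets of flags\<close>

text \<open>Each step should multiply the count by w. Half is lost to w / 2 in the high-low step and
  another half to its error term, which is at most half of the main term because 7 w 4 ^ (t + 1)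
  \<le> 1. This gives the factor 4 ^ t. The range extends to \<open>Suc m\<close>, one scale below
  the separation.\<close>

lemma close_pairs_descent:
  assumes X: "finite X" "X \<noteq> {}" and reg: "regular X w m" and w: "0 < w" "10 ^ 15 * 4 ^ (m + 1) \<le> 1 / w"
    and z0: "z0 \<in> X" and p: "1 \<le> p"
    and start: "(real (card X) / cov X w i j)\<^sup>2 \<le> (1 / w) ^ (2 * p + 5) * cross_ratio X w i j p * close_pairs X w i j z0 (2 * p)"
    and S: "\<And>t. 2 * p \<le> t \<Longrightarrow> i + j + t \<le> m \<Longrightarrow>
       (1 / w) ^ (3 * t + 26) * (cross_ratio X w i j p)\<^sup>2 * (cov X w i j)\<^sup>2 \<le> cov X w (i + t) j * cov X w i (j + t)"
    and t: "2 * p \<le> t" "i + j + t \<le> Suc m"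
  shows "(real (card X) / cov X w i j)\<^sup>2 * w ^ (t + 5) \<le> 4 ^ t * cross_ratio X w i j p * close_pairs X w i j z0 t"
  using t
proof (induction t rule: dec_induct)
  case base
  define A where "A = cross_ratio X w i j p * close_pairs X w i j z0 (2 * p)"
  have A: "0 \<le> A" unfolding A_def close_pairs_def using cross_ratio_pos[OF X, of w i j p] by simp
  have "(real (card X) / cov X w i j)\<^sup>2 * w ^ (2 * p + 5) \<le> ((1 / w) ^ (2 * p + 5) * A) * w ^ (2 * p + 5)"
    using start w unfolding A_def by (intro mult_right_mono) (simp_all add: mult.assoc)
  also have "\<dots> = A" using w by (simp add: power_one_over)
  also have "\<dots> \<le> 4 ^ (2 * p) * A" using A by (simp add: mult_le_cancel_right1)
  finally show ?case unfolding A_def by (simp add: mult.assoc)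
next
  case (step t)
  define q where "q = cross_ratio X w i j p"
  define N2 where "N2 = (real (card X) / cov X w i j)\<^sup>2"
  define J where "J = close_pairs X w i j z0 t"
  define J' where "J' = close_pairs X w i j z0 (Suc t)"
  have q: "0 < q" unfolding q_def by (rule cross_ratio_pos[OF X])
  have N2: "0 \<le> N2" unfolding N2_def by simp
  have tm: "i + j + t \<le> m" using step.prems by simp
  have t1: "1 \<le> t" using step.hyps p by simp
  have four: "(1::real) \<le> 4 ^ (m + 1)" "real m + 3 \<le> 10 ^ 15 * 4 ^ (m + 1)"
  proof -
    show "(1::real) \<le> 4 ^ (m + 1)" by (rule one_le_power) simp
    have "real (m + 1) < 2 ^ (m + 1)" by (rule of_nat_less_two_power)
    also have "(2::real) ^ (m + 1) \<le> 4 ^ (m + 1)" by (rule power_mono) simp_all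
    finally have "real m + 1 \<le> 4 ^ (m + 1)" by simp
    then show "real m + 3 \<le> 10 ^ 15 * 4 ^ (m + 1)" by simp
  qed
  have ih: "N2 * w ^ (t + 5) \<le> 4 ^ t * q * J" using step.IH tm unfolding N2_def q_def J_def by simp
  have w': "10 ^ 15 \<le> 1 / w" using w four by simp
  have w'': "real m + 3 \<le> 1 / w" using w four by linarith
  have st: "w / 2 * J \<le> J' + 7 * (N2 * w ^ (t + 7) / q)"
    unfolding N2_def q_def J_def J'_def
    by (rule close_pairs_step[OF X reg w(1) w' w'' tm z0 t1 S[OF step.hyps(1) tm]])
  have "7 * w * 4 ^ (t + 1) \<le> 7 * w * 4 ^ (m + 1)" using tm w by (intro mult_left_mono power_increasing) auto
  also have "\<dots> \<le> 1"
  proof -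
    have "7 * 4 ^ (m + 1) \<le> 1 / w" using w four by simp
    then have "w * (7 * 4 ^ (m + 1)) \<le> w * (1 / w)" using w by (intro mult_left_mono) auto
    then show ?thesis using w by simp
  qed
  finally have sm: "7 * w * 4 ^ (t + 1) \<le> 1" .
  have "2 * (N2 * w ^ (t + 6)) = 2 * w * (N2 * w ^ (t + 5))" by (simp add: power_add eval_nat_numeral)
  also have "\<dots> \<le> 2 * w * (4 ^ t * q * J)" using ih w by (intro mult_left_mono) auto
  also have "\<dots> = 4 ^ (t + 1) * q * (w / 2 * J)" by simp
  also have "\<dots> \<le> 4 ^ (t + 1) * q * (J' + 7 * (N2 * w ^ (t + 7) / q))" using st q by (intro mult_left_mono) auto
  also have "\<dots> = 4 ^ (t + 1) * q * J' + (7 * w * 4 ^ (t + 1)) * (N2 * w ^ (t + 6))"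
    using q by (simp add: power_add eval_nat_numeral field_simps)
  also have "\<dots> \<le> 4 ^ (t + 1) * q * J' + 1 * (N2 * w ^ (t + 6))"
    using sm N2 w by (intro add_left_mono mult_right_mono) auto
  finally have fin: "N2 * w ^ (t + 6) \<le> 4 ^ (t + 1) * q * J'" by linarith
  have e: "Suc t + 5 = t + 6" by simp
  show ?case using fin unfolding N2_def q_def J'_def by (simp only: e Suc_eq_plus1[symmetric])
qed

text \<open>At the last index the threshold is 9 w ^ (m + 1), and 9 w \<le> 1 puts it below the
  separation w ^ m; so only pairs (z, z) are left.\<close>

lemma close_pairs_terminal:
  assumes X: "finite X" and reg: "regular X w m" and w: "0 < w" "w \<le> 1/9" and sep: "separated (w ^ m) X"
    and ij: "i + j \<le> m" and z0: "z0 \<in> X"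
  shows "close_pairs X w i j z0 (Suc m - (i + j)) \<le> (1 / w)\<^sup>2 * (real (card X) / cov X w i j)"
proof -
  define L where "L = fibre X (cell (w ^ i) (w ^ j)) z0"
  have LX: "L \<subseteq> X" "finite L" unfolding L_def fibre_def using X by auto
  have e: "9 * (w ^ i * w ^ j * w ^ (Suc m - (i + j))) \<le> w ^ m"
  proof -
    have "w ^ i * w ^ j * w ^ (Suc m - (i + j)) = w * w ^ m" using ij by (simp add: power_add[symmetric] power_Suc[symmetric] del: power_Suc)
    then show ?thesis using w mult_right_mono[of "9 * w" 1 "w ^ m"] by simp
  qed
  have "flag_incidences (vicinity X (w ^ i) (w ^ j) z0) L (9 * (w ^ i * w ^ j * w ^ (Suc m - (i + j)))) \<subseteq> (\<lambda>z. (z, z)) ` L"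
  proof
    fix a assume "a \<in> flag_incidences (vicinity X (w ^ i) (w ^ j) z0) L (9 * (w ^ i * w ^ j * w ^ (Suc m - (i + j))))"
    then obtain y z where a: "a = (y, z)" "y \<in> X" "z \<in> L" "\<bar>dev y z\<bar> \<le> w ^ m"
      unfolding flag_incidences_def vicinity_def using e by auto
    then have "y = z" using sep LX unfolding separated_def by (meson not_less subsetD)
    then show "a \<in> (\<lambda>z. (z, z)) ` L" using a by simp
  qed
  then have "close_pairs X w i j z0 (Suc m - (i + j)) \<le> real (card ((\<lambda>z. (z, z)) ` L))"
    unfolding close_pairs_def L_def[symmetric] of_nat_le_iff using LX by (intro card_mono) auto
  also have "\<dots> \<le> real (card L)" using LX by (simp add: card_image_le)
  also have "\<dots> \<le> (1 / w)\<^sup>2 * real (card X) / cov X w i j" using reg ij z0 unfolding regular_def L_def by blast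
  finally show ?thesis by simp
qed

text \<open>Let N be the average number of flags per cell (i, j). About N^2 w ^ t / q pairs should
  survive to t = m + 1 - (i + j), but at most (1 / w)^2 N do, so N is at most (1 / w) ^ (t + 7)
  times 4 ^ t q. The factor 4 ^ t is below 1 / w, and \<open>cross_ratio_le\<close> supplies the 12
  p.\<close>

lemma regular_card_le:
  assumes X: "finite X" "X \<noteq> {}" and reg: "regular X w m" and w: "0 < w" "10 ^ 15 * 4 ^ (m + 1) \<le> 1 / w"
    and sep: "separated (w ^ m) X" and p: "1 \<le> p" and m: "i + j + 3 * p \<le> m"
    and S: "\<And>t. 2 * p \<le> t \<Longrightarrow> i + j + t \<le> m \<Longrightarrow>
       (1 / w) ^ (3 * t + 26) * (cross_ratio X w i j p)\<^sup>2 * (cov X w i j)\<^sup>2 \<le> cov X w (i + t) j * cov X w i (j + t)"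
  shows "real (card X) \<le> (1 / w) ^ (m + 9 + 12 * p) * cov X w i j"
proof -
  define v where "v = 1 / w"
  have four: "(1::real) \<le> 4 ^ (m + 1)" by (rule one_le_power) simp
  have v: "10 ^ 15 \<le> v" unfolding v_def using w four by simp
  have v4: "4 ^ (m + 1) \<le> v" unfolding v_def using w four by simp
  have w128: "w \<le> 1/128" using v w unfolding v_def by (simp add: field_simps)
  have v1: "1 \<le> v" using v by simp
  have wv: "w * v = 1" unfolding v_def using w by simp
  define c where "c = cov X w i j"
  have c: "0 < c" unfolding c_def using cov_ge1[OF X, of w i j] by linarith
  define q where "q = cross_ratio X w i j p"
  have q: "0 < q" "q \<le> v ^ (12 * p)" unfolding q_def v_def
    by (rule cross_ratio_pos[OF X]) (rule cross_ratio_le[OF X w(1) w128])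
  define N where "N = real (card X) / c"
  have N: "0 < N" unfolding N_def using X c by (simp add: card_gt_0_iff)
  have "64 * 384\<^sup>2 \<le> 1 / w" using v unfolding v_def by simp
  from close_pairs_start[OF X reg w(1) this m] obtain z0 where z0: "z0 \<in> X"
    and start: "(real (card X) / cov X w i j)\<^sup>2 \<le> (1 / w) ^ (2 * p + 5) * cross_ratio X w i j p * close_pairs X w i j z0 (2 * p)" by blast
  define t where "t = Suc m - (i + j)"
  have ij: "i + j \<le> m" using m by simp
  have "N\<^sup>2 * w ^ (t + 5) \<le> 4 ^ t * q * close_pairs X w i j z0 t"
    unfolding N_def c_def q_def
    by (rule close_pairs_descent[OF X reg w z0 p start S]) (use m p in \<open>auto simp: t_def\<close>)
  also have "\<dots> \<le> 4 ^ t * q * (v\<^sup>2 * N)"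
    using close_pairs_terminal[OF X(1) reg w(1) _ sep ij z0] w128 q unfolding t_def v_def N_def c_def by (intro mult_left_mono) auto
  finally have "v ^ (t + 5) * (N\<^sup>2 * w ^ (t + 5)) \<le> v ^ (t + 5) * (4 ^ t * q * (v\<^sup>2 * N))" using v1 by (intro mult_left_mono) auto
  also have "v ^ (t + 5) * (N\<^sup>2 * w ^ (t + 5)) = N * N"
  proof -
    have "w ^ (t + 5) * v ^ (t + 5) = 1" using wv by (simp add: power_mult_distrib[symmetric] del: power_add)
    moreover have "v ^ (t + 5) * (N\<^sup>2 * w ^ (t + 5)) = N\<^sup>2 * (w ^ (t + 5) * v ^ (t + 5))" by (simp only: ac_simps)
    ultimately show ?thesis by (simp add: power2_eq_square)
  qed
  also have "v ^ (t + 5) * (4 ^ t * q * (v\<^sup>2 * N)) = N * (4 ^ t * q * v ^ (t + 7))"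
    by (simp add: power_add eval_nat_numeral)
  finally have "N \<le> 4 ^ t * q * v ^ (t + 7)" using N by simp
  also have "\<dots> \<le> v * v ^ (12 * p) * v ^ (m + 8)"
  proof (intro mult_mono)
    have "(4::real) ^ t \<le> 4 ^ (m + 1)" unfolding t_def by (intro power_increasing) auto
    then show "(4::real) ^ t \<le> v" using v4 by linarith
    show "v ^ (t + 7) \<le> v ^ (m + 8)" unfolding t_def using v1 by (intro power_increasing) auto
  qed (use v1 q in auto)
  also have "\<dots> = v ^ (1 + 12 * p + (m + 8))" by (simp only: power_add power_one_right)
  also have "1 + 12 * p + (m + 8) = m + 9 + 12 * p" by simp
  finally have "N \<le> v ^ (m + 9 + 12 * p)" .
  then show ?thesis unfolding N_def using c by (simp add: pos_divide_le_eq v_def c_def)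
qed

text \<open>\<open>separated_card_le\<close> gives fewer than (1 / w) ^ (2 m + 1) flags, since 37
  exceeds its constant 36. So 2 m + 1 levels in base 1 / w suffice, and by \<open>K\<close> the
  selection costs only a factor 1 / w.\<close>

lemma exists_regular_subset:
  assumes X: "finite X" "X \<noteq> {}" "X \<subseteq> unit_flags" and w: "0 < w" "w \<le> 1/37"
    and K: "real ((2 * m + 1) ^ card {(i, j). i + j \<le> m}) \<le> 1 / w"
    and sep: "separated (w ^ m) X"
  shows "\<exists>Y\<subseteq>X. Y \<noteq> {} \<and> real (card X) \<le> 1 / w * real (card Y) \<and> regular Y w m"
proof -
  define v where "v = 1 / w"
  have v: "37 \<le> v" unfolding v_def using w by (simp add: field_simps)
  define K where "K = {(i::nat, j). i + j \<le> m}"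
  have fK: "finite K" unfolding K_def by (rule finite_subset[of _ "{..m} \<times> {..m}"]) auto
  define R where "R = real ((2 * m + 1) ^ card K)"
  have R: "0 \<le> R" "R \<le> v" using K unfolding R_def K_def v_def by auto
  have "real (card X) \<le> 36 / (w ^ m)\<^sup>2"
    by (rule separated_card_le[OF X(1,3) sep]) (use w in \<open>auto intro: power_le_one\<close>)
  also have "\<dots> = 36 * v ^ (2 * m)" unfolding v_def by (simp add: power_one_over power_mult[symmetric] mult.commute)
  also have "\<dots> < v * v ^ (2 * m)" using v by (intro mult_strict_right_mono) auto
  finally have card: "real (card X) < v ^ (2 * m + 1)" by simp
  have "1 < v" using v by simp
  from regular_subset[OF X(1,2) fK this card, of "\<lambda>(i, j). cell (w ^ i) (w ^ j)"]
  obtain Y where Y: "Y \<subseteq> X" "Y \<noteq> {}" "card X \<le> (2 * m + 1) ^ card K * card Y"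
    and M: "\<And>k. k \<in> K \<Longrightarrow> \<exists>M. (\<forall>u\<in>Y. real (card (fibre Y ((\<lambda>(i, j). cell (w ^ i) (w ^ j)) k) u)) \<le> M) \<and>
        M * real (card ((\<lambda>(i, j). cell (w ^ i) (w ^ j)) k ` Y)) \<le> v * R * real (card Y)"
    unfolding R_def by blast
  have fY: "finite Y" using Y X finite_subset by blast
  have "real (card X) \<le> R * real (card Y)" using Y(3) unfolding R_def by (simp only: of_nat_mult[symmetric] of_nat_le_iff)
  also have "\<dots> \<le> v * real (card Y)" using R by (intro mult_right_mono) auto
  finally have XY: "real (card X) \<le> v * real (card Y)" .
  have "regular Y w m" unfolding regular_def
  proof (intro allI impI ballI)
    fix i j u assume ij: "i + j \<le> m" and u: "u \<in> Y"
    have c: "0 < cov Y w i j" using cov_ge1[OF fY Y(2), of w i j] by linarith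
    have "(i, j) \<in> K" using ij unfolding K_def by simp
    from M[OF this] obtain M where MM: "\<And>u. u \<in> Y \<Longrightarrow> real (card (fibre Y (cell (w ^ i) (w ^ j)) u)) \<le> M"
      "M * cov Y w i j \<le> v * R * real (card Y)" unfolding cov_def by auto
    have "v * R * real (card Y) \<le> v * v * real (card Y)" using R v by (intro mult_right_mono mult_left_mono) auto
    then have "M \<le> v\<^sup>2 * real (card Y) / cov Y w i j" using MM(2) c by (simp add: pos_le_divide_eq power2_eq_square)
    then show "real (card (fibre Y (cell (w ^ i) (w ^ j)) u)) \<le> (1 / w)\<^sup>2 * real (card Y) / cov Y w i j"
      using MM(1)[OF u] unfolding v_def by linarith
  qed
  then show ?thesis using Y XY unfolding v_def by blast
qed

lemma log_cov_bounds:
  assumes X: "finite X" "X \<noteq> {}" "X \<subseteq> unit_flags" and w: "0 < w" "w \<le> 1/160"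
  shows "step_lipschitz m (\<lambda>i j. log (1 / w) (cov X w i j))" "log (1 / w) (cov X w 0 0) \<le> 1"
proof -
  define v where "v = 1 / w"
  have v: "160 \<le> v" unfolding v_def using w by (simp add: field_simps)
  then have v1: "1 < v" by simp
  have c0: "0 < cov X w i j" for i j using cov_ge1[OF X(1,2), of w i j] by linarith
  have w128: "w \<le> 1/128" using w by simp
  note st = cov_steps[OF X(1) w(1) w128, folded v_def]
  have l: "log v a \<le> log v b + 3" if "a \<le> b * v ^ 3" "0 < a" "0 < b" for a b
  proof -
    have "log v a \<le> log v (b * v ^ 3)" using that v1 by (subst log_le_cancel_iff) auto
    also have "\<dots> = log v b + 3" using that v1 by (simp add: log_mult_pos log_nat_power)
    finally show ?thesis .
  qed
  have "\<bar>log v (cov X w (Suc i) j) - log v (cov X w i j)\<bar> \<le> 3 \<and> \<bar>log v (cov X w i (Suc j)) - log v (cov X w i j)\<bar> \<le> 3" for i j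
    using l[OF st(1) c0 c0, of i j] l[OF st(2) c0 c0, of i j] l[OF st(3) c0 c0, of i j] l[OF st(4) c0 c0, of i j]
    unfolding abs_le_iff by linarith
  then show "step_lipschitz m (\<lambda>i j. log (1 / w) (cov X w i j))" unfolding step_lipschitz_def v_def by blast
  obtain u0 where u0: "u0 \<in> X" using X by blast
  \<comment> \<open>The count of cells of unit size is 4 * 4 * 10 = 160, the origin of the bound on
    w.\<close>
  have "cov X w 0 0 \<le> (2 * 1 + 2) * (2 * 1 + 2) * (2 * (3 + 1) + 2)"
    unfolding cov_def
  proof (rule card_cells_near(1))
    fix u assume u: "u \<in> X"
    have "\<bar>dev u0 u\<bar> \<le> 3" using u u0 X(3) by (intro dev_unit_flags_le) auto
    moreover have "u \<in> unit_flags" "u0 \<in> unit_flags" using u u0 X(3) by auto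
    then have "\<bar>fx u - fx u0\<bar> \<le> 1" "\<bar>fa u - fa u0\<bar> \<le> 1" unfolding unit_flags_def abs_le_iff by auto
    ultimately show "near (w ^ 0) (w ^ 0) 1 1 3 u0 u" unfolding near_def by simp
  qed auto
  also have "\<dots> \<le> v" using v by simp
  finally have "log v (cov X w 0 0) \<le> log v v" using c0 v1 by (subst log_le_cancel_iff) auto
  moreover have "log v v = 1" using v1 by simp
  ultimately show "log (1 / w) (cov X w 0 0) \<le> 1" unfolding v_def by simp
qed

text \<open>Two bounds on the number of flags collide: density asks for (1 / w) ^ (s m), while the
  selected cell allows only (1 / w) ^ m up to factors with small multiples of m in the
  exponent.\<close>

lemma no_dense_separated_flags:
  fixes s :: real
  assumes s: "3/2 < s"
  shows "\<exists>\<delta>0>0. \<forall>\<delta> X. 0 < \<delta> \<longrightarrow> \<delta> \<le> \<delta>0 \<longrightarrow> finite X \<longrightarrow> X \<noteq> {} \<longrightarrow> X \<subseteq> unit_flags \<longrightarrow> separated \<delta> X \<longrightarrow>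
    (\<forall>\<alpha> \<beta> u. 0 < \<alpha> \<longrightarrow> \<alpha> \<le> 1 \<longrightarrow> 0 < \<beta> \<longrightarrow> \<beta> \<le> 1 \<longrightarrow> \<delta> \<le> \<alpha> * \<beta> \<longrightarrow> u \<in> X \<longrightarrow>
       real (card (fibre X (cell \<alpha> \<beta>) u)) \<le> 2 * real (card X) * (\<alpha> * \<beta>) powr s) \<longrightarrow>
    real (card X) * \<delta> powr s < 1"
proof -
  obtain m0 where m0: "\<And>m G. m0 \<le> m \<Longrightarrow> step_lipschitz m G \<Longrightarrow> G 0 0 \<le> 1 \<Longrightarrow>
      (\<And>i j. i + j \<le> m \<Longrightarrow> s * real (i + j) - 2 \<le> G i j) \<Longrightarrow>
      \<exists>i j p. 1 \<le> p \<and> 40 * (i + j) \<le> m \<and> 80 * p \<le> m \<and>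
        (\<forall>t. 2 * p \<le> t \<and> i + j + t \<le> m \<longrightarrow> 3 * real t + 2 * defect G i j p + 26 \<le> axes G i j t)"
    using selection[OF s, of 26] by metis
  \<comment> \<open>In the final comparison \<open>G i j\<close> contributes at most 3 m / 40 + 1
    and the cross ratio 12 m / 80. The exponent 1.225 m + 11 is below 1.5 m exactly when m >
    40.\<close>
  define m where "m = max m0 41"
  have m: "m0 \<le> m" "41 \<le> m" unfolding m_def by simp_all
  define B where "B = max (10 ^ 15 * 4 ^ (m + 1)) (real ((2 * m + 1) ^ card {(i::nat, j). i + j \<le> m}))"
  have four: "(1::real) \<le> 4 ^ (m + 1)" by (rule one_le_power) simp
  have B1: "10 ^ 15 * 4 ^ (m + 1) \<le> B" unfolding B_def by (rule max.cobounded1)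
  have B2: "real ((2 * m + 1) ^ card {(i::nat, j). i + j \<le> m}) \<le> B" unfolding B_def by (rule max.cobounded2)
  have B160: "160 \<le> B" using B1 four by simp
  have Bpos: "0 < (1 / B) ^ m" using B160 by simp
  have main: False
    if \<delta>: "0 < \<delta>" "\<delta> \<le> (1 / B) ^ m" and X: "finite X" "X \<noteq> {}" "X \<subseteq> unit_flags" and sep: "separated \<delta> X"
      and ext: "\<And>\<alpha> \<beta> u. 0 < \<alpha> \<Longrightarrow> \<alpha> \<le> 1 \<Longrightarrow> 0 < \<beta> \<Longrightarrow> \<beta> \<le> 1 \<Longrightarrow> \<delta> \<le> \<alpha> * \<beta> \<Longrightarrow> u \<in> X \<Longrightarrow>
       real (card (fibre X (cell \<alpha> \<beta>) u)) \<le> 2 * real (card X) * (\<alpha> * \<beta>) powr s"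
      and dense: "1 \<le> real (card X) * \<delta> powr s" for \<delta> X
  proof -
    define w where "w = root m \<delta>"
    have mp: "0 < m" using m by simp
    have w0: "0 < w" unfolding w_def using mp \<delta> by simp
    have wm: "w ^ m = \<delta>" unfolding w_def using mp \<delta> by simp
    have "w \<le> root m ((1 / B) ^ m)" unfolding w_def using mp \<delta> by simp
    also have "\<dots> = 1 / B" using mp B160 by (intro real_root_power_cancel) auto
    finally have wB: "w \<le> 1 / B" .
    define v where "v = 1 / w"
    have vB: "B \<le> v" unfolding v_def using wB w0 B160 by (simp add: field_simps)
    have v: "160 \<le> v" "1 < v" using vB B160 by simp_all
    have w160: "w \<le> 1/160" using v(1) w0 unfolding v_def by (simp add: field_simps)
    have wle: "w \<le> 1/37" "w \<le> 1/128" "w \<le> 1" using w160 by simp_all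
    have K: "real ((2 * m + 1) ^ card {(i::nat, j). i + j \<le> m}) \<le> 1 / w" using B2 vB unfolding v_def by linarith
    have w15: "10 ^ 15 * 4 ^ (m + 1) \<le> 1 / w" using B1 vB unfolding v_def by linarith
    have sepw: "separated (w ^ m) X" using sep wm by simp
    obtain Y where Y: "Y \<subseteq> X" "Y \<noteq> {}" "real (card X) \<le> v * real (card Y)" and reg: "regular Y w m"
      using exists_regular_subset[OF X w0 wle(1) K sepw] unfolding v_def by blast
    have fY: "finite Y" using Y X finite_subset by blast
    have Yu: "Y \<subseteq> unit_flags" using Y X by blast
    have sepY: "separated (w ^ m) Y" using sepw Y unfolding separated_def by blast
    have nY: "0 < real (card Y)" using fY Y by (simp add: card_gt_0_iff)
    define G where "G = (\<lambda>i j. log v (cov Y w i j))"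
    have c0: "0 < cov Y w i j" for i j using cov_ge1[OF fY Y(2), of w i j] by linarith
    have cG: "cov Y w i j = v powr G i j" for i j unfolding G_def using c0 v by simp
    have G1: "step_lipschitz m G" "G 0 0 \<le> 1"
      using log_cov_bounds[OF fY Y(2) Yu w0 w160] unfolding G_def v_def by auto
    have wpowr: "w ^ k = v powr (- real k)" for k
    proof -
      have "v powr (- real k) = inverse (v ^ k)" using v by (simp add: powr_minus powr_realpow)
      also have "\<dots> = w ^ k" unfolding v_def by (simp add: power_one_over)
      finally show ?thesis by simp
    qed
    \<comment> \<open>Few flags per cell mean many cells. The loss 2 covers the passage from X to Y
      and the factor 2 in \<open>ext\<close>, each at most a factor v.\<close>
    have G2: "s * real (i + j) - 2 \<le> G i j" if ij: "i + j \<le> m" for i j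
    proof -
      define M where "M = 2 * real (card X) * v powr (- (s * real (i + j)))"
      have "real (card (fibre Y (cell (w ^ i) (w ^ j)) u)) \<le> M" if u: "u \<in> Y" for u
      proof -
        have "card (fibre Y (cell (w ^ i) (w ^ j)) u) \<le> card (fibre X (cell (w ^ i) (w ^ j)) u)"
          using X Y unfolding fibre_def by (intro card_mono) auto
        also have "real (card (fibre X (cell (w ^ i) (w ^ j)) u)) \<le> 2 * real (card X) * (w ^ i * w ^ j) powr s"
        proof (rule ext)
          have "w ^ m \<le> w ^ (i + j)" using ij w0 wle by (intro power_decreasing) auto
          then show "\<delta> \<le> w ^ i * w ^ j" unfolding wm power_add .
        qed (use u Y w0 wle in \<open>auto intro: power_le_one\<close>)
        also have "(w ^ i * w ^ j) powr s = v powr (- (s * real (i + j)))"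
        proof -
          have "w ^ i * w ^ j = v powr (- real (i + j))" using wpowr[of "i + j"] by (simp only: power_add)
          then have "(w ^ i * w ^ j) powr s = (v powr (- real (i + j))) powr s" by (rule arg_cong)
          also have "\<dots> = v powr (- real (i + j) * s)" by (rule powr_powr)
          also have "- real (i + j) * s = - (s * real (i + j))" by (simp only: mult_minus_left mult.commute)
          finally show ?thesis .
        qed
        finally show ?thesis unfolding M_def by simp
      qed
      then have "real (card Y) \<le> cov Y w i j * M" unfolding cov_def
        using fY by (intro card_le_image_mult) (auto simp: fibre_def)
      also have "\<dots> \<le> cov Y w i j * (2 * (v * real (card Y)) * v powr (- (s * real (i + j))))"
        unfolding M_def using Y(3) c0 v by (intro mult_left_mono mult_right_mono) (auto simp: less_imp_le)
      finally have "real (card Y) * 1 \<le> real (card Y) * (cov Y w i j * (2 * v) * v powr (- (s * real (i + j))))" by (simp add: mult_ac)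
      then have "1 \<le> cov Y w i j * (2 * v) * v powr (- (s * real (i + j)))" using nY by (subst (asm) mult_le_cancel_left_pos)
      also have "\<dots> \<le> cov Y w i j * (v * v) * v powr (- (s * real (i + j)))"
        using v c0[of i j] by (intro mult_right_mono mult_left_mono) auto
      also have "v * v = v powr 2" using v by (simp add: power2_eq_square)
      also have "cov Y w i j * v powr 2 * v powr (- (s * real (i + j))) = v powr (G i j + 2 - s * real (i + j))"
        unfolding cG powr_add[symmetric] by simp
      finally have "v powr 0 \<le> v powr (G i j + 2 - s * real (i + j))" using v by simp
      then show ?thesis using v by (simp only: powr_le_cancel_iff)
    qed
    from m0[OF m(1) G1 G2] obtain i j p where p: "1 \<le> p" "40 * (i + j) \<le> m" "80 * p \<le> m"
      and sel: "\<And>t. 2 * p \<le> t \<Longrightarrow> i + j + t \<le> m \<Longrightarrow> 3 * real t + 2 * defect G i j p + 26 \<le> axes G i j t" by blast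
    have cr: "cross_ratio Y w i j p = v powr (defect G i j p)"
      unfolding cross_ratio_def cG defect_def powr_add[symmetric] powr_diff[symmetric] by (simp add: algebra_simps)
    have "real (card Y) \<le> (1 / w) ^ (m + 9 + 12 * p) * cov Y w i j"
    proof (rule regular_card_le[OF fY Y(2) reg w0 w15 sepY p(1)])
      show "i + j + 3 * p \<le> m" using p by simp
      fix t assume t: "2 * p \<le> t" "i + j + t \<le> m"
      have "v ^ (3 * t + 26) * (cross_ratio Y w i j p)\<^sup>2 * (cov Y w i j)\<^sup>2
          = v powr (3 * real t + 26 + 2 * defect G i j p + 2 * G i j)"
      proof -
        have "v ^ (3 * t + 26) = v powr (3 * real t + 26)" using v powr_realpow[of v "3 * t + 26"] by simp
        moreover have "(v powr a)\<^sup>2 = v powr (2 * a)" for a by (simp add: power2_eq_square powr_add[symmetric])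
        ultimately show ?thesis unfolding cr cG by (simp only: powr_add)
      qed
      also have "\<dots> \<le> v powr (G (i + t) j + G i (j + t))"
        using sel[OF t] v unfolding axes_def by (intro powr_mono) auto
      also have "\<dots> = cov Y w (i + t) j * cov Y w i (j + t)" unfolding cG powr_add ..
      finally show "(1 / w) ^ (3 * t + 26) * (cross_ratio Y w i j p)\<^sup>2 * (cov Y w i j)\<^sup>2 \<le> cov Y w (i + t) j * cov Y w i (j + t)"
        unfolding v_def .
    qed
    also have "\<dots> = v powr (real (m + 9 + 12 * p) + G i j)"
      using v unfolding v_def[symmetric] cG powr_add by (simp add: powr_realpow del: of_nat_add)
    finally have Yle: "real (card Y) \<le> v powr (real (m + 9 + 12 * p) + G i j)" .
    \<comment> \<open>The count in \<open>regular_card_le\<close> is relative to the cells at (i,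
      j); the Lipschitz path from (0, 0) bounds their number, and i + j \<le> m / 40 keeps it
      small.\<close>
    have "cov Y w (0 + i) j \<le> cov Y w 0 j * v ^ (3 * i)" unfolding v_def by (rule cov_steps_iterated(1)[OF fY w0 wle(2)])
    also have "\<dots> \<le> (cov Y w 0 0 * v ^ (3 * j)) * v ^ (3 * i)"
      using cov_steps_iterated(2)[OF fY w0 wle(2), of 0 0 j] v unfolding v_def[symmetric] by (intro mult_right_mono) auto
    also have "\<dots> = v powr (G 0 0 + 3 * real j + 3 * real i)"
      using v powr_realpow[of v "3 * i"] powr_realpow[of v "3 * j"] unfolding cG powr_add by simp
    finally have "v powr G i j \<le> v powr (G 0 0 + 3 * real j + 3 * real i)" unfolding cG by simp
    then have Gij: "G i j \<le> G 0 0 + 3 * real j + 3 * real i" using v by (simp only: powr_le_cancel_iff)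
    have "1 \<le> real (card X) * v powr (- (real m * s))"
      using dense unfolding wm[symmetric] wpowr powr_powr by simp
    also have "\<dots> \<le> (v * v powr (real (m + 9 + 12 * p) + G i j)) * v powr (- (real m * s))"
      using Y(3) Yle v by (intro mult_right_mono order_trans[OF Y(3)] mult_left_mono) auto
    also have "\<dots> = v powr 1 * v powr (real (m + 9 + 12 * p) + G i j) * v powr (- (real m * s))" using v by simp
    also have "\<dots> = v powr (1 + (real (m + 9 + 12 * p) + G i j) + - (real m * s))" by (simp only: powr_add)
    finally have "v powr 0 \<le> v powr (1 + (real (m + 9 + 12 * p) + G i j) + - (real m * s))" using v by simp
    then have "0 \<le> 1 + (real (m + 9 + 12 * p) + G i j) + - (real m * s)" using v by (simp only: powr_le_cancel_iff)
    moreover have "real m * (3/2) \<le> real m * s" using s by (intro mult_left_mono) auto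
    moreover have "real (40 * (i + j)) \<le> real m" "real (80 * p) \<le> real m" "real 41 \<le> real m"
      using p m unfolding of_nat_le_iff by blast+
    then have "40 * (real i + real j) \<le> real m \<and> 80 * real p \<le> real m \<and> 41 \<le> real m" by simp
    moreover have "real (m + 9 + 12 * p) = real m + 9 + 12 * real p" by simp
    ultimately show False using Gij G1(2) by argo
  qed
  show ?thesis
  proof (intro exI[of _ "(1 / B) ^ m"] conjI allI impI)
    fix \<delta> X
    assume *: "0 < \<delta>" "\<delta> \<le> (1 / B) ^ m" "finite X" "X \<noteq> {}" "X \<subseteq> unit_flags" "separated \<delta> X"
      "\<forall>\<alpha> \<beta> u. 0 < \<alpha> \<longrightarrow> \<alpha> \<le> 1 \<longrightarrow> 0 < \<beta> \<longrightarrow> \<beta> \<le> 1 \<longrightarrow> \<delta> \<le> \<alpha> * \<beta> \<longrightarrow> u \<in> X \<longrightarrow>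
       real (card (fibre X (cell \<alpha> \<beta>) u)) \<le> 2 * real (card X) * (\<alpha> * \<beta>) powr s"
    show "real (card X) * \<delta> powr s < 1"
      using main[OF *(1-6)] *(7) by (meson not_less)
  qed (rule Bpos)
qed

section \<open>Minimal counterexamples\<close>

lemma separated_mono: "separated \<delta> X \<Longrightarrow> \<delta>' \<le> \<delta> \<Longrightarrow> X' \<subseteq> X \<Longrightarrow> separated \<delta>' X'"
  unfolding separated_def by (meson le_less_trans subsetD)

lemma powr_root_cancel:
  fixes n s :: real
  assumes "0 < n" "0 < s"
  shows "(n powr (- (1 / s))) powr s = inverse n"
proof -
  have "- (1 / s) * s = - 1" using assms by simp
  then have "(n powr (- (1 / s))) powr s = n powr (- 1)" by (simp only: powr_powr)
  then show ?thesis using assms by (simp add: powr_minus)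
qed

lemma powr_root_scale:
  fixes n s C :: real
  assumes "0 < n" "0 < s" "0 \<le> C"
  shows "n * (C * n powr (- (1 / s))) powr s = C powr s"
proof -
  have "(C * n powr (- (1 / s))) powr s = C powr s * inverse n"
    using assms by (subst powr_mult) (simp_all only: powr_root_cancel powr_ge_zero)
  then show ?thesis using assms by simp
qed

text \<open>A crowded cell, rescaled to unit size, would be a smaller counterexample: its separation
  grows to \<delta> / (\<alpha> \<beta>), which must fall short of C n' powr (- (1 / s)) for its n'
  flags.\<close>

lemma fibre_card_le_of_minimal:
  fixes s C :: real
  assumes s: "0 < s" and C: "1 \<le> C" and X: "finite X" "X \<subseteq> unit_flags" and u: "u \<in> X"
    and sep: "separated (C * real (card X) powr (- (1 / s))) X"
    and IH: "\<And>Z. finite Z \<Longrightarrow> Z \<subseteq> unit_flags \<Longrightarrow> 2 \<le> card Z \<Longrightarrow> card Z < card X \<Longrightarrow>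
        \<not> separated (C * real (card Z) powr (- (1 / s))) Z"
    and \<alpha>: "0 < \<alpha>" "\<alpha> \<le> 1" and \<beta>: "0 < \<beta>" "\<beta> \<le> 1" and le: "C * real (card X) powr (- (1 / s)) \<le> \<alpha> * \<beta>"
  shows "real (card (fibre X (cell \<alpha> \<beta>) u)) \<le> 2 * real (card X) * (\<alpha> * \<beta>) powr s"
proof -
  define n where "n = real (card X)"
  define \<delta> where "\<delta> = C * n powr (- (1 / s))"
  have n: "0 < n" unfolding n_def using X u by (auto simp: card_gt_0_iff)
  have \<delta>: "0 < \<delta>" unfolding \<delta>_def using C n by simp
  have ab: "0 < \<alpha> * \<beta>" using \<alpha> \<beta> by simp
  have \<delta>s: "n * \<delta> powr s = C powr s"
    unfolding \<delta>_def using C n s by (intro powr_root_scale) auto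
  have one: "1 \<le> n * (\<alpha> * \<beta>) powr s"
  proof -
    have "1 \<le> n * \<delta> powr s" unfolding \<delta>s using C s by (simp add: ge_one_powr_ge_zero)
    also have "\<dots> \<le> n * (\<alpha> * \<beta>) powr s"
      using le \<delta> n s unfolding \<delta>_def n_def by (intro mult_left_mono powr_mono2) auto
    finally show ?thesis .
  qed
  define F where "F = fibre X (cell \<alpha> \<beta>) u"
  have F: "u \<in> F" "F \<subseteq> X" "finite F" unfolding F_def fibre_def using u X by auto
  \<comment> \<open>The cell may contain all of X, so one flag is removed to make the set strictly
    smaller. As n (\<alpha> \<beta>) powr s \<ge> 1, the factor 2 in the conclusion pays for
    it.\<close>
  define F' where "F' = F - {u}"
  have F': "F' \<subseteq> F" "F' \<subseteq> X" "finite F'" unfolding F'_def using F by auto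
  have SF: "card F = Suc (card F')" unfolding F'_def using F by (simp only: card_Suc_Diff1)
  have cF: "card F \<le> card X" using F X by (simp add: card_mono)
  have "real (card F') \<le> n * (\<alpha> * \<beta>) powr s"
  proof (cases "2 \<le> card F'")
    case False
    then have "real (card F') \<le> 1" by simp
    then show ?thesis using one by linarith
  next
    case True
    define n' where "n' = real (card F')"
    have n': "0 < n'" unfolding n'_def using True by simp
    obtain \<phi> where \<phi>: "inj_on \<phi> F" "\<phi> ` F \<subseteq> unit_flags" "\<And>v v'. dev (\<phi> v) (\<phi> v') = dev v v' / (\<alpha> * \<beta>)"
      using rescale_fibre[OF X(2) \<alpha> \<beta>, of u] unfolding F_def by blast
    have c: "card (\<phi> ` F') = card F'" by (rule card_image[OF inj_on_subset[OF \<phi>(1) F'(1)]])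
    have sep': "separated (\<delta> / (\<alpha> * \<beta>)) (\<phi> ` F')"
      unfolding separated_def
    proof (intro ballI impI)
      fix a b assume ab': "a \<in> \<phi> ` F'" "b \<in> \<phi> ` F'" "a \<noteq> b"
      then obtain v v' where v: "v \<in> F'" "v' \<in> F'" "a = \<phi> v" "b = \<phi> v'" "v \<noteq> v'" by blast
      have "\<delta> < \<bar>dev v v'\<bar>" using sep v F' unfolding separated_def \<delta>_def n_def by blast
      then show "\<delta> / (\<alpha> * \<beta>) < \<bar>dev a b\<bar>" unfolding v \<phi>(3) using ab by (simp add: abs_divide divide_strict_right_mono)
    qed
    have "\<not> separated (C * n' powr (- (1 / s))) (\<phi> ` F')"
      using IH[of "\<phi> ` F'"] \<phi>(2) F' c True cF SF unfolding n'_def by auto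
    then have "\<delta> / (\<alpha> * \<beta>) < C * n' powr (- (1 / s))" using separated_mono[OF sep'] by (meson not_less subset_refl)
    then have "C * n powr (- (1 / s)) < C * (n' powr (- (1 / s)) * (\<alpha> * \<beta>))"
      unfolding \<delta>_def using ab by (simp add: pos_divide_less_eq mult.assoc)
    then have "n powr (- (1 / s)) < n' powr (- (1 / s)) * (\<alpha> * \<beta>)" using C by simp
    then have "(n powr (- (1 / s))) powr s < (n' powr (- (1 / s)) * (\<alpha> * \<beta>)) powr s"
      using s by (intro powr_less_mono2) auto
    then have "inverse n < inverse n' * (\<alpha> * \<beta>) powr s"
      using n n' s ab by (simp add: powr_mult powr_root_cancel)
    then have "n' < n * (\<alpha> * \<beta>) powr s" using n n' by (simp add: field_simps)
    then show ?thesis unfolding n'_def by simp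
  qed
  then have "real (card F) \<le> 2 * n * (\<alpha> * \<beta>) powr s" using SF one by simp
  then show ?thesis unfolding F_def n_def .
qed

theorem flags_not_separated:
  fixes s :: real
  assumes s: "3/2 < s"
  shows "\<exists>C>0. \<forall>X. finite X \<longrightarrow> X \<subseteq> unit_flags \<longrightarrow> 2 \<le> card X \<longrightarrow>
    \<not> separated (C * real (card X) powr (- (1 / s))) X"
proof -
  obtain \<delta>1 where \<delta>1: "0 < \<delta>1" and core: "\<And>\<delta> X. 0 < \<delta> \<Longrightarrow> \<delta> \<le> \<delta>1 \<Longrightarrow> finite X \<Longrightarrow> X \<noteq> {} \<Longrightarrow> X \<subseteq> unit_flags \<Longrightarrow> separated \<delta> X \<Longrightarrow>
    (\<And>\<alpha> \<beta> u. 0 < \<alpha> \<Longrightarrow> \<alpha> \<le> 1 \<Longrightarrow> 0 < \<beta> \<Longrightarrow> \<beta> \<le> 1 \<Longrightarrow> \<delta> \<le> \<alpha> * \<beta> \<Longrightarrow> u \<in> X \<Longrightarrow>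
       real (card (fibre X (cell \<alpha> \<beta>) u)) \<le> 2 * real (card X) * (\<alpha> * \<beta>) powr s) \<Longrightarrow>
    real (card X) * \<delta> powr s < 1"
    using no_dense_separated_flags[OF s] by metis
  define \<delta>0 where "\<delta>0 = min \<delta>1 1"
  have \<delta>0: "0 < \<delta>0" "\<delta>0 \<le> 1" "\<delta>0 \<le> \<delta>1" unfolding \<delta>0_def using \<delta>1 by auto
  define n0 where "n0 = 36 / \<delta>0\<^sup>2"
  have "\<delta>0\<^sup>2 \<le> 1" using \<delta>0 by (simp add: power_le_one)
  then have n0: "1 \<le> n0" unfolding n0_def using \<delta>0 by (simp add: pos_le_divide_eq)
  \<comment> \<open>If \<delta> exceeded \<delta>0, packing would give n \<le> n0 and hence \<delta>
    \<ge> 4, while \<open>dev\<close> never exceeds 3 on unit flags; this brings \<delta> into the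
    range of \<open>core\<close>.\<close>
  define C where "C = 4 * n0 powr (1 / s)"
  have C: "4 \<le> C" unfolding C_def using n0 s by (simp add: ge_one_powr_ge_zero)
  have "\<not> separated (C * real (card X) powr (- (1 / s))) X"
    if "finite X" "X \<subseteq> unit_flags" "2 \<le> card X" for X
    using that
  proof (induction "card X" arbitrary: X rule: less_induct)
    case less
    show ?case
    proof
      define n where "n = real (card X)"
      define \<delta> where "\<delta> = C * n powr (- (1 / s))"
      assume "separated (C * real (card X) powr (- (1 / s))) X"
      then have sep: "separated \<delta> X" unfolding \<delta>_def n_def .
      have n: "0 < n" unfolding n_def using less.prems by simp
      have \<delta>: "0 < \<delta>" unfolding \<delta>_def using C n by simp
      have X0: "X \<noteq> {}" using less.prems by auto
      have "\<delta> \<le> \<delta>0"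
      proof (rule ccontr)
        assume "\<not> \<delta> \<le> \<delta>0"
        then have "separated \<delta>0 X" using separated_mono[OF sep] by simp
        then have "n \<le> n0" unfolding n_def n0_def using less.prems \<delta>0 by (intro separated_card_le) auto
        then have "n0 powr (- (1 / s)) \<le> n powr (- (1 / s))" using n s by (intro powr_mono2') auto
        then have "C * n0 powr (- (1 / s)) \<le> \<delta>" unfolding \<delta>_def using C by (intro mult_left_mono) auto
        moreover have "C * n0 powr (- (1 / s)) = 4" unfolding C_def using n0 by (simp add: powr_minus)
        ultimately have "4 \<le> \<delta>" by simp
        obtain T where T: "T \<subseteq> X" "card T = 2" using ex_card[OF less.prems(3)] by blast
        obtain u v where "u \<in> X" "v \<in> X" "u \<noteq> v" using T unfolding card_2_iff by blast
        then have "\<delta> < \<bar>dev u v\<bar>" "\<bar>dev u v\<bar> \<le> 3"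
          using sep less.prems dev_unit_flags_le[of u v] unfolding separated_def by auto
        with \<open>4 \<le> \<delta>\<close> show False by linarith
      qed
      then have "n * \<delta> powr s < 1" unfolding n_def
      proof (intro core[OF \<delta> _ less.prems(1) X0 less.prems(2) sep])
        fix \<alpha> \<beta> :: real and u
        assume *: "0 < \<alpha>" "\<alpha> \<le> 1" "0 < \<beta>" "\<beta> \<le> 1" "\<delta> \<le> \<alpha> * \<beta>" "u \<in> X"
        show "real (card (fibre X (cell \<alpha> \<beta>) u)) \<le> 2 * real (card X) * (\<alpha> * \<beta>) powr s"
          by (rule fibre_card_le_of_minimal[of s C])
            (use * s C less.prems less.hyps sep in \<open>auto simp: \<delta>_def n_def\<close>)
      qed (use \<delta>0 in simp)
      moreover have "n * \<delta> powr s = C powr s"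
        unfolding \<delta>_def using C n s by (intro powr_root_scale) auto
      moreover have "1 \<le> C powr s" using C s by (simp add: ge_one_powr_ge_zero)
      ultimately show False by simp
    qed
  qed
  then show ?thesis using C by (intro exI[of _ C]) auto
qed

subsection \<open>Small triangles\<close>

text \<open>Two points of equal colour are removed as long as more than K points remain.
  Disjointness later makes the flags distinct and the triangles have three different
  vertices.\<close>

lemma disjoint_pairs:
  assumes "finite P" "card (f ` P) \<le> K"
  shows "\<exists>S \<subseteq> P \<times> P. (\<forall>e\<in>S. fst e \<noteq> snd e \<and> f (fst e) = f (snd e)) \<and>
    (\<forall>e\<in>S. \<forall>e'\<in>S. e \<noteq> e' \<longrightarrow> {fst e, snd e} \<inter> {fst e', snd e'} = {}) \<and> card P \<le> K + 2 * card S"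
  using assms
proof (induction "card P" arbitrary: P rule: less_induct)
  case less
  show ?case
  proof (cases "card P \<le> K")
    case True
    then show ?thesis by (intro exI[of _ "{}"]) auto
  next
    case False
    then have "\<not> inj_on f P" using less.prems by (intro pigeonhole) simp
    then obtain p q where pq: "p \<in> P" "q \<in> P" "p \<noteq> q" "f p = f q" unfolding inj_on_def by blast
    define P' where "P' = P - {p, q}"
    have P': "P' \<subseteq> P" "finite P'" "p \<notin> P'" "q \<notin> P'" unfolding P'_def using less.prems by auto
    have "card P' = card P - card {p, q}" unfolding P'_def using pq less.prems by (intro card_Diff_subset) auto
    moreover have "card {p, q} = 2" using pq by simp
    moreover have "card {p, q} \<le> card P" using pq less.prems by (intro card_mono) auto
    ultimately have c: "card P = card P' + 2" by simp
    have im: "card (f ` P') \<le> K" using less.prems P' by (meson card_mono finite_imageI image_mono order_trans)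
    have "card P' < card P" using c by simp
    from less.hyps[OF this P'(2) im]
    obtain S where S: "S \<subseteq> P' \<times> P'" "\<forall>e\<in>S. fst e \<noteq> snd e \<and> f (fst e) = f (snd e)"
      "\<forall>e\<in>S. \<forall>e'\<in>S. e \<noteq> e' \<longrightarrow> {fst e, snd e} \<inter> {fst e', snd e'} = {}" "card P' \<le> K + 2 * card S" by blast
    have fS: "finite S" using S(1) P' finite_subset by blast
    have nS: "(p, q) \<notin> S" using S(1) P' by auto
    show ?thesis
    proof (intro exI[of _ "insert (p, q) S"] conjI)
      show "insert (p, q) S \<subseteq> P \<times> P" using S(1) P' pq by auto
      show "\<forall>e\<in>insert (p, q) S. fst e \<noteq> snd e \<and> f (fst e) = f (snd e)" using S(2) pq by auto
      show "card P \<le> K + 2 * card (insert (p, q) S)" using S(4) c fS nS by simp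
      have n: "{p, q} \<inter> {fst e, snd e} = {}" if "e \<in> S" for e using that S(1) P' by auto
      show "\<forall>e\<in>insert (p, q) S. \<forall>e'\<in>insert (p, q) S. e \<noteq> e' \<longrightarrow> {fst e, snd e} \<inter> {fst e', snd e'} = {}"
      proof (intro ballI impI)
        fix e e' assume "e \<in> insert (p, q) S" "e' \<in> insert (p, q) S" "e \<noteq> e'"
        then consider "e = (p, q)" "e' \<in> S" | "e \<in> S" "e' = (p, q)" | "e \<in> S" "e' \<in> S" "e \<noteq> e'" by blast
        then show "{fst e, snd e} \<inter> {fst e', snd e'} = {}"
        proof cases
          case 1
          show ?thesis using n[OF 1(2)] 1(1) by simp
        next
          case 2
          show ?thesis using n[OF 2(1)] 2(2) by (simp add: Int_commute)
        next
          case 3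
          then show ?thesis using S(3) by blast
        qed
      qed
    qed
  qed
qed

lemma triangle_area_eq:
  "triangle_area a b c = \<bar>(c $ 1 - a $ 1) * (b $ 2 - a $ 2) - (b $ 1 - a $ 1) * (c $ 2 - a $ 2)\<bar> / 2"
proof -
  have "compact (convex hull {a, b, c})" by (intro compact_convex_hull finite_imp_compact) simp
  then have "measure lebesgue (convex hull {a, b, c}) = measure lborel (convex hull {a, b, c})"
    by (intro measure_completion) (simp add: borel_compact)
  then show ?thesis unfolding triangle_area_def by (simp add: content_triangle)
qed

text \<open>\<open>i\<close> indexes the abscissa and \<open>j\<close> the ordinate; exchanging them
  makes steep pairs flat, so slopes of absolute value at most 1 suffice.\<close>

definition slope :: "2 \<Rightarrow> 2 \<Rightarrow> (real ^ 2) \<times> (real ^ 2) \<Rightarrow> real" where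
  "slope i j e = (snd e $ j - fst e $ j) / (snd e $ i - fst e $ i)"

text \<open>Slope and intercept are normalised affinely so that the flag lands in \<^const>\<open>unit_flags\<close>; this halves \<^const>\<open>dev\<close>.\<close>

definition pair_flag :: "2 \<Rightarrow> 2 \<Rightarrow> (real ^ 2) \<times> (real ^ 2) \<Rightarrow> flag" where
  "pair_flag i j e = (fst e $ i, (slope i j e + 1) / 2, (fst e $ j - slope i j e * fst e $ i + 1) / 2)"

lemma dev_pair_flag:
  "dev (pair_flag i j e) (pair_flag i j e') = (fst e $ j - fst e' $ j - slope i j e' * (fst e $ i - fst e' $ i)) / 2"
  unfolding dev_def pair_flag_def by (simp add: field_simps)

text \<open>The area is half the extent of the second pair along axis \<open>i\<close> times the
  distance, measured along axis \<open>j\<close>, from the first point to its line; the half is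
  already contained in \<open>dev\<close>.\<close>

lemma triangle_area_pair:
  assumes "(i, j) = (1, 2) \<or> (i, j) = (2, 1)" "fst e' $ i \<noteq> snd e' $ i"
  shows "triangle_area (fst e) (fst e') (snd e') = \<bar>snd e' $ i - fst e' $ i\<bar> * \<bar>dev (pair_flag i j e) (pair_flag i j e')\<bar>"
proof -
  have sl: "(snd e' $ i - fst e' $ i) * slope i j e' = snd e' $ j - fst e' $ j"
    unfolding slope_def using assms(2) by simp
  have "(snd e' $ i - fst e' $ i) * dev (pair_flag i j e) (pair_flag i j e')
      = ((snd e' $ i - fst e' $ i) * (fst e $ j - fst e' $ j) - (snd e' $ j - fst e' $ j) * (fst e $ i - fst e' $ i)) / 2"
    unfolding dev_pair_flag sl[symmetric] by (simp add: algebra_simps)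
  then have *: "\<bar>snd e' $ i - fst e' $ i\<bar> * \<bar>dev (pair_flag i j e) (pair_flag i j e')\<bar>
      = \<bar>(snd e' $ i - fst e' $ i) * (fst e $ j - fst e' $ j) - (snd e' $ j - fst e' $ j) * (fst e $ i - fst e' $ i)\<bar> / 2"
    by (simp add: abs_mult[symmetric])
  show ?thesis using assms(1)
  proof
    assume "(i, j) = (1, 2)"
    then show ?thesis unfolding * triangle_area_eq by (simp add: algebra_simps abs_minus_commute)
  next
    assume "(i, j) = (2, 1)"
    then show ?thesis unfolding * triangle_area_eq by (simp add: algebra_simps abs_minus_commute)
  qed
qed

lemma pair_flag_unit:
  assumes "fst e \<in> unit_square" and le: "\<bar>snd e $ j - fst e $ j\<bar> \<le> \<bar>snd e $ i - fst e $ i\<bar>"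
  shows "pair_flag i j e \<in> unit_flags"
proof -
  have s: "\<bar>slope i j e\<bar> \<le> 1" unfolding slope_def using le by (simp add: abs_divide divide_le_eq_1)
  have u: "0 \<le> fst e $ i" "fst e $ i \<le> 1" "0 \<le> fst e $ j" "fst e $ j \<le> 1" using assms(1) unfolding unit_square_def by auto
  have "\<bar>slope i j e * fst e $ i\<bar> \<le> 1 * 1" unfolding abs_mult using s u by (intro mult_mono) auto
  then show ?thesis unfolding unit_flags_def pair_flag_def using u s by (simp add: abs_le_iff)
qed

lemma small_triangle_of_pairs:
  assumes ij: "(i, j) = (1, 2) \<or> (i, j) = (2, 1)" and S: "finite S" "\<And>e. e \<in> S \<Longrightarrow> fst e \<in> unit_square"
    and ne: "\<And>e. e \<in> S \<Longrightarrow> fst e \<noteq> snd e"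
    and disj: "\<And>e e'. e \<in> S \<Longrightarrow> e' \<in> S \<Longrightarrow> e \<noteq> e' \<Longrightarrow> {fst e, snd e} \<inter> {fst e', snd e'} = {}"
    and le: "\<And>e. e \<in> S \<Longrightarrow> \<bar>snd e $ j - fst e $ j\<bar> \<le> \<bar>snd e $ i - fst e $ i\<bar>"
    and h: "\<And>e. e \<in> S \<Longrightarrow> \<bar>snd e $ i - fst e $ i\<bar> \<le> h"
    and C: "\<And>X. finite X \<Longrightarrow> X \<subseteq> unit_flags \<Longrightarrow> card X = card S \<Longrightarrow> \<not> separated \<rho> X"
  shows "\<exists>e\<in>S. \<exists>e'\<in>S. e \<noteq> e' \<and> triangle_area (fst e) (fst e') (snd e') \<le> h * \<rho>"
proof -
  \<comment> \<open>A flag determines the first point of its pair, and disjoint pairs have different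
    first points.\<close>
  have inj: "inj_on (pair_flag i j) S"
  proof (rule inj_onI, rule ccontr)
    fix e e' assume e: "e \<in> S" "e' \<in> S" "pair_flag i j e = pair_flag i j e'" "e \<noteq> e'"
    then have "fst e $ i = fst e' $ i" "fst e $ j = fst e' $ j" unfolding pair_flag_def by auto
    then have "fst e = fst e'" using ij by (auto simp: vec_eq_iff forall_2)
    then show False using disj[OF e(1,2,4)] by auto
  qed
  have "\<not> separated \<rho> (pair_flag i j ` S)"
  proof (rule C)
    show "pair_flag i j ` S \<subseteq> unit_flags" using pair_flag_unit[OF S(2) le] by auto
    show "card (pair_flag i j ` S) = card S" by (rule card_image[OF inj])
  qed (use S in simp)
  then obtain e e' where e: "e \<in> S" "e' \<in> S" "e \<noteq> e'" "\<bar>dev (pair_flag i j e) (pair_flag i j e')\<bar> \<le> \<rho>"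
    unfolding separated_def by (auto simp: not_less)
  have "fst e' $ i \<noteq> snd e' $ i"
  proof
    assume "fst e' $ i = snd e' $ i"
    then have "fst e' = snd e'" using le[OF e(2)] ij by (auto simp: vec_eq_iff forall_2)
    then show False using ne[OF e(2)] by simp
  qed
  from triangle_area_pair[OF ij this, of e]
  have "triangle_area (fst e) (fst e') (snd e') \<le> h * \<rho>"
    using h[OF e(2)] e(4) by (simp add: mult_mono order_trans[OF abs_ge_zero])
  then show ?thesis using e by blast
qed

text \<open>The closed square meets (k + 1)^2 cells of mesh 1 / k. Beyond N points, 4 l more give 2
  l disjoint pairs, and l of them are flat in the same order of the axes.\<close>

lemma small_triangle_of_grid:
  fixes P :: "(real ^ 2) set"
  assumes P: "finite P" "P \<subseteq> unit_square" and k: "0 < k" "(k + 1)\<^sup>2 \<le> N" "N + 4 * l \<le> card P" and l: "0 < l"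
    and C: "\<And>X. finite X \<Longrightarrow> X \<subseteq> unit_flags \<Longrightarrow> l \<le> card X \<Longrightarrow> \<not> separated \<rho> X"
  shows "\<exists>a\<in>P. \<exists>b\<in>P. \<exists>c\<in>P. a \<noteq> b \<and> a \<noteq> c \<and> b \<noteq> c \<and> triangle_area a b c \<le> \<rho> / real k"
proof -
  define f where "f = (\<lambda>p::real^2. (\<lfloor>p $ 1 / (1 / real k)\<rfloor>, \<lfloor>p $ 2 / (1 / real k)\<rfloor>))"
  have pos: "0 < 1 / real k" using k by simp
  have "f ` P \<subseteq> {0..int k} \<times> {0..int k}"
  proof
    fix t assume "t \<in> f ` P"
    then obtain p where p: "p \<in> P" "t = f p" by blast
    have u: "0 \<le> p $ i" "p $ i \<le> 1" for i using p P unfolding unit_square_def by auto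
    have "0 \<le> \<lfloor>p $ i / (1 / real k)\<rfloor> \<and> \<lfloor>p $ i / (1 / real k)\<rfloor> \<le> int k" for i
      using u[of i] k by (simp add: floor_le_iff mult_left_le_one_le le_less_trans[of _ "real k"])
    then show "t \<in> {0..int k} \<times> {0..int k}" unfolding p f_def by auto
  qed
  then have "card (f ` P) \<le> card ({0..int k} \<times> {0..int k})" by (intro card_mono) auto
  also have "\<dots> = (k + 1)\<^sup>2" by (simp add: card_cartesian_product power2_eq_square nat_add_distrib)
  finally have "card (f ` P) \<le> N" using k by simp
  from disjoint_pairs[OF P(1) this] obtain S where S: "S \<subseteq> P \<times> P"
    "\<And>e. e \<in> S \<Longrightarrow> fst e \<noteq> snd e \<and> f (fst e) = f (snd e)"
    "\<And>e e'. e \<in> S \<Longrightarrow> e' \<in> S \<Longrightarrow> e \<noteq> e' \<Longrightarrow> {fst e, snd e} \<inter> {fst e', snd e'} = {}" "card P \<le> N + 2 * card S" by blast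
  have fS: "finite S" using S(1) P finite_subset by blast
  have SP: "fst e \<in> P" "snd e \<in> P" if "e \<in> S" for e using that S(1) by auto
  have near: "\<bar>snd e $ 1 - fst e $ 1\<bar> \<le> 1 / real k \<and> \<bar>snd e $ 2 - fst e $ 2\<bar> \<le> 1 / real k" if "e \<in> S" for e
    using S(2)[OF that] floor_div_eq_imp[OF _ pos] unfolding f_def by (simp del: floor_divide_of_nat_eq)
  define S1 where "S1 = {e \<in> S. \<bar>snd e $ 2 - fst e $ 2\<bar> \<le> \<bar>snd e $ 1 - fst e $ 1\<bar>}"
  define S2 where "S2 = {e \<in> S. \<bar>snd e $ 1 - fst e $ 1\<bar> \<le> \<bar>snd e $ 2 - fst e $ 2\<bar>}"
  have "card S \<le> card (S1 \<union> S2)" unfolding S1_def S2_def using fS by (intro card_mono) auto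
  also have "\<dots> \<le> card S1 + card S2" by (rule card_Un_le)
  finally have "2 * l \<le> card S1 + card S2" using S(4) k by simp
  then have l12: "l \<le> card S1 \<or> l \<le> card S2" by linarith
  have fin: "\<exists>a\<in>P. \<exists>b\<in>P. \<exists>c\<in>P. a \<noteq> b \<and> a \<noteq> c \<and> b \<noteq> c \<and> triangle_area a b c \<le> \<rho> / real k"
    if ij: "(i, j) = (1, 2) \<or> (i, j) = (2, 1)" and T: "T \<subseteq> S" "l \<le> card T"
      and le: "\<And>e. e \<in> T \<Longrightarrow> \<bar>snd e $ j - fst e $ j\<bar> \<le> \<bar>snd e $ i - fst e $ i\<bar>" for i j T
  proof -
    have "\<exists>e\<in>T. \<exists>e'\<in>T. e \<noteq> e' \<and> triangle_area (fst e) (fst e') (snd e') \<le> 1 / real k * \<rho>"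
    proof (rule small_triangle_of_pairs[OF ij _ _ _ _ le])
      show "finite T" using T fS finite_subset by blast
      show "fst e \<in> unit_square" if "e \<in> T" for e using that T SP P by blast
      show "fst e \<noteq> snd e" if "e \<in> T" for e using that T S(2) by blast
      show "{fst e, snd e} \<inter> {fst e', snd e'} = {}" if "e \<in> T" "e' \<in> T" "e \<noteq> e'" for e e' using that T S(3) by blast
      show "\<bar>snd e $ i - fst e $ i\<bar> \<le> 1 / real k" if "e \<in> T" for e using near[of e] that T ij by auto
      show "\<not> separated \<rho> X" if "finite X" "X \<subseteq> unit_flags" "card X = card T" for X using C[of X] that T by simp
    qed
    then obtain e e' where e: "e \<in> T" "e' \<in> T" "e \<noteq> e'" "triangle_area (fst e) (fst e') (snd e') \<le> 1 / real k * \<rho>" by blast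
    have eS: "e \<in> S" "e' \<in> S" using e T by auto
    have "fst e \<noteq> fst e' \<and> fst e \<noteq> snd e' \<and> fst e' \<noteq> snd e'" using S(3)[OF eS e(3)] S(2)[OF eS(2)] by auto
    moreover have "triangle_area (fst e) (fst e') (snd e') \<le> \<rho> / real k" using e(4) by simp
    ultimately show ?thesis using SP[OF eS(1)] SP[OF eS(2)] by blast
  qed
  from l12 show ?thesis
  proof
    assume "l \<le> card S1"
    then show ?thesis by (intro fin[of 1 2 S1]) (auto simp: S1_def)
  next
    assume "l \<le> card S2"
    then show ?thesis by (intro fin[of 2 1 S2]) (auto simp: S2_def)
  qed
qed

theorem theorem1p1:
  "\<exists>n0::nat. \<forall>n\<ge>n0. \<forall>P :: (real ^ 2) set.
     finite P \<and> card P = n \<and> P \<subseteq> unit_square \<longrightarrow>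
     (\<exists>a\<in>P. \<exists>b\<in>P. \<exists>c\<in>P. a \<noteq> b \<and> a \<noteq> c \<and> b \<noteq> c \<and>
        triangle_area a b c \<le> real n powr (- 8 / 7 - 1 / 2000))"
proof -
  have s: "3/2 < (31/20 :: real)" by simp
  have exponent: "1 / (31/20) = (20/31 :: real)" by simp
  obtain C where C: "0 < C" and sep: "\<And>X. finite X \<Longrightarrow> X \<subseteq> unit_flags \<Longrightarrow> 2 \<le> card X \<Longrightarrow>
    \<not> separated (C * real (card X) powr (- (20/31))) X"
    using flags_not_separated[OF s] unfolding exponent by metis
  \<comment> \<open>The 4 comes from k \<ge> r / 4 and the power of 16 from l \<ge> n / 16; the
    margin \<epsilon> in the exponent absorbs D once n is at least D powr (1 / \<epsilon>).\<close>
  define D where "D = 4 * C * 16 powr (20/31)"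
  define \<epsilon> :: real where "\<epsilon> = (1/2 + 20/31) - (8/7 + 1/2000)"
  have \<epsilon>: "0 < \<epsilon>" unfolding \<epsilon>_def by simp
  have D: "0 < D" unfolding D_def using C by simp
  show ?thesis
  proof (intro exI[of _ "max 64 (nat \<lceil>D powr (1 / \<epsilon>)\<rceil>)"] allI impI)
    fix n :: nat and P :: "(real ^ 2) set"
    assume n: "max 64 (nat \<lceil>D powr (1 / \<epsilon>)\<rceil>) \<le> n" and P: "finite P \<and> card P = n \<and> P \<subseteq> unit_square"
    have n64: "64 \<le> n" using n by simp
    have "D powr (1 / \<epsilon>) \<le> real n" using n by linarith
    then have "(D powr (1 / \<epsilon>)) powr \<epsilon> \<le> real n powr \<epsilon>" using \<epsilon> by (intro powr_mono2) auto
    then have Dn: "D \<le> real n powr \<epsilon>" using D \<epsilon> by (simp add: powr_powr)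
    define r where "r = sqrt (real n)"
    have r: "8 \<le> r" unfolding r_def using n64 by (intro real_le_rsqrt) simp
    have r2: "r * r = real n" unfolding r_def by simp
    \<comment> \<open>This gives (k + 1)^2 \<le> n / 4, and 4 l \<le> n / 2 for l = n div 8, so the
      n points are enough for the grid lemma.\<close>
    define k where "k = nat \<lfloor>r / 2\<rfloor> - 1"
    define l where "l = n div 8"
    have k1: "real (k + 1) \<le> r / 2" "r / 4 \<le> real k"
    proof -
      have "4 \<le> \<lfloor>r / 2\<rfloor>" using r by (simp add: le_floor_iff)
      then have "real (k + 1) = of_int \<lfloor>r / 2\<rfloor>" unfolding k_def by (simp add: of_nat_diff)
      then show "real (k + 1) \<le> r / 2" "r / 4 \<le> real k" using r by linarith+
    qed
    have k0: "0 < k" using k1(2) r by (cases k) auto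
    have "real ((k + 1)\<^sup>2) \<le> (r / 2)\<^sup>2" using k1(1) by (simp only: of_nat_power) (intro power_mono, auto)
    also have "\<dots> = real n / 4" using r2 by (simp add: power2_eq_square)
    finally have "4 * (k + 1)\<^sup>2 \<le> n" by linarith
    then have kl: "(k + 1)\<^sup>2 + 4 * l \<le> card P" using P unfolding l_def by linarith
    have l8: "8 \<le> l" unfolding l_def using n64 by linarith
    have l16: "real n / 16 \<le> real l"
    proof -
      have "n \<le> 16 * l" unfolding l_def using n64 by linarith
      then show ?thesis by linarith
    qed
    define \<rho> where "\<rho> = C * real l powr (- (20/31))"
    have nsep: "\<not> separated \<rho> X" if "finite X" "X \<subseteq> unit_flags" "l \<le> card X" for X
    proof
      assume "separated \<rho> X"
      moreover have "C * real (card X) powr (- (20/31)) \<le> \<rho>"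
        unfolding \<rho>_def using that l8 C by (intro mult_left_mono powr_mono2') auto
      ultimately show False using sep[of X] that l8 separated_mono by fastforce
    qed
    have "\<rho> / real k \<le> C * (real n / 16) powr (- (20/31)) / (r / 4)"
      unfolding \<rho>_def using l16 n64 k1(2) r C by (intro frac_le mult_left_mono powr_mono2') auto
    also have "\<dots> = D * (real n powr (- (20/31)) / r)"
      unfolding D_def by (simp add: powr_divide powr_minus field_simps)
    also have "r = real n powr (1/2)" unfolding r_def by (simp add: powr_half_sqrt)
    also have "D * (real n powr (- (20/31)) / real n powr (1/2)) = D * real n powr (- (20/31) - 1/2)" by (simp only: powr_diff)
    also have "\<dots> \<le> real n powr \<epsilon> * real n powr (- (20/31) - 1/2)" using Dn by (intro mult_right_mono) auto
    also have "\<dots> = real n powr (\<epsilon> + (- (20/31) - 1/2))" by (simp only: powr_add)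
    also have "\<epsilon> + (- (20/31) - 1/2) = - 8 / 7 - 1 / 2000" unfolding \<epsilon>_def by simp
    finally have "\<rho> / real k \<le> real n powr (- 8 / 7 - 1 / 2000)" .
    moreover have "\<exists>a\<in>P. \<exists>b\<in>P. \<exists>c\<in>P. a \<noteq> b \<and> a \<noteq> c \<and> b \<noteq> c \<and> triangle_area a b c \<le> \<rho> / real k"
      by (rule small_triangle_of_grid[OF _ _ k0 order_refl kl _ nsep]) (use P l8 in auto)
    ultimately show "\<exists>a\<in>P. \<exists>b\<in>P. \<exists>c\<in>P. a \<noteq> b \<and> a \<noteq> c \<and> b \<noteq> c \<and> triangle_area a b c \<le> real n powr (- 8 / 7 - 1 / 2000)"
      by (meson order_trans)
  qed
qed

end
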